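(* In the language of second-order arithmetic, let $\exists X\,\forall Y\,\Psi(X,Y)$ be a $\Sigma^1_2$ sentence such that $\Psi(X,Y)$ is a $\Pi^0_3$ formula. If $\mathrm{RCA}_0 + \exists X\,\forall Y\,\Psi(X,Y)$ is consistent, then $\mathrm{RCA}_0 + \exists X\,\forall Y\,\Psi(X,Y)$ does not prove $\mathrm{B}\Sigma^0_2$.
   Context: $\mathrm{RCA}_0$ is the standard base system of reverse mathematics (basic arithmetic axioms, $\Delta^0_1$ comprehension, and $\Sigma^0_1$ induction). For a $\Sigma^0_k$ formula $\Phi$ (possibly with free number and set variables), $\mathrm{B}\Sigma^0_k$ ($\Sigma^0_k$ bounding) is the scheme consisting of the universal closures of $(\forall i\,\exists j\,\Phi(i,j))\Rightarrow\forall m\,\exists n\,(\forall i<m)\,(\exists j<n)\,\Phi(i,j)$. *)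

theory Defs
  imports Main
begin

section \<open>The language of second-order arithmetic\<close>

text \<open>
  Variables are de Bruijn indices, counted separately for the two sorts: in \<^term>\<open>AllN p\<close> number
  variable 0 of \<^term>\<open>p\<close> is bound, in \<^term>\<open>AllS p\<close> set variable 0 of \<^term>\<open>p\<close> is bound. The only
  terms of set sort are variables, and equality is primitive for numbers only (equality of sets is
  defined by extensionality), as in Simpson's book on subsystems of second-order arithmetic.
\<close>

datatype trm = Var nat | Zero | One | Add trm trm | Mul trm trm

datatype fml =
    Eq trm trm
  | Lt trm trm
  | Mem trm nat
  | Fls
  | Imp fml fml
  | AllN fml
  | AllS fml

abbreviation Neg :: "fml \<Rightarrow> fml" where "Neg p \<equiv> Imp p Fls"
abbreviation Con :: "fml \<Rightarrow> fml \<Rightarrow> fml" where "Con p q \<equiv> Neg (Imp p (Neg q))"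
abbreviation Dis :: "fml \<Rightarrow> fml \<Rightarrow> fml" where "Dis p q \<equiv> Imp (Neg p) q"
abbreviation Iff :: "fml \<Rightarrow> fml \<Rightarrow> fml" where "Iff p q \<equiv> Con (Imp p q) (Imp q p)"
abbreviation ExN :: "fml \<Rightarrow> fml" where "ExN p \<equiv> Neg (AllN (Neg p))"
abbreviation ExS :: "fml \<Rightarrow> fml" where "ExS p \<equiv> Neg (AllS (Neg p))"

text \<open>Simultaneous capture-avoiding substitution of terms for the free number variables and of
  set variables for the free set variables.\<close>

primrec subst_trm :: "(nat \<Rightarrow> trm) \<Rightarrow> trm \<Rightarrow> trm" where
  "subst_trm f (Var i) = f i"
| "subst_trm f Zero = Zero"
| "subst_trm f One = One"
| "subst_trm f (Add s t) = Add (subst_trm f s) (subst_trm f t)"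
| "subst_trm f (Mul s t) = Mul (subst_trm f s) (subst_trm f t)"

abbreviation lift_trm :: "trm \<Rightarrow> trm" where
  "lift_trm \<equiv> subst_trm (\<lambda>i. Var (Suc i))"

primrec subst_fml :: "(nat \<Rightarrow> trm) \<Rightarrow> (nat \<Rightarrow> nat) \<Rightarrow> fml \<Rightarrow> fml" where
  "subst_fml f g (Eq s t) = Eq (subst_trm f s) (subst_trm f t)"
| "subst_fml f g (Lt s t) = Lt (subst_trm f s) (subst_trm f t)"
| "subst_fml f g (Mem t k) = Mem (subst_trm f t) (g k)"
| "subst_fml f g Fls = Fls"
| "subst_fml f g (Imp p q) = Imp (subst_fml f g p) (subst_fml f g q)"
| "subst_fml f g (AllN p) = AllN (subst_fml (case_nat (Var 0) (\<lambda>i. lift_trm (f i))) g p)"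
| "subst_fml f g (AllS p) = AllS (subst_fml f (case_nat 0 (\<lambda>k. Suc (g k))) p)"

definition liftN :: "fml \<Rightarrow> fml" where
  "liftN p = subst_fml (\<lambda>i. Var (Suc i)) (\<lambda>k. k) p"

definition liftS :: "fml \<Rightarrow> fml" where
  "liftS p = subst_fml Var Suc p"

definition instN :: "trm \<Rightarrow> fml \<Rightarrow> fml" where
  "instN t p = subst_fml (case_nat t Var) (\<lambda>k. k) p"

definition instS :: "nat \<Rightarrow> fml \<Rightarrow> fml" where
  "instS m p = subst_fml Var (case_nat m (\<lambda>k. k)) p"

text \<open>\<open>boundN p\<close> (\<open>boundS p\<close>) is the least \<open>n\<close> such that every free number (set) variable of \<open>p\<close>
  is less than \<open>n\<close>.\<close>

primrec boundN_trm :: "trm \<Rightarrow> nat" where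
  "boundN_trm (Var i) = Suc i"
| "boundN_trm Zero = 0"
| "boundN_trm One = 0"
| "boundN_trm (Add s t) = max (boundN_trm s) (boundN_trm t)"
| "boundN_trm (Mul s t) = max (boundN_trm s) (boundN_trm t)"

primrec boundN :: "fml \<Rightarrow> nat" where
  "boundN (Eq s t) = max (boundN_trm s) (boundN_trm t)"
| "boundN (Lt s t) = max (boundN_trm s) (boundN_trm t)"
| "boundN (Mem t k) = boundN_trm t"
| "boundN Fls = 0"
| "boundN (Imp p q) = max (boundN p) (boundN q)"
| "boundN (AllN p) = boundN p - 1"
| "boundN (AllS p) = boundN p"

primrec boundS :: "fml \<Rightarrow> nat" where
  "boundS (Eq s t) = 0"
| "boundS (Lt s t) = 0"
| "boundS (Mem t k) = Suc k"
| "boundS Fls = 0"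
| "boundS (Imp p q) = max (boundS p) (boundS q)"
| "boundS (AllN p) = boundS p"
| "boundS (AllS p) = boundS p - 1"

definition is_sentence :: "fml \<Rightarrow> bool" where
  "is_sentence p \<longleftrightarrow> boundN p = 0 \<and> boundS p = 0"

definition univ_closure :: "fml \<Rightarrow> fml" where
  "univ_closure p = (AllN ^^ boundN p) ((AllS ^^ boundS p) p)"


section \<open>Provability\<close>

text \<open>Natural deduction for two-sorted classical first-order logic with equality on the number
  sort. Lifting the assumptions in the introduction rules for the quantifiers is the eigenvariable
  condition.\<close>

inductive derives :: "fml set \<Rightarrow> fml \<Rightarrow> bool" (infix \<open>\<turnstile>\<close> 50) where
  Assm: "p \<in> T \<Longrightarrow> T \<turnstile> p"
| ImpI: "insert p T \<turnstile> q \<Longrightarrow> T \<turnstile> Imp p q"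
| ImpE: "T \<turnstile> Imp p q \<Longrightarrow> T \<turnstile> p \<Longrightarrow> T \<turnstile> q"
| Contr: "insert (Neg p) T \<turnstile> Fls \<Longrightarrow> T \<turnstile> p"
| AllNI: "liftN ` T \<turnstile> p \<Longrightarrow> T \<turnstile> AllN p"
| AllNE: "T \<turnstile> AllN p \<Longrightarrow> T \<turnstile> instN t p"
| AllSI: "liftS ` T \<turnstile> p \<Longrightarrow> T \<turnstile> AllS p"
| AllSE: "T \<turnstile> AllS p \<Longrightarrow> T \<turnstile> instS m p"
| EqRefl: "T \<turnstile> Eq t t"
| EqSubst: "T \<turnstile> Eq s t \<Longrightarrow> T \<turnstile> instN s p \<Longrightarrow> T \<turnstile> instN t p"

definition is_consistent :: "fml set \<Rightarrow> bool" where
  "is_consistent T \<longleftrightarrow> \<not> T \<turnstile> Fls"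

definition proves_scheme :: "fml set \<Rightarrow> fml set \<Rightarrow> bool" where
  "proves_scheme T S \<longleftrightarrow> (\<forall>p\<in>S. T \<turnstile> p)"


section \<open>The arithmetical hierarchy\<close>

abbreviation BAll :: "trm \<Rightarrow> fml \<Rightarrow> fml" where
  "BAll t p \<equiv> AllN (Imp (Lt (Var 0) (lift_trm t)) p)"

abbreviation BEx :: "trm \<Rightarrow> fml \<Rightarrow> fml" where
  "BEx t p \<equiv> ExN (Con (Lt (Var 0) (lift_trm t)) p)"

inductive is_Delta00 :: "fml \<Rightarrow> bool" where
  "is_Delta00 (Eq s t)"
| "is_Delta00 (Lt s t)"
| "is_Delta00 (Mem t k)"
| "is_Delta00 Fls"
| "is_Delta00 p \<Longrightarrow> is_Delta00 q \<Longrightarrow> is_Delta00 (Imp p q)"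
| "is_Delta00 p \<Longrightarrow> is_Delta00 (BAll t p)"
| "is_Delta00 p \<Longrightarrow> is_Delta00 (BEx t p)"

inductive is_Sigma0 :: "nat \<Rightarrow> fml \<Rightarrow> bool" and is_Pi0 :: "nat \<Rightarrow> fml \<Rightarrow> bool" where
  "is_Delta00 p \<Longrightarrow> is_Sigma0 0 p"
| "is_Delta00 p \<Longrightarrow> is_Pi0 0 p"
| "is_Pi0 k p \<Longrightarrow> is_Sigma0 (Suc k) (ExN p)"
| "is_Sigma0 k p \<Longrightarrow> is_Pi0 (Suc k) (AllN p)"


section \<open>Axioms and schemes\<close>

definition basic_axioms :: "fml set" where
  "basic_axioms = univ_closure `
    {Neg (Eq (Add (Var 0) One) Zero),
     Imp (Eq (Add (Var 0) One) (Add (Var 1) One)) (Eq (Var 0) (Var 1)),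
     Eq (Add (Var 0) Zero) (Var 0),
     Eq (Add (Var 0) (Add (Var 1) One)) (Add (Add (Var 0) (Var 1)) One),
     Eq (Mul (Var 0) Zero) Zero,
     Eq (Mul (Var 0) (Add (Var 1) One)) (Add (Mul (Var 0) (Var 1)) (Var 0)),
     Neg (Lt (Var 0) Zero),
     Iff (Lt (Var 0) (Add (Var 1) One)) (Dis (Lt (Var 0) (Var 1)) (Eq (Var 0) (Var 1)))}"

text \<open>In \<open>induction_fml p\<close> the induction variable is number variable 0 of \<open>p\<close>.\<close>

definition induction_fml :: "fml \<Rightarrow> fml" where
  "induction_fml p =
     Imp (Con (instN Zero p)
              (AllN (Imp p (subst_fml (case_nat (Add (Var 0) One) (\<lambda>i. Var (Suc i))) (\<lambda>k. k) p))))
         (AllN p)"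

text \<open>\<open>comprehension_fml p q\<close> is
  \<open>\<forall>n (p(n) \<longleftrightarrow> q(n)) \<longrightarrow> \<exists>X \<forall>n (n \<in> X \<longleftrightarrow> p(n))\<close>, with \<open>n\<close> number variable 0 of \<open>p\<close> and \<open>q\<close>. The
  lifting of \<open>p\<close> expresses that \<open>X\<close> is not free in \<open>p\<close>.\<close>

definition comprehension_fml :: "fml \<Rightarrow> fml \<Rightarrow> fml" where
  "comprehension_fml p q =
     Imp (AllN (Iff p q)) (ExS (AllN (Iff (Mem (Var 0) 0) (liftS p))))"

definition RCA0 :: "fml set" where
  "RCA0 = basic_axioms
     \<union> {univ_closure (induction_fml p) | p. is_Sigma0 1 p}
     \<union> {univ_closure (comprehension_fml p q) | p q. is_Sigma0 1 p \<and> is_Pi0 1 q}"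

text \<open>\<open>bounding_fml p\<close> is
  \<open>(\<forall>i \<exists>j p(i,j)) \<longrightarrow> (\<forall>m \<exists>n (\<forall>i<m) (\<exists>j<n) p(i,j))\<close>, where \<open>j\<close> and \<open>i\<close> are the number variables
  0 and 1 of \<open>p\<close>. In the conclusion the variables 0, 1, 2, 3 of the matrix are \<open>j\<close>, \<open>i\<close>, \<open>n\<close>, \<open>m\<close>,
  so the parameters of \<open>p\<close> move up by 2.\<close>

definition bounding_fml :: "fml \<Rightarrow> fml" where
  "bounding_fml p =
     Imp (AllN (ExN p))
         (AllN (ExN (BAll (Var 1) (BEx (Var 1)
           (subst_fml (\<lambda>i. Var (if i < 2 then i else i + 2)) (\<lambda>k. k) p)))))"

definition BSigma0 :: "nat \<Rightarrow> fml set" where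
  "BSigma0 k = {univ_closure (bounding_fml p) | p. is_Sigma0 k p}"

end

theory Submission
  imports Defs "HOL-Library.Countable"
begin

text \<open>
  By compactness there are a model \<open>(D, S)\<close> of \<open>RCA\<^sub>0\<close>, a set \<open>A \<in> S\<close> with \<open>\<Psi>(A, Y)\<close> for all
  \<open>Y \<in> S\<close>, a nonstandard \<open>c \<in> D\<close>, and a set \<open>T \<in> S\<close> such that every \<open>\<Pi>\<^sup>0\<^sub>1(A, T; c)\<close> class is
  \<open>{t. \<forall>s \<langle>n,t,s\<rangle> \<in> T}\<close> for some standard \<open>n\<close>. For finitely many of these classes such a \<open>T\<close> is
  defined by recursion, which avoids an arithmetized truth definition. Let \<open>K\<close> be the set of first
  components of least elements of non-empty \<open>\<Pi>\<^sup>0\<^sub>1(A, T; c)\<close> classes, and equip it with the sets of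
  \<open>S\<close> that are \<open>\<Delta>\<^sup>0\<^sub>1(A, T)\<close> with parameters from \<open>K\<close>. Then \<open>K\<close> is \<open>\<Sigma>\<^sup>0\<^sub>2\<close>-elementary in \<open>D\<close>, so it
  inherits \<open>RCA\<^sub>0\<close> and the \<open>\<Pi>\<^sup>0\<^sub>3\<close> statements \<open>\<Psi>(A, Y)\<close>. Every element of \<open>K\<close> has an index below \<open>c\<close>,
  and an index determines at most one element. Under \<open>B\<Sigma>\<^sup>0\<^sub>2\<close> the witnesses for the indices of all codes
  of subsets of \<open>{i. i < c}\<close> would be bounded, and then the set of the \<open>i < c\<close> that are not in the set
  coded by the element with index \<open>i\<close> would have a code, which is contradictory.
\<close>

text \<open>Sigma^0_2 elementarity is the level that fits: both a failing step of a Sigma^0_1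
  induction and a failing Delta^0_1 equivalence are Sigma^0_2 events, so they are reflected into
  \<open>K\<close>. The sets of the hull have to stay in \<open>S\<close>, because
  \<open>\<Psi>\<close> is known only for those, and have to be Delta^0_1 in \<open>A\<close> and
  \<open>T\<close>, so that using them as parameters does not raise the complexity of a formula.

  A least number principle for Sigma^0_2 formulas is not at hand, so a Sigma^0_2 witness cannot be
  minimized by itself. Minimizing the pair of the witness and an auxiliary number needs only the
  Pi^0_1 least number principle; this is why \<open>K\<close> collects first components.

  The classes may mention \<open>T\<close> itself, since the relation between indices and elements
  is expressed through \<open>T\<close> and the hull has to reflect it. The genuine indices are
  standard, but standardness cannot be expressed inside the model. The internal relation therefore
  admits every \<open>i\<close> below \<open>c\<close>, and uniqueness is proved for nonstandard
  indices too.\<close>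

instance trm :: countable by countable_datatype
instance fml :: countable by countable_datatype

abbreviation cons_env :: "'a \<Rightarrow> (nat \<Rightarrow> 'a) \<Rightarrow> nat \<Rightarrow> 'a" (infixr \<open>##\<close> 65) where
  "x ## e \<equiv> case_nat x e"

section \<open>Substitution\<close>

lemma subst_trm_comp: "subst_trm f (subst_trm h t) = subst_trm (\<lambda>i. subst_trm f (h i)) t"
  by (induction t) auto

lemma subst_trm_Var: "subst_trm Var t = t"
  by (induction t) auto

lemma subst_trm_cong: "(\<And>i. i < boundN_trm t \<Longrightarrow> f i = h i) \<Longrightarrow> subst_trm f t = subst_trm h t"
  by (induction t) auto

lemma subst_fml_cong:
  "(\<And>i. i < boundN p \<Longrightarrow> f i = f' i) \<Longrightarrow> (\<And>k. k < boundS p \<Longrightarrow> g k = g' k)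
   \<Longrightarrow> subst_fml f g p = subst_fml f' g' p"
proof (induction p arbitrary: f f' g g')
  case (AllN p)
  show ?case
    by (simp, rule AllN.IH) (use AllN.prems in \<open>auto split: nat.split\<close>)
next
  case (AllS p)
  show ?case
    by (simp, rule AllS.IH) (use AllS.prems in \<open>auto split: nat.split\<close>)
next
  case (Imp p q)
  have "subst_fml f g p = subst_fml f' g' p" "subst_fml f g q = subst_fml f' g' q"
    by (rule Imp.IH; use Imp.prems in auto)+
  then show ?case by simp
qed (auto intro: subst_trm_cong)

lemma subst_fml_comp:
  "subst_fml f g (subst_fml f' g' p) = subst_fml (\<lambda>i. subst_trm f (f' i)) (\<lambda>k. g (g' k)) p"
proof (induction p arbitrary: f f' g g')
  case (AllN p)
  have "(\<lambda>i. subst_trm (Var 0 ## (\<lambda>i. lift_trm (f i))) ((Var 0 ## (\<lambda>i. lift_trm (f' i))) i))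
     = Var 0 ## (\<lambda>i. lift_trm (subst_trm f (f' i)))"
    by (auto simp: fun_eq_iff subst_trm_comp split: nat.split)
  then show ?case by (simp add: AllN.IH)
next
  case (AllS p)
  have "(\<lambda>k. (0 ## (\<lambda>k. Suc (g k))) ((0 ## (\<lambda>k. Suc (g' k))) k))
     = 0 ## (\<lambda>k. Suc (g (g' k)))"
    by (auto simp: fun_eq_iff split: nat.split)
  then show ?case by (simp add: AllS.IH)
qed (auto simp: subst_trm_comp)

lemma subst_fml_Var: "subst_fml Var (\<lambda>k. k) p = p"
proof (induction p)
  case (AllN p)
  have "Var 0 ## (\<lambda>i. lift_trm (Var i)) = Var"
    by (auto simp: fun_eq_iff split: nat.split)
  then show ?case using AllN by simp
next
  case (AllS p)
  have "0 ## (\<lambda>k. Suc k) = (\<lambda>k. k)"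
    by (auto simp: fun_eq_iff split: nat.split)
  then show ?case using AllS by simp
qed (auto simp: subst_trm_Var)

lemma subst_liftN:
  "subst_fml (Var 0 ## (\<lambda>i. lift_trm (f i))) g (liftN p) = liftN (subst_fml f g p)"
  by (simp add: liftN_def subst_fml_comp)

lemma subst_liftS:
  "subst_fml f (0 ## (\<lambda>k. Suc (g k))) (liftS p) = liftS (subst_fml f g p)"
  by (simp add: liftS_def subst_fml_comp subst_trm_Var)

lemma subst_instN:
  "subst_fml f g (instN t p)
   = instN (subst_trm f t) (subst_fml (Var 0 ## (\<lambda>i. lift_trm (f i))) g p)"
proof -
  have "(\<lambda>i. subst_trm f ((t ## Var) i))
    = (\<lambda>i. subst_trm (subst_trm f t ## Var) ((Var 0 ## (\<lambda>i. lift_trm (f i))) i))"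
    by (auto simp: fun_eq_iff subst_trm_comp subst_trm_Var split: nat.split)
  then show ?thesis by (simp add: instN_def subst_fml_comp)
qed

lemma subst_instS:
  "subst_fml f g (instS m p)
   = instS (g m) (subst_fml f (0 ## (\<lambda>k. Suc (g k))) p)"
proof -
  have "(\<lambda>k. g ((m ## (\<lambda>k. k)) k))
    = (\<lambda>k. (g m ## (\<lambda>k. k)) ((0 ## (\<lambda>k. Suc (g k))) k))"
    by (auto simp: fun_eq_iff split: nat.split)
  then show ?thesis by (simp add: instS_def subst_fml_comp subst_trm_Var)
qed

section \<open>Derivations\<close>

text \<open>The substitution is arbitrary because the quantifier rules change it under a binder. Its
  purpose is renaming: a derivation about a fresh variable becomes one about the bound
  variable.\<close>

lemma derives_subst: "T \<turnstile> p \<Longrightarrow> subst_fml f g ` T \<turnstile> subst_fml f g p"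
proof (induction arbitrary: f g rule: derives.induct)
  case (AllNI T p)
  have "liftN ` subst_fml f g ` T = subst_fml (Var 0 ## (\<lambda>i. lift_trm (f i))) g ` liftN ` T"
    by (simp add: image_image subst_liftN)
  then show ?case using AllNI.IH by (simp add: derives.AllNI)
next
  case (AllSI T p)
  have "liftS ` subst_fml f g ` T = subst_fml f (0 ## (\<lambda>k. Suc (g k))) ` liftS ` T"
    by (simp add: image_image subst_liftS)
  then show ?case using AllSI.IH by (simp add: derives.AllSI)
next
  case (AllNE T p t)
  then show ?case by (simp add: subst_instN derives.AllNE)
next
  case (AllSE T p m)
  then show ?case by (simp add: subst_instS derives.AllSE)
next
  case (EqSubst T s t p)
  show ?case
    using EqSubst.IH[of f g] unfolding subst_instN subst_fml.simps(1) by (rule derives.EqSubst)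
next
  case (ImpE T p q)
  show ?case using ImpE.IH[of f g] unfolding subst_fml.simps(5) by (rule derives.ImpE)
next
  case (Contr p T)
  then show ?case by (simp add: derives.Contr)
next
  case (ImpI p T q)
  then show ?case by (simp add: derives.ImpI)
qed (simp_all add: derives.Assm derives.EqRefl)

lemma derives_mono: "T \<turnstile> p \<Longrightarrow> T \<subseteq> T' \<Longrightarrow> T' \<turnstile> p"
proof (induction arbitrary: T' rule: derives.induct)
  case (ImpI p T q)
  then show ?case by (meson derives.ImpI insert_mono)
next
  case (Contr p T)
  then show ?case by (meson derives.Contr insert_mono)
next
  case (AllNI T p)
  then show ?case by (meson derives.AllNI image_mono)
next
  case (AllSI T p)
  then show ?case by (meson derives.AllSI image_mono)
next
  case (ImpE T p q)
  then show ?case by (meson derives.ImpE)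
next
  case (EqSubst T s t p)
  then show ?case by (meson derives.EqSubst)
qed (auto intro: derives.Assm derives.AllNE derives.AllSE derives.EqRefl)

lemma derives_finite: "T \<turnstile> p \<Longrightarrow> \<exists>F. finite F \<and> F \<subseteq> T \<and> F \<turnstile> p"
proof (induction rule: derives.induct)
  case (Assm p T)
  then show ?case by (intro exI[of _ "{p}"]) (auto intro: derives.Assm)
next
  case (ImpI p T q)
  then obtain F where "finite F" "F \<subseteq> insert p T" "F \<turnstile> q" by blast
  then show ?case
    by (intro exI[of _ "F - {p}"]) (auto intro!: derives.ImpI elim: derives_mono)
next
  case (ImpE T p q)
  then obtain F G where "finite F" "F \<subseteq> T" "F \<turnstile> Imp p q" "finite G" "G \<subseteq> T" "G \<turnstile> p" by blast
  then show ?case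
    by (intro exI[of _ "F \<union> G"]) (auto intro!: derives.ImpE[of _ p q] elim: derives_mono)
next
  case (Contr p T)
  then obtain F where "finite F" "F \<subseteq> insert (Neg p) T" "F \<turnstile> Fls" by blast
  then show ?case
    by (intro exI[of _ "F - {Neg p}"]) (auto intro!: derives.Contr[of p] elim: derives_mono)
next
  case (AllNI T p)
  then obtain F where F: "finite F" "F \<subseteq> liftN ` T" "F \<turnstile> p" by blast
  then obtain G where "G \<subseteq> T" "finite G" "F = liftN ` G" by (meson finite_subset_image)
  then show ?case using F derives.AllNI by blast
next
  case (AllSI T p)
  then obtain F where F: "finite F" "F \<subseteq> liftS ` T" "F \<turnstile> p" by blast
  then obtain G where "G \<subseteq> T" "finite G" "F = liftS ` G" by (meson finite_subset_image)
  then show ?case using F derives.AllSI by blast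
next
  case (EqRefl T t)
  then show ?case by (intro exI[of _ "{}"]) (auto intro: derives.EqRefl)
next
  case (EqSubst T s t p)
  then obtain F G where "finite F" "F \<subseteq> T" "F \<turnstile> Eq s t" "finite G" "G \<subseteq> T" "G \<turnstile> instN s p" by blast
  then show ?case
    by (intro exI[of _ "F \<union> G"]) (auto intro!: derives.EqSubst[of _ s t] elim: derives_mono)
next
  case (AllNE T p t)
  then show ?case by (meson derives.AllNE)
next
  case (AllSE T p t)
  then show ?case by (meson derives.AllSE)
qed

section \<open>Cut and generalization over fresh variables\<close>

lemma derives_cut: "insert q T \<turnstile> p \<Longrightarrow> T \<turnstile> q \<Longrightarrow> T \<turnstile> p"
  using derives.ImpE derives.ImpI by blast

text \<open>The rule \<open>AllNI\<close> has no named eigenvariable, so the fresh variable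
  \<open>k\<close> is renamed to index 0 while all others are shifted. On formulas without
  \<open>k\<close> this renaming is the lifting that the rule demands.\<close>

lemma derives_generalizeN:
  assumes "T \<turnstile> instN (Var k) p" "\<And>q. q \<in> insert (AllN p) T \<Longrightarrow> boundN q \<le> k"
  shows "T \<turnstile> AllN p"
proof (rule derives.AllNI)
  define f where "f = (\<lambda>i. if i = k then Var 0 else Var (Suc i))"
  have "subst_fml f (\<lambda>k. k) ` T = liftN ` T"
  proof (rule image_cong[OF refl])
    fix q assume "q \<in> T"
    then have "boundN q \<le> k" using assms(2) by blast
    then show "subst_fml f (\<lambda>k. k) q = liftN q"
      unfolding liftN_def by (intro subst_fml_cong) (auto simp: f_def)
  qed
  moreover have "subst_fml f (\<lambda>k. k) (instN (Var k) p) = p"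
  proof -
    have "subst_fml f (\<lambda>k. k) (instN (Var k) p) = subst_fml Var (\<lambda>k. k) p"
      unfolding instN_def subst_fml_comp
    proof (rule subst_fml_cong)
      fix i assume "i < boundN p"
      moreover have "boundN p - 1 \<le> k" using assms(2)[of "AllN p"] by simp
      ultimately show "subst_trm f ((Var k ## Var) i) = Var i"
        by (cases i) (auto simp: f_def)
    qed simp
    then show ?thesis by (simp add: subst_fml_Var)
  qed
  ultimately show "liftN ` T \<turnstile> p" using derives_subst[OF assms(1)] by metis
qed

lemma derives_generalizeS:
  assumes "T \<turnstile> instS k p" "\<And>q. q \<in> insert (AllS p) T \<Longrightarrow> boundS q \<le> k"
  shows "T \<turnstile> AllS p"
proof (rule derives.AllSI)
  define g where "g = (\<lambda>i. if i = k then 0 else Suc i)"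
  have "subst_fml Var g ` T = liftS ` T"
  proof (rule image_cong[OF refl])
    fix q assume "q \<in> T"
    then have "boundS q \<le> k" using assms(2) by blast
    then show "subst_fml Var g q = liftS q"
      unfolding liftS_def by (intro subst_fml_cong) (auto simp: g_def)
  qed
  moreover have "subst_fml Var g (instS k p) = p"
  proof -
    have "subst_fml Var g (instS k p) = subst_fml Var (\<lambda>k. k) p"
      unfolding instS_def subst_fml_comp
    proof (rule subst_fml_cong)
      fix i assume "i < boundS p"
      moreover have "boundS p - 1 \<le> k" using assms(2)[of "AllS p"] by simp
      ultimately show "g ((k ## (\<lambda>k. k)) i) = i"
        by (cases i) (auto simp: g_def)
    qed (simp add: subst_trm_Var)
    then show ?thesis by (simp add: subst_fml_Var)
  qed
  ultimately show "liftS ` T \<turnstile> p" using derives_subst[OF assms(1)] by metis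
qed

lemma boundN_AllN_power: "boundN ((AllN ^^ n) p) = boundN p - n"
  by (induction n) auto
lemma boundN_AllS_power: "boundN ((AllS ^^ n) p) = boundN p"
  by (induction n) auto
lemma boundS_AllN_power: "boundS ((AllN ^^ n) p) = boundS p"
  by (induction n) auto
lemma boundS_AllS_power: "boundS ((AllS ^^ n) p) = boundS p - n"
  by (induction n) auto

lemma bound_univ_closure: "boundN (univ_closure p) = 0" "boundS (univ_closure p) = 0"
  by (simp_all add: univ_closure_def boundN_AllN_power boundN_AllS_power boundS_AllN_power
      boundS_AllS_power)

section \<open>Structures and soundness\<close>

text \<open>A structure consists of the operations fixed in the locale, a domain \<open>D\<close> and a family \<open>S\<close> of
  sets. Only the traces on \<open>D\<close> of the members of \<open>S\<close> matter, so that a substructure can reuse the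
  operations and the sets of the larger structure.\<close>

locale ops =
  fixes zero :: 'm (\<open>\<zero>\<close>) and one :: 'm (\<open>\<one>\<close>)
    and add :: "'m \<Rightarrow> 'm \<Rightarrow> 'm" (infixl \<open>\<oplus>\<close> 65)
    and mul :: "'m \<Rightarrow> 'm \<Rightarrow> 'm" (infixl \<open>\<odot>\<close> 70)
    and less :: "'m \<Rightarrow> 'm \<Rightarrow> bool" (infix \<open>\<prec>\<close> 50)
begin

primrec val :: "(nat \<Rightarrow> 'm) \<Rightarrow> trm \<Rightarrow> 'm" where
  "val e (Var i) = e i"
| "val e Zero = \<zero>"
| "val e One = \<one>"
| "val e (Add s t) = val e s \<oplus> val e t"
| "val e (Mul s t) = val e s \<odot> val e t"

primrec sat :: "'m set \<Rightarrow> 'm set set \<Rightarrow> (nat \<Rightarrow> 'm) \<Rightarrow> (nat \<Rightarrow> 'm set) \<Rightarrow> fml \<Rightarrow> bool" where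
  "sat D S e \<sigma> (Eq s t) \<longleftrightarrow> val e s = val e t"
| "sat D S e \<sigma> (Lt s t) \<longleftrightarrow> val e s \<prec> val e t"
| "sat D S e \<sigma> (Mem t k) \<longleftrightarrow> val e t \<in> \<sigma> k"
| "sat D S e \<sigma> Fls \<longleftrightarrow> False"
| "sat D S e \<sigma> (Imp p q) \<longleftrightarrow> (sat D S e \<sigma> p \<longrightarrow> sat D S e \<sigma> q)"
| "sat D S e \<sigma> (AllN p) \<longleftrightarrow> (\<forall>x\<in>D. sat D S (x ## e) \<sigma> p)"
| "sat D S e \<sigma> (AllS p) \<longleftrightarrow> (\<forall>X\<in>S. sat D S e (X ## \<sigma>) p)"

definition closed_dom :: "'m set \<Rightarrow> bool" where
  "closed_dom D \<longleftrightarrow> \<zero> \<in> D \<and> \<one> \<in> D \<and> (\<forall>x\<in>D. \<forall>y\<in>D. x \<oplus> y \<in> D \<and> x \<odot> y \<in> D)"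

lemma val_subst: "val e (subst_trm f t) = val (\<lambda>i. val e (f i)) t"
  by (induction t) auto

lemma val_lift: "val (x ## e) (lift_trm t) = val e t"
  by (simp add: val_subst)

lemma val_cong: "(\<And>i. i < boundN_trm t \<Longrightarrow> e i = e' i) \<Longrightarrow> val e t = val e' t"
  by (induction t) auto

lemma sat_cong:
  "(\<And>i. i < boundN p \<Longrightarrow> e i = e' i) \<Longrightarrow> (\<And>k. k < boundS p \<Longrightarrow> \<sigma> k = \<sigma>' k)
   \<Longrightarrow> sat D S e \<sigma> p = sat D S e' \<sigma>' p"
proof (induction p arbitrary: e e' \<sigma> \<sigma>')
  case (AllN p)
  have "sat D S (x ## e) \<sigma> p = sat D S (x ## e') \<sigma>' p" for x
    by (rule AllN.IH) (use AllN.prems in \<open>auto split: nat.split\<close>)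
  then show ?case by simp
next
  case (AllS p)
  have "sat D S e (X ## \<sigma>) p = sat D S e' (X ## \<sigma>') p" for X
    by (rule AllS.IH) (use AllS.prems in \<open>auto split: nat.split\<close>)
  then show ?case by simp
next
  case (Imp p q)
  have "sat D S e \<sigma> p = sat D S e' \<sigma>' p" "sat D S e \<sigma> q = sat D S e' \<sigma>' q"
    by (rule Imp.IH; use Imp.prems in auto)+
  then show ?case by simp
next
  case (Eq s t)
  then have "val e s = val e' s" "val e t = val e' t" by (auto intro!: val_cong)
  then show ?case by simp
next
  case (Lt s t)
  then have "val e s = val e' s" "val e t = val e' t" by (auto intro!: val_cong)
  then show ?case by simp
next
  case (Mem t k)
  then have "val e t = val e' t" by (auto intro!: val_cong)
  then show ?case using Mem by simp
qed auto

lemma sat_subst: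
  "sat D S e \<sigma> (subst_fml f g p) = sat D S (\<lambda>i. val e (f i)) (\<lambda>k. \<sigma> (g k)) p"
proof (induction p arbitrary: e \<sigma> f g)
  case (AllN p)
  have "(\<lambda>i. val (x ## e) ((Var 0 ## (\<lambda>i. lift_trm (f i))) i))
      = x ## (\<lambda>i. val e (f i))" for x
    by (auto simp: fun_eq_iff val_lift split: nat.split)
  then show ?case by (simp add: AllN.IH)
next
  case (AllS p)
  have "(\<lambda>k. (X ## \<sigma>) ((0 ## (\<lambda>k. Suc (g k))) k)) = X ## (\<lambda>k. \<sigma> (g k))" for X
    by (auto simp: fun_eq_iff split: nat.split)
  then show ?case by (simp add: AllS.IH)
qed (auto simp: val_subst)

lemma case_nat_val: "(\<lambda>i. val e ((t ## Var) i)) = val e t ## e"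
  by (auto simp: fun_eq_iff split: nat.split)

lemma sat_instN: "sat D S e \<sigma> (instN t p) = sat D S (val e t ## e) \<sigma> p"
  by (simp add: instN_def sat_subst case_nat_val)

lemma sat_instS: "sat D S e \<sigma> (instS m p) = sat D S e (\<sigma> m ## \<sigma>) p"
proof -
  have "(\<lambda>k. \<sigma> ((m ## (\<lambda>k. k)) k)) = \<sigma> m ## \<sigma>"
    by (auto simp: fun_eq_iff split: nat.split)
  then show ?thesis by (simp add: instS_def sat_subst)
qed

lemma sat_liftN: "sat D S (x ## e) \<sigma> (liftN p) = sat D S e \<sigma> p"
  by (simp add: liftN_def sat_subst)

lemma sat_liftS: "sat D S e (X ## \<sigma>) (liftS p) = sat D S e \<sigma> p"
  by (simp add: liftS_def sat_subst)

lemma val_closed: "closed_dom D \<Longrightarrow> (\<And>i. e i \<in> D) \<Longrightarrow> val e t \<in> D"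
  by (induction t) (auto simp: closed_dom_def)

lemma case_nat_in: "x \<in> D \<Longrightarrow> (\<And>i. e i \<in> D) \<Longrightarrow> (x ## e) i \<in> D"
  by (cases i) auto

theorem soundness:
  assumes "T \<turnstile> p" "closed_dom D" "\<And>i. e i \<in> D" "\<And>k. \<sigma> k \<in> S" "\<And>q. q \<in> T \<Longrightarrow> sat D S e \<sigma> q"
  shows "sat D S e \<sigma> p"
  using assms
proof (induction arbitrary: e \<sigma> rule: derives.induct)
  case (AllNI T p)
  have "sat D S (x ## e) \<sigma> p" if "x \<in> D" for x
    by (rule AllNI.IH) (use AllNI.prems that in \<open>auto simp: sat_liftN intro!: case_nat_in\<close>)
  then show ?case by simp
next
  case (AllSI T p)
  have "sat D S e (X ## \<sigma>) p" if "X \<in> S" for X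
    by (rule AllSI.IH) (use AllSI.prems that in \<open>auto simp: sat_liftS split: nat.split\<close>)
  then show ?case by simp
next
  case (AllNE T p t)
  then have "sat D S e \<sigma> (AllN p)" by blast
  then show ?case using AllNE.prems val_closed by (simp add: sat_instN)
next
  case (AllSE T p m)
  then have "sat D S e \<sigma> (AllS p)" by blast
  then show ?case using AllSE.prems by (simp add: sat_instS)
next
  case (EqSubst T s t p)
  then have "sat D S e \<sigma> (Eq s t)" "sat D S e \<sigma> (instN s p)" by blast+
  then show ?case by (simp add: sat_instN)
next
  case (Contr p T)
  then show ?case by (metis insert_iff sat.simps(4,5))
next
  case (ImpI p T q)
  then show ?case by (metis insert_iff sat.simps(5))
qed auto

text \<open>Quantifying over all environments absorbs the quantifiers one at a time, since an
  environment splits into its head and its tail.\<close>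

lemma all_envs_AllN_power:
  "(\<forall>e. (\<forall>i. e i \<in> D) \<longrightarrow> sat D S e \<sigma> ((AllN ^^ n) p)) \<longleftrightarrow> (\<forall>e. (\<forall>i. e i \<in> D) \<longrightarrow> sat D S e \<sigma> p)"
proof (induction n)
  case (Suc n)
  have "(\<forall>e. (\<forall>i. e i \<in> D) \<longrightarrow> sat D S e \<sigma> (AllN q)) \<longleftrightarrow> (\<forall>e. (\<forall>i. e i \<in> D) \<longrightarrow> sat D S e \<sigma> q)" for q
  proof (intro iffI allI impI)
    fix e :: "nat \<Rightarrow> 'm" assume all: "\<forall>e. (\<forall>i. e i \<in> D) \<longrightarrow> sat D S e \<sigma> (AllN q)" and e: "\<forall>i. e i \<in> D"
    have "sat D S (e 0 ## (\<lambda>i. e (Suc i))) \<sigma> q" using all[rule_format, of "\<lambda>i. e (Suc i)"] e by simp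
    moreover have "e 0 ## (\<lambda>i. e (Suc i)) = e" by (auto simp: fun_eq_iff split: nat.split)
    ultimately show "sat D S e \<sigma> q" by simp
  next
    fix e :: "nat \<Rightarrow> 'm" assume all: "\<forall>e. (\<forall>i. e i \<in> D) \<longrightarrow> sat D S e \<sigma> q" and e: "\<forall>i. e i \<in> D"
    have "sat D S (x ## e) \<sigma> q" if "x \<in> D" for x
      by (rule all[rule_format]) (use e that in \<open>simp add: case_nat_in\<close>)
    then show "sat D S e \<sigma> (AllN q)" by simp
  qed
  then show ?case using Suc by simp
qed simp

lemma all_envs_AllS_power:
  "(\<forall>\<sigma>. (\<forall>k. \<sigma> k \<in> S) \<longrightarrow> sat D S e \<sigma> ((AllS ^^ n) p)) \<longleftrightarrow> (\<forall>\<sigma>. (\<forall>k. \<sigma> k \<in> S) \<longrightarrow> sat D S e \<sigma> p)"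
proof (induction n)
  case (Suc n)
  have "(\<forall>\<sigma>. (\<forall>k. \<sigma> k \<in> S) \<longrightarrow> sat D S e \<sigma> (AllS q)) \<longleftrightarrow> (\<forall>\<sigma>. (\<forall>k. \<sigma> k \<in> S) \<longrightarrow> sat D S e \<sigma> q)" for q
  proof (intro iffI allI impI)
    fix \<sigma> :: "nat \<Rightarrow> 'm set" assume all: "\<forall>\<sigma>. (\<forall>k. \<sigma> k \<in> S) \<longrightarrow> sat D S e \<sigma> (AllS q)" and \<sigma>: "\<forall>k. \<sigma> k \<in> S"
    have "sat D S e (\<sigma> 0 ## (\<lambda>k. \<sigma> (Suc k))) q" using all[rule_format, of "\<lambda>k. \<sigma> (Suc k)"] \<sigma> by simp
    moreover have "\<sigma> 0 ## (\<lambda>k. \<sigma> (Suc k)) = \<sigma>" by (auto simp: fun_eq_iff split: nat.split)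
    ultimately show "sat D S e \<sigma> q" by simp
  next
    fix \<sigma> :: "nat \<Rightarrow> 'm set" assume all: "\<forall>\<sigma>. (\<forall>k. \<sigma> k \<in> S) \<longrightarrow> sat D S e \<sigma> q" and \<sigma>: "\<forall>k. \<sigma> k \<in> S"
    have "sat D S e (X ## \<sigma>) q" if "X \<in> S" for X
      by (rule all[rule_format]) (use \<sigma> that in \<open>simp split: nat.split\<close>)
    then show "sat D S e \<sigma> (AllS q)" by simp
  qed
  then show ?case using Suc by simp
qed simp

lemma sat_univ_closure:
  assumes "\<And>i. e i \<in> D" "\<And>k. \<sigma> k \<in> S"
  shows "sat D S e \<sigma> (univ_closure p)
    \<longleftrightarrow> (\<forall>e' \<sigma>'. (\<forall>i. e' i \<in> D) \<longrightarrow> (\<forall>k. \<sigma>' k \<in> S) \<longrightarrow> sat D S e' \<sigma>' p)"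
proof -
  have "sat D S e' \<sigma>' (univ_closure p) = sat D S e \<sigma> (univ_closure p)" for e' \<sigma>'
    by (rule sat_cong) (simp_all add: bound_univ_closure)
  then have "sat D S e \<sigma> (univ_closure p) \<longleftrightarrow> (\<forall>\<sigma>'. (\<forall>k. \<sigma>' k \<in> S) \<longrightarrow>
      (\<forall>e'. (\<forall>i. e' i \<in> D) \<longrightarrow> sat D S e' \<sigma>' (univ_closure p)))"
    using assms by blast
  also have "\<dots> \<longleftrightarrow> (\<forall>e'. (\<forall>i. e' i \<in> D) \<longrightarrow>
      (\<forall>\<sigma>'. (\<forall>k. \<sigma>' k \<in> S) \<longrightarrow> sat D S e' \<sigma>' ((AllS ^^ boundS p) p)))"
    unfolding univ_closure_def all_envs_AllN_power by blast
  finally show ?thesis unfolding all_envs_AllS_power by blast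
qed

end

section \<open>Completeness\<close>

text \<open>Henkin witnesses are variables instead of new constants: \<open>k\<close> bounds the
  free variables in use, so the variable \<open>k\<close> is fresh. Only rejected universal formulas
  need a witness, because existential formulas are negated universal ones.\<close>

definition witness :: "fml set \<Rightarrow> fml \<Rightarrow> fml set" where
  "witness H \<phi> = (let k = (SOME k. \<forall>q\<in>insert \<phi> H. boundN q \<le> k \<and> boundS q \<le> k) in
     case \<phi> of AllN p \<Rightarrow> {Neg (instN (Var k) p)} | AllS p \<Rightarrow> {Neg (instS k p)} | _ \<Rightarrow> {})"

primrec henkin :: "fml set \<Rightarrow> nat \<Rightarrow> fml set" where
  "henkin T 0 = T"
| "henkin T (Suc n) = (let H = henkin T n; \<phi> = from_nat n in
     if is_consistent (insert \<phi> H) then insert \<phi> H else insert (Neg \<phi>) H \<union> witness H \<phi>)"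

text \<open>The invariant that supplies fresh variables. A stage adds at most two formulas, so a
  common bound on the free variables survives.\<close>

definition few_vars :: "fml set \<Rightarrow> bool" where
  "few_vars H \<longleftrightarrow> (\<exists>k. \<forall>q\<in>H. boundN q \<le> k \<and> boundS q \<le> k)"

lemma few_vars_insert: "few_vars (insert p H) \<longleftrightarrow> few_vars H"
proof
  assume "few_vars H"
  then obtain k where k: "\<forall>q\<in>H. boundN q \<le> k \<and> boundS q \<le> k" by (auto simp: few_vars_def)
  have "\<forall>q\<in>insert p H. boundN q \<le> max k (max (boundN p) (boundS p))
     \<and> boundS q \<le> max k (max (boundN p) (boundS p))"
    using k by fastforce
  then show "few_vars (insert p H)" unfolding few_vars_def by blast
qed (auto simp: few_vars_def)

lemma witness_cases: "witness H \<phi> = {} \<or> (\<exists>q. witness H \<phi> = {q})"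
  by (cases \<phi>) (auto simp: witness_def)

lemma few_vars_henkin: "few_vars T \<Longrightarrow> few_vars (henkin T n)"
proof (induction n)
  case (Suc n)
  then show ?case using witness_cases[of "henkin T n" "from_nat n"]
    by (auto simp: Let_def few_vars_insert)
qed auto

text \<open>If the witness were inconsistent with the rest, the instance at the fresh variable would
  be derivable, hence by generalization \<open>\<phi>\<close> itself; but \<open>\<phi>\<close> is
  already refuted by \<open>H\<close>.\<close>

lemma consistent_witness:
  assumes con: "is_consistent H" and few: "few_vars H" and incon: "\<not> is_consistent (insert \<phi> H)"
  shows "is_consistent (insert (Neg \<phi>) H \<union> witness H \<phi>)"
proof -
  define k where "k = (SOME k. \<forall>q\<in>insert \<phi> H. boundN q \<le> k \<and> boundS q \<le> k)"
  have k: "\<forall>q\<in>insert \<phi> H. boundN q \<le> k \<and> boundS q \<le> k"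
    unfolding k_def by (rule someI_ex) (use few few_vars_insert few_vars_def in metis)
  have neg: "H \<turnstile> Neg \<phi>" using incon by (auto simp: is_consistent_def intro: derives.ImpI)
  have main: "is_consistent (insert (Neg r) (insert (Neg \<phi>) H))"
    if gen: "H \<turnstile> r \<Longrightarrow> H \<turnstile> \<phi>" for r
  proof (rule ccontr)
    assume "\<not> is_consistent (insert (Neg r) (insert (Neg \<phi>) H))"
    then have "insert (Neg \<phi>) H \<turnstile> r" by (auto simp: is_consistent_def intro: derives.Contr)
    then have "H \<turnstile> \<phi>" using neg gen derives_cut by blast
    then show False using neg con derives.ImpE by (auto simp: is_consistent_def)
  qed
  have base: "is_consistent (insert (Neg \<phi>) H)"
    using neg con derives_cut by (auto simp: is_consistent_def)
  have w: "witness H \<phi> = (case \<phi> of AllN p \<Rightarrow> {Neg (instN (Var k) p)} | AllS p \<Rightarrow> {Neg (instS k p)} | _ \<Rightarrow> {})"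
    by (simp only: witness_def k_def Let_def)
  show ?thesis
  proof (cases \<phi>)
    case (AllN p)
    have "H \<turnstile> instN (Var k) p \<Longrightarrow> H \<turnstile> \<phi>"
      unfolding AllN by (rule derives_generalizeN) (use k AllN in auto)
    then show ?thesis
      using main[of "instN (Var k) p"] unfolding w by (simp add: AllN)
  next
    case (AllS p)
    have "H \<turnstile> instS k p \<Longrightarrow> H \<turnstile> \<phi>"
      unfolding AllS by (rule derives_generalizeS) (use k AllS in auto)
    then show ?thesis
      using main[of "instS k p"] unfolding w by (simp add: AllS)
  qed (use base in \<open>unfold w, simp_all\<close>)
qed

lemma consistent_henkin: "is_consistent T \<Longrightarrow> few_vars T \<Longrightarrow> is_consistent (henkin T n)"
proof (induction n)
  case (Suc n)
  then show ?case
    using consistent_witness[of "henkin T n" "from_nat n"] few_vars_henkin[of T n]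
    by (auto simp: Let_def)
qed auto

lemma henkin_mono: "m \<le> n \<Longrightarrow> henkin T m \<subseteq> henkin T n"
  by (rule lift_Suc_mono_le[of "henkin T"]) (auto simp: Let_def)

definition henkin_limit :: "fml set \<Rightarrow> fml set" where
  "henkin_limit T = (\<Union>n. henkin T n)"

context
  fixes T H
  assumes con: "is_consistent T" and few: "few_vars T" and H_def: "H = henkin_limit T"
begin

section \<open>The limit theory: consistency, completeness, deductive closure\<close>

lemma henkin_finite_subset: "finite F \<Longrightarrow> F \<subseteq> H \<Longrightarrow> \<exists>n. F \<subseteq> henkin T n"
proof (induction F rule: finite_induct)
  case (insert p F)
  then obtain m n where "F \<subseteq> henkin T n" "p \<in> henkin T m"
    by (auto simp: H_def henkin_limit_def)
  then have "insert p F \<subseteq> henkin T (max m n)"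
    using henkin_mono[of m "max m n" T] henkin_mono[of n "max m n" T] by auto
  then show ?case by blast
qed auto

lemma consistent_limit: "\<not> H \<turnstile> Fls"
proof
  assume "H \<turnstile> Fls"
  then obtain F where "finite F" "F \<subseteq> H" "F \<turnstile> Fls" using derives_finite by blast
  then obtain n where "henkin T n \<turnstile> Fls" using henkin_finite_subset derives_mono by meson
  then show False using consistent_henkin[OF con few, of n] by (simp add: is_consistent_def)
qed

lemma limit_complete: "p \<in> H \<or> Neg p \<in> H"
proof -
  have "p \<in> henkin T (Suc (to_nat p)) \<or> Neg p \<in> henkin T (Suc (to_nat p))"
    by (auto simp: Let_def)
  then show ?thesis unfolding H_def henkin_limit_def by blast
qed

lemma limit_deductive: "H \<turnstile> p \<longleftrightarrow> p \<in> H"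
  using limit_complete[of p] consistent_limit derives.ImpE[of H p Fls] derives.Assm[of _ H] by metis

lemma limit_Imp: "Imp p q \<in> H \<longleftrightarrow> (p \<in> H \<longrightarrow> q \<in> H)"
proof
  assume "Imp p q \<in> H" then show "p \<in> H \<longrightarrow> q \<in> H" using derives.ImpE limit_deductive by metis
next
  assume R: "p \<in> H \<longrightarrow> q \<in> H"
  show "Imp p q \<in> H"
  proof (cases "p \<in> H")
    case True
    then have "H \<turnstile> q" using R limit_deductive by blast
    then have "H \<turnstile> Imp p q" by (meson derives.ImpI derives_mono subset_insertI)
    then show ?thesis using limit_deductive by blast
  next
    case False
    then have "Neg p \<in> H" using limit_complete by blast
    then have "insert p H \<turnstile> Fls" by (intro derives.ImpE[of _ p Fls] derives.Assm) auto
    then have "insert (Neg q) (insert p H) \<turnstile> Fls" by (meson derives_mono subset_insertI)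
    then have "H \<turnstile> Imp p q" using derives.ImpI[OF derives.Contr] by metis
    then show ?thesis using limit_deductive by blast
  qed
qed

lemma limit_witness: "\<phi> \<notin> H \<Longrightarrow> \<exists>K. witness K \<phi> \<subseteq> H"
proof -
  assume "\<phi> \<notin> H"
  then have "\<phi> \<notin> henkin T (Suc (to_nat \<phi>))" unfolding H_def henkin_limit_def by blast
  then have "witness (henkin T (to_nat \<phi>)) \<phi> \<subseteq> henkin T (Suc (to_nat \<phi>))"
    by (auto simp: Let_def split: if_splits)
  then show ?thesis unfolding H_def henkin_limit_def by blast
qed

lemma limit_Neg: "Neg p \<in> H \<Longrightarrow> p \<notin> H"
  using limit_Imp[of p Fls] consistent_limit derives.Assm[of Fls H] by metis

lemma limit_AllN: "AllN p \<in> H \<longleftrightarrow> (\<forall>t. instN t p \<in> H)"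
proof
  assume "AllN p \<in> H" then show "\<forall>t. instN t p \<in> H" using derives.AllNE limit_deductive by metis
next
  assume R: "\<forall>t. instN t p \<in> H"
  show "AllN p \<in> H"
  proof (rule ccontr)
    assume "AllN p \<notin> H"
    then obtain t where "Neg (instN t p) \<in> H" using limit_witness by (fastforce simp: witness_def Let_def)
    then show False using R limit_Neg by blast
  qed
qed

lemma limit_AllS: "AllS p \<in> H \<longleftrightarrow> (\<forall>k. instS k p \<in> H)"
proof
  assume "AllS p \<in> H" then show "\<forall>k. instS k p \<in> H" using derives.AllSE limit_deductive by metis
next
  assume R: "\<forall>k. instS k p \<in> H"
  show "AllS p \<in> H"
  proof (rule ccontr)
    assume "AllS p \<notin> H"
    then obtain t where "Neg (instS t p) \<in> H" using limit_witness by (fastforce simp: witness_def Let_def)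
    then show False using R limit_Neg by blast
  qed
qed

section \<open>The term model and the truth lemma\<close>

lemma instN_lift [simp]: "subst_trm (t ## Var) (lift_trm s) = s"
  by (simp add: subst_trm_comp subst_trm_Var)

lemma limit_EqSubst: "Eq s t \<in> H \<Longrightarrow> instN s p \<in> H \<Longrightarrow> instN t p \<in> H"
  using derives.EqSubst limit_deductive by metis

lemma limit_refl: "Eq t t \<in> H"
  using derives.EqRefl limit_deductive by metis

lemma limit_sym: "Eq s t \<in> H \<Longrightarrow> Eq t s \<in> H"
  using limit_EqSubst[of s t "Eq (Var 0) (lift_trm s)"] limit_refl by (simp add: instN_def)

lemma limit_trans: "Eq s t \<in> H \<Longrightarrow> Eq t u \<in> H \<Longrightarrow> Eq s u \<in> H"
  using limit_EqSubst[of t u "Eq (lift_trm s) (Var 0)"] by (simp add: instN_def)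

definition cls :: "trm \<Rightarrow> trm set" where "cls t = {s. Eq t s \<in> H}"

definition rep :: "trm set \<Rightarrow> trm" where "rep X = (SOME t. t \<in> X)"

lemma cls_eq_iff: "cls s = cls t \<longleftrightarrow> Eq s t \<in> H"
proof
  assume "cls s = cls t"
  then show "Eq s t \<in> H" unfolding cls_def using limit_refl by blast
next
  assume "Eq s t \<in> H"
  then have "Eq s u \<in> H \<longleftrightarrow> Eq t u \<in> H" for u by (metis limit_sym limit_trans)
  then show "cls s = cls t" by (simp add: cls_def)
qed

lemma rep_cls: "Eq t (rep (cls t)) \<in> H"
proof -
  have "t \<in> cls t" by (simp add: cls_def limit_refl)
  then have "rep (cls t) \<in> cls t" unfolding rep_def by (rule someI)
  then show ?thesis by (simp add: cls_def)
qed

lemma limit_cong2: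
  assumes "Eq s s' \<in> H" "Eq t t' \<in> H"
  shows "Eq (Add s t) (Add s' t') \<in> H" "Eq (Mul s t) (Mul s' t') \<in> H"
    "Lt s t \<in> H \<Longrightarrow> Lt s' t' \<in> H"
proof -
  have "Eq (Add s t) (Add s' t) \<in> H"
    using limit_EqSubst[OF assms(1), of "Eq (Add (lift_trm s) (lift_trm t)) (Add (Var 0) (lift_trm t))"]
    by (simp add: instN_def limit_refl)
  then show "Eq (Add s t) (Add s' t') \<in> H"
    using limit_EqSubst[OF assms(2), of "Eq (Add (lift_trm s) (lift_trm t)) (Add (lift_trm s') (Var 0))"]
    by (simp add: instN_def)
  have "Eq (Mul s t) (Mul s' t) \<in> H"
    using limit_EqSubst[OF assms(1), of "Eq (Mul (lift_trm s) (lift_trm t)) (Mul (Var 0) (lift_trm t))"]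
    by (simp add: instN_def limit_refl)
  then show "Eq (Mul s t) (Mul s' t') \<in> H"
    using limit_EqSubst[OF assms(2), of "Eq (Mul (lift_trm s) (lift_trm t)) (Mul (lift_trm s') (Var 0))"]
    by (simp add: instN_def)
  assume "Lt s t \<in> H"
  then have "Lt s' t \<in> H"
    using limit_EqSubst[OF assms(1), of "Lt (Var 0) (lift_trm t)"] by (simp add: instN_def)
  then show "Lt s' t' \<in> H"
    using limit_EqSubst[OF assms(2), of "Lt (lift_trm s') (Var 0)"] by (simp add: instN_def)
qed

lemma limit_Mem: "Eq s t \<in> H \<Longrightarrow> Mem s k \<in> H \<Longrightarrow> Mem t k \<in> H"
  using limit_EqSubst[of s t "Mem (Var 0) k"] by (simp add: instN_def)

abbreviation "hadd \<equiv> \<lambda>X Y. cls (Add (rep X) (rep Y))"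
abbreviation "hmul \<equiv> \<lambda>X Y. cls (Mul (rep X) (rep Y))"
abbreviation "hless \<equiv> \<lambda>X Y. Lt (rep X) (rep Y) \<in> H"
abbreviation "hset \<equiv> \<lambda>k. {cls t |t. Mem t k \<in> H}"

interpretation ops "cls Zero" "cls One" hadd hmul hless .

lemma henkin_val: "val (\<lambda>i. cls (Var i)) t = cls t"
  by (induction t) (auto simp: cls_eq_iff intro: limit_cong2 limit_sym[OF rep_cls])

text \<open>The induction is on size because \<open>instN t q\<close> is not a subformula of
  \<open>AllN q\<close>; substitution preserves the size. Every set of the model is some
  \<open>hset k\<close>, so instances at set variables decide \<open>AllS\<close>.\<close>

lemma henkin_sat: "sat (range cls) (range hset) (\<lambda>i. cls (Var i)) hset p \<longleftrightarrow> p \<in> H"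
proof (induction "size p" arbitrary: p rule: less_induct)
  case less
  have szN: "size (subst_fml f g q) = size q" for f g q
    by (induction q arbitrary: f g) auto
  show ?case
  proof (cases p)
    case (Lt s t)
    have "Lt (rep (cls s)) (rep (cls t)) \<in> H \<longleftrightarrow> Lt s t \<in> H"
      by (rule iffI; erule limit_cong2(3)[rotated 2]; intro rep_cls limit_sym[OF rep_cls])
    then show ?thesis by (simp add: Lt henkin_val)
  next
    case (Mem t k)
    have "(\<exists>s. Eq t s \<in> H \<and> Mem s k \<in> H) \<longleftrightarrow> Mem t k \<in> H"
      using limit_Mem limit_sym limit_refl by metis
    then show ?thesis by (simp add: Mem henkin_val cls_eq_iff)
  next
    case Fls
    then show ?thesis using consistent_limit limit_deductive by auto
  next
    case (Imp q r)
    then show ?thesis using less[of q] less[of r] by (simp add: limit_Imp)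
  next
    case (AllN q)
    have "sat (range cls) (range hset) (cls t ## (\<lambda>i. cls (Var i))) hset q
        \<longleftrightarrow> instN t q \<in> H" for t
      using less[of "instN t q"] AllN by (simp add: sat_instN henkin_val) (simp add: instN_def szN)
    then show ?thesis using AllN by (simp add: limit_AllN)
  next
    case (AllS q)
    have "sat (range cls) (range hset) (\<lambda>i. cls (Var i)) (hset k ## hset) q
        \<longleftrightarrow> instS k q \<in> H" for k
      using less[of "instS k q"] AllS by (simp add: sat_instS) (simp add: instS_def szN)
    then show ?thesis using AllS by (simp add: limit_AllS)
  qed (simp add: henkin_val cls_eq_iff)
qed

lemma henkin_model:
  "\<exists>(z::trm set) u a m l D S e \<sigma>. ops.closed_dom z u a m D \<and> (\<forall>i. e i \<in> D) \<and> (\<forall>k. \<sigma> k \<in> S)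
    \<and> (\<forall>p\<in>T. ops.sat z u a m l D S e \<sigma> p)"
proof -
  have "T \<subseteq> H" unfolding H_def henkin_limit_def using henkin.simps(1)[of T] by blast
  then have "\<forall>p\<in>T. sat (range cls) (range hset) (\<lambda>i. cls (Var i)) hset p"
    by (simp add: henkin_sat subset_iff)
  moreover have "closed_dom (range cls)" by (simp add: closed_dom_def)
  ultimately show ?thesis
    by (intro exI[of _ "cls Zero"] exI[of _ "cls One"] exI[of _ hadd] exI[of _ hmul]
        exI[of _ hless] exI[of _ "range cls"] exI[of _ "range hset"]
        exI[of _ "\<lambda>i. cls (Var i)"] exI[of _ hset]) blast
qed

end

text \<open>The theory may have free variables, which \<open>e\<close> and \<open>\<sigma>\<close>
  interpret. They will serve as constants for a nonstandard number and two sets.\<close>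

theorem compactness:
  assumes few: "few_vars T"
    and fin: "\<And>F. finite F \<Longrightarrow> F \<subseteq> T \<Longrightarrow> is_consistent F"
  shows "\<exists>(z::trm set) u a m l D S e \<sigma>. ops.closed_dom z u a m D \<and> (\<forall>i. e i \<in> D) \<and> (\<forall>k. \<sigma> k \<in> S)
    \<and> (\<forall>p\<in>T. ops.sat z u a m l D S e \<sigma> p)"
proof -
  have "is_consistent T"
    using fin derives_finite[of T Fls] unfolding is_consistent_def by metis
  then show ?thesis using henkin_model[OF _ few refl] by simp
qed

section \<open>Bounded predicates\<close>

lemma is_Delta00_subst: "is_Delta00 p \<Longrightarrow> is_Delta00 (subst_fml f g p)"
proof (induction arbitrary: f g rule: is_Delta00.induct)
  case (6 p t)
  have "subst_trm (Var 0 ## (\<lambda>i. lift_trm (f i))) (lift_trm t) = lift_trm (subst_trm f t)"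
    by (simp add: subst_trm_comp)
  then show ?case using is_Delta00.intros(6)[OF 6(2)] by simp
next
  case (7 p t)
  have "subst_trm (Var 0 ## (\<lambda>i. lift_trm (f i))) (lift_trm t) = lift_trm (subst_trm f t)"
    by (simp add: subst_trm_comp)
  then show ?case using is_Delta00.intros(7)[OF 7(2)] by simp
qed (auto intro: is_Delta00.intros)

context ops
begin

text \<open>The semantic counterpart of terms, with the elements of \<open>C\<close> as constants.
  For functions and predicates on environments, definability is proved by introduction rules,
  without writing formulas with de Bruijn indices.\<close>

inductive tm :: "'m set \<Rightarrow> ((nat \<Rightarrow> 'm) \<Rightarrow> 'm) \<Rightarrow> bool" for C where
  tm_var: "tm C (\<lambda>e. e i)"
| tm_zero: "tm C (\<lambda>e. \<zero>)"
| tm_one: "tm C (\<lambda>e. \<one>)"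
| tm_add: "tm C s \<Longrightarrow> tm C t \<Longrightarrow> tm C (\<lambda>e. s e \<oplus> t e)"
| tm_mul: "tm C s \<Longrightarrow> tm C t \<Longrightarrow> tm C (\<lambda>e. s e \<odot> t e)"
| tm_const: "a \<in> C \<Longrightarrow> tm C (\<lambda>e. a)"

text \<open>\<open>dz D C U P\<close>: the predicate \<open>P\<close> on environments is defined over the domain \<open>D\<close> by a
  \<open>\<Delta>\<^sup>0\<^sub>0\<close> formula with number parameters from \<open>C\<close> and set parameters from \<open>U\<close>.\<close>

inductive dz :: "'m set \<Rightarrow> 'm set \<Rightarrow> 'm set set \<Rightarrow> ((nat \<Rightarrow> 'm) \<Rightarrow> bool) \<Rightarrow> bool" for D C U where
  dz_eq: "tm C s \<Longrightarrow> tm C t \<Longrightarrow> dz D C U (\<lambda>e. s e = t e)"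
| dz_lt: "tm C s \<Longrightarrow> tm C t \<Longrightarrow> dz D C U (\<lambda>e. s e \<prec> t e)"
| dz_mem: "tm C t \<Longrightarrow> X \<in> U \<Longrightarrow> dz D C U (\<lambda>e. t e \<in> X)"
| dz_False: "dz D C U (\<lambda>e. False)"
| dz_imp: "dz D C U P \<Longrightarrow> dz D C U Q \<Longrightarrow> dz D C U (\<lambda>e. P e \<longrightarrow> Q e)"
| dz_ball_env: "tm C t \<Longrightarrow> dz D C U P \<Longrightarrow> dz D C U (\<lambda>e. \<forall>y\<in>D. y \<prec> t e \<longrightarrow> P (y ## e))"

lemma dz_not: "dz D C U P \<Longrightarrow> dz D C U (\<lambda>e. \<not> P e)"
  using dz_imp[OF _ dz_False] by fastforce

lemma dz_conj: "dz D C U P \<Longrightarrow> dz D C U Q \<Longrightarrow> dz D C U (\<lambda>e. P e \<and> Q e)"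
  using dz_not[OF dz_imp[OF _ dz_not]] by fastforce

lemma dz_disj: "dz D C U P \<Longrightarrow> dz D C U Q \<Longrightarrow> dz D C U (\<lambda>e. P e \<or> Q e)"
  unfolding disj_imp by (intro dz_imp dz_not)

lemma dz_iff: "dz D C U P \<Longrightarrow> dz D C U Q \<Longrightarrow> dz D C U (\<lambda>e. P e \<longleftrightarrow> Q e)"
  unfolding iff_conv_conj_imp by (intro dz_conj dz_imp)

lemma dz_ball:
  assumes "tm C t" "dz D C U (\<lambda>e. P (e 0) (\<lambda>i. e (Suc i)))"
  shows "dz D C U (\<lambda>e. \<forall>y\<in>D. y \<prec> t e \<longrightarrow> P y e)"
  using dz_ball_env[OF assms] by simp

lemma dz_bex:
  assumes "tm C t" "dz D C U (\<lambda>e. P (e 0) (\<lambda>i. e (Suc i)))"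
  shows "dz D C U (\<lambda>e. \<exists>y\<in>D. y \<prec> t e \<and> P y e)"
proof -
  have "dz D C U (\<lambda>e. \<not> (\<forall>y\<in>D. y \<prec> t e \<longrightarrow> \<not> P y e))"
    by (intro dz_not dz_ball assms)
  then show ?thesis by (simp add: Bex_def Ball_def)
qed

lemmas tm_intros = tm_var tm_zero tm_one tm_add tm_mul tm_const
lemmas dz_intros = dz_eq dz_lt dz_mem dz_False dz_not dz_conj dz_disj dz_iff dz_imp dz_ball dz_bex tm_intros

section \<open>Substitution in bounded predicates and removal of their parameters\<close>

lemma tm_subst: "tm C t \<Longrightarrow> (\<And>i. tm C (\<lambda>e. g e i)) \<Longrightarrow> tm C (\<lambda>e. t (g e))"
  by (induction rule: tm.induct) (auto intro: tm.intros)

lemma tm_shift: "tm C s \<Longrightarrow> tm C (\<lambda>e. s (\<lambda>i. e (Suc i)))"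
  by (rule tm_subst[where g = "\<lambda>e i. e (Suc i)"]) (simp_all add: tm.tm_var)

lemma tm_cons: "tm C s \<Longrightarrow> (\<And>i. tm C (\<lambda>e. g e i)) \<Longrightarrow> tm C (\<lambda>e. (s e ## g e) i)"
  by (cases i) simp_all

lemma dz_subst: "dz D C U P \<Longrightarrow> (\<And>i. tm C (\<lambda>e. g e i)) \<Longrightarrow> dz D C U (\<lambda>e. P (g e))"
proof (induction arbitrary: g rule: dz.induct)
  case (dz_ball_env t P)
  have "dz D C U (\<lambda>e. P (e 0 ## g (\<lambda>j. e (Suc j))))"
    by (rule dz_ball_env.IH) (intro tm_cons tm_var tm_shift[OF dz_ball_env.prems])
  from dz.dz_ball_env[OF tm_subst[OF dz_ball_env.hyps(1) dz_ball_env.prems] this]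
  show ?case by simp
next
  case (dz_eq s t)
  show ?case by (rule dz.dz_eq[OF tm_subst[OF dz_eq(1)] tm_subst[OF dz_eq(2)]]) (rule dz_eq(3))+
next
  case (dz_lt s t)
  show ?case by (rule dz.dz_lt[OF tm_subst[OF dz_lt(1)] tm_subst[OF dz_lt(2)]]) (rule dz_lt(3))+
next
  case (dz_mem t X)
  show ?case by (rule dz.dz_mem[OF tm_subst[OF dz_mem(1)] dz_mem(2)]) (rule dz_mem(3))
next
  case (dz_imp P Q)
  show ?case by (rule dz.dz_imp[OF dz_imp.IH]) (rule dz_imp.prems)+
qed (rule dz.dz_False)

lemma tm_mono: "tm C t \<Longrightarrow> C \<subseteq> C' \<Longrightarrow> tm C' t"
  by (induction rule: tm.induct) (auto intro: tm.intros)

lemma dz_mono: "dz D C U P \<Longrightarrow> C \<subseteq> C' \<Longrightarrow> U \<subseteq> U' \<Longrightarrow> dz D C' U' P"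
  by (induction rule: dz.induct) (auto intro: dz.intros tm_mono)

lemma tm_abstract: "tm (insert a C) t \<Longrightarrow> \<exists>t'. tm C t' \<and> (\<forall>e. t e = t' (a ## e))"
proof (induction rule: tm.induct)
  case (tm_var i)
  show ?case by (rule exI[of _ "\<lambda>e. e (Suc i)"]) (auto intro: tm.intros)
next
  case (tm_const b)
  then show ?case
    by (cases "b = a") (auto intro: exI[of _ "\<lambda>e. e 0"] exI[of _ "\<lambda>e. b"] tm.intros)
next
  case (tm_add s t)
  then obtain s' t' where "tm C s'" "\<forall>e. s e = s' (a ## e)" "tm C t'" "\<forall>e. t e = t' (a ## e)"
    by blast
  then show ?case by (intro exI[of _ "\<lambda>e. s' e \<oplus> t' e"]) (auto intro: tm.intros)
next
  case (tm_mul s t)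
  then obtain s' t' where "tm C s'" "\<forall>e. s e = s' (a ## e)" "tm C t'" "\<forall>e. t e = t' (a ## e)"
    by blast
  then show ?case by (intro exI[of _ "\<lambda>e. s' e \<odot> t' e"]) (auto intro: tm.intros)
next
  case tm_zero
  show ?case by (rule exI[of _ "\<lambda>e. \<zero>"]) (simp add: tm.tm_zero)
next
  case tm_one
  show ?case by (rule exI[of _ "\<lambda>e. \<one>"]) (simp add: tm.tm_one)
qed

text \<open>A parameter is traded for a new variable in position 0. Repeating this leaves a
  predicate without parameters, which can be written as a formula or be given other
  parameters.\<close>

lemma dz_abstract: "dz D (insert a C) U P \<Longrightarrow> \<exists>P'. dz D C U P' \<and> (\<forall>e. P e = P' (a ## e))"
proof (induction rule: dz.induct)
  case (dz_eq s t)
  obtain s' t' where "tm C s'" "\<forall>e. s e = s' (a ## e)" "tm C t'" "\<forall>e. t e = t' (a ## e)"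
    using tm_abstract[OF dz_eq(1)] tm_abstract[OF dz_eq(2)] by auto
  then show ?case by (intro exI[of _ "\<lambda>e. s' e = t' e"]) (simp add: dz.dz_eq)
next
  case (dz_lt s t)
  obtain s' t' where "tm C s'" "\<forall>e. s e = s' (a ## e)" "tm C t'" "\<forall>e. t e = t' (a ## e)"
    using tm_abstract[OF dz_lt(1)] tm_abstract[OF dz_lt(2)] by auto
  then show ?case by (intro exI[of _ "\<lambda>e. s' e \<prec> t' e"]) (simp add: dz.dz_lt)
next
  case (dz_mem t X)
  obtain t' where "tm C t'" "\<forall>e. t e = t' (a ## e)"
    using tm_abstract[OF dz_mem(1)] by auto
  then show ?case using dz_mem(2) by (intro exI[of _ "\<lambda>e. t' e \<in> X"]) (simp add: dz.dz_mem)
next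
  case dz_False
  show ?case by (rule exI[of _ "\<lambda>e. False"]) (simp add: dz.dz_False)
next
  case (dz_imp P Q)
  obtain P' Q' where "dz D C U P'" "\<forall>e. P e = P' (a ## e)" "dz D C U Q'" "\<forall>e. Q e = Q' (a ## e)"
    using dz_imp.IH by auto
  then show ?case by (intro exI[of _ "\<lambda>e. P' e \<longrightarrow> Q' e"]) (simp add: dz.dz_imp)
next
  case (dz_ball_env t P)
  obtain t' where t': "tm C t'" "\<forall>e. t e = t' (a ## e)"
    using tm_abstract[OF dz_ball_env.hyps(1)] by auto
  obtain P' where P': "dz D C U P'" "\<forall>e. P e = P' (a ## e)"
    using dz_ball_env.IH by auto
  \<comment> \<open>Under the quantifier the bound variable comes first and the abstracted parameter
    second, whereas \<open>P'\<close> expects the parameter first; hence the swap.\<close>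
  have "dz D C U (\<lambda>e. P' (e 1 ## e 0 ## (\<lambda>i. e (Suc (Suc i)))))"
    by (intro dz_subst[OF P'(1)] tm_cons tm_var)
  from dz.dz_ball_env[OF t'(1) this]
  have "dz D C U (\<lambda>e. \<forall>y\<in>D. y \<prec> t' e \<longrightarrow> P' (e 0 ## y ## (\<lambda>i. e (Suc i))))" by simp
  then show ?case
    by (intro exI[of _ "\<lambda>e. \<forall>y\<in>D. y \<prec> t' e \<longrightarrow> P' (e 0 ## y ## (\<lambda>i. e (Suc i)))"]) (simp add: t'(2) P'(2))
qed

lemma tm_finite: "tm C t \<Longrightarrow> \<exists>F. finite F \<and> F \<subseteq> C \<and> tm F t"
proof (induction rule: tm.induct)
  case (tm_const a)
  then show ?case by (intro exI[of _ "{a}"]) (auto intro: tm.intros)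
next
  case (tm_add s t)
  then obtain F G where "finite F" "F \<subseteq> C" "tm F s" "finite G" "G \<subseteq> C" "tm G t" by blast
  then show ?case by (intro exI[of _ "F \<union> G"]) (auto intro: tm.intros tm_mono)
next
  case (tm_mul s t)
  then obtain F G where "finite F" "F \<subseteq> C" "tm F s" "finite G" "G \<subseteq> C" "tm G t" by blast
  then show ?case by (intro exI[of _ "F \<union> G"]) (auto intro: tm.intros tm_mono)
next
  case (tm_var i)
  show ?case by (rule exI[of _ "{}"]) (simp add: tm.tm_var)
next
  case tm_zero
  show ?case by (rule exI[of _ "{}"]) (simp add: tm.tm_zero)
next
  case tm_one
  show ?case by (rule exI[of _ "{}"]) (simp add: tm.tm_one)
qed

lemma tm_finite2:
  assumes "tm C s" "tm C t" shows "\<exists>F. finite F \<and> F \<subseteq> C \<and> tm F s \<and> tm F t"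
proof -
  obtain F G where "finite F" "F \<subseteq> C" "tm F s" "finite G" "G \<subseteq> C" "tm G t" using tm_finite[OF assms(1)] tm_finite[OF assms(2)] by auto
  then show ?thesis by (intro exI[of _ "F \<union> G"]) (auto intro: tm_mono)
qed

lemma dz_finite: "dz D C U P \<Longrightarrow> \<exists>F. finite F \<and> F \<subseteq> C \<and> dz D F U P"
proof (induction rule: dz.induct)
  case (dz_eq s t)
  obtain F where "finite F \<and> F \<subseteq> C \<and> tm F s \<and> tm F t" using tm_finite2[OF dz_eq] by auto
  then show ?case using dz.dz_eq[of F s t D U] by blast
next
  case (dz_lt s t)
  obtain F where "finite F \<and> F \<subseteq> C \<and> tm F s \<and> tm F t" using tm_finite2[OF dz_lt] by auto
  then show ?case using dz.dz_lt[of F s t D U] by blast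
next
  case (dz_mem t X)
  then obtain F where "finite F \<and> F \<subseteq> C \<and> tm F t" using tm_finite[OF dz_mem(1)] by auto
  then show ?case using dz.dz_mem[of F t X U D] dz_mem(2) by blast
next
  case dz_False
  show ?case by (rule exI[of _ "{}"]) (simp add: dz.dz_False)
next
  case (dz_imp P Q)
  then obtain F G where "finite F" "F \<subseteq> C" "dz D F U P" "finite G" "G \<subseteq> C" "dz D G U Q" by blast
  then show ?case by (intro exI[of _ "F \<union> G"]) (auto intro!: dz.dz_imp elim: dz_mono)
next
  case (dz_ball_env t P)
  obtain F G where "finite F" "F \<subseteq> C" "tm F t" "finite G" "G \<subseteq> C" "dz D G U P"
    using tm_finite[OF dz_ball_env.hyps(1)] dz_ball_env.IH by auto
  then show ?case by (intro exI[of _ "F \<union> G"]) (auto intro!: dz.dz_ball_env elim: dz_mono tm_mono)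
qed

lemma tm_val: "(\<And>i. tm C (\<lambda>e. g e i)) \<Longrightarrow> tm C (\<lambda>e. val (g e) t)"
  by (induction t) (auto intro: tm.intros)

lemma dz_sat: "is_Delta00 p \<Longrightarrow> (\<And>k. \<sigma> k \<in> U) \<Longrightarrow> dz D C U (\<lambda>e. sat D S e \<sigma> p)"
proof (induction rule: is_Delta00.induct)
  case (6 p t)
  from dz.dz_ball_env[OF tm_val[where g = "\<lambda>e. e" and t = t, OF tm_var] 6(2)[OF 6(3)]]
  show ?case by (simp add: val_lift)
next
  case (7 p t)
  from dz_not[OF dz.dz_ball_env[OF tm_val[where g = "\<lambda>e. e" and t = t, OF tm_var] dz_not[OF 7(2)[OF 7(3)]]]]
  show ?case by (simp add: val_lift)
qed (simp_all add: dz.dz_eq dz.dz_lt dz.dz_mem dz.dz_False dz.dz_imp tm_val tm_var)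

section \<open>From predicates back to formulas\<close>

lemma tm_represent: "tm {} t \<Longrightarrow> \<exists>s. \<forall>e. t e = val e s"
proof (induction rule: tm.induct)
  case (tm_var i)
  show ?case by (rule exI[of _ "Var i"]) simp
next
  case tm_zero
  show ?case by (rule exI[of _ Zero]) simp
next
  case tm_one
  show ?case by (rule exI[of _ One]) simp
next
  case (tm_add s t)
  then obtain s' t' where "\<forall>e. s e = val e s'" "\<forall>e. t e = val e t'" by blast
  then show ?case by (intro exI[of _ "Add s' t'"]) simp
next
  case (tm_mul s t)
  then obtain s' t' where "\<forall>e. s e = val e s'" "\<forall>e. t e = val e t'" by blast
  then show ?case by (intro exI[of _ "Mul s' t'"]) simp
qed auto

lemma dz_represent:
  "dz D {} U P \<Longrightarrow> A \<in> U \<Longrightarrow> \<exists>p \<sigma>. is_Delta00 p \<and> (\<forall>k. \<sigma> k \<in> U) \<and> (\<forall>e. P e = sat D S e \<sigma> p)"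
proof (induction rule: dz.induct)
  case (dz_eq s t)
  obtain s' t' where "\<forall>e. s e = val e s'" "\<forall>e. t e = val e t'" using tm_represent[OF dz_eq(1)] tm_represent[OF dz_eq(2)] by auto
  then show ?case using dz_eq
    by (intro exI[of _ "Eq s' t'"] exI[of _ "\<lambda>_. A"]) (auto intro: is_Delta00.intros)
next
  case (dz_lt s t)
  obtain s' t' where "\<forall>e. s e = val e s'" "\<forall>e. t e = val e t'" using tm_represent[OF dz_lt(1)] tm_represent[OF dz_lt(2)] by auto
  then show ?case using dz_lt
    by (intro exI[of _ "Lt s' t'"] exI[of _ "\<lambda>_. A"]) (auto intro: is_Delta00.intros)
next
  case (dz_mem t X)
  obtain t' where "\<forall>e. t e = val e t'" using tm_represent[OF dz_mem(1)] by auto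
  then show ?case using dz_mem
    by (intro exI[of _ "Mem t' 0"] exI[of _ "\<lambda>_. X"]) (auto intro: is_Delta00.intros)
next
  case dz_False
  then show ?case
    by (intro exI[of _ "Fls"] exI[of _ "\<lambda>_. A"]) (auto intro: is_Delta00.intros)
next
  case (dz_imp P Q)
  then obtain p \<sigma> q \<tau> where p: "is_Delta00 p" "\<forall>k. \<sigma> k \<in> U" "\<forall>e. P e = sat D S e \<sigma> p"
    and q: "is_Delta00 q" "\<forall>k. \<tau> k \<in> U" "\<forall>e. Q e = sat D S e \<tau> q" by blast
  \<comment> \<open>The two assignments of set variables are interleaved, even positions for
    \<open>p\<close> and odd ones for \<open>q\<close>, so that one assignment serves both.\<close>
  let ?\<rho> = "\<lambda>k. if even k then \<sigma> (k div 2) else \<tau> (k div 2)"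
  have "(\<lambda>k. ?\<rho> (2 * k)) = \<sigma>" "(\<lambda>k. ?\<rho> (2 * k + 1)) = \<tau>" by auto
  then show ?case
    using p q
    by (intro exI[of _ "Imp (subst_fml Var (\<lambda>k. 2 * k) p) (subst_fml Var (\<lambda>k. 2 * k + 1) q)"]
        exI[of _ ?\<rho>]) (auto intro!: is_Delta00.intros is_Delta00_subst simp: sat_subst)
next
  case (dz_ball_env t P)
  obtain p \<sigma> where p: "is_Delta00 p" "\<forall>k. \<sigma> k \<in> U" "\<forall>e. P e = sat D S e \<sigma> p"
    using dz_ball_env.IH dz_ball_env.prems by auto
  obtain t' where t': "\<forall>e. t e = val e t'" using tm_represent[OF dz_ball_env.hyps(1)] by auto
  show ?case
    by (intro exI[of _ "BAll t' p"] exI[of _ \<sigma>])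
      (use p t' in \<open>simp add: val_lift is_Delta00.intros\<close>)
qed

primrec append_env :: "'m list \<Rightarrow> (nat \<Rightarrow> 'm) \<Rightarrow> nat \<Rightarrow> 'm" where
  "append_env [] e = e"
| "append_env (a # as) e = a ## (append_env as e)"

lemma append_env_snoc: "append_env (as @ [a]) e = append_env as (a ## e)"
  by (induction as) auto

lemma append_env_nth: "append_env as e i = (if i < length as then as ! i else e (i - length as))"
  by (induction as arbitrary: i) (auto split: nat.split)

lemma dz_abstract_finite:
  "finite F \<Longrightarrow> dz D F U P \<Longrightarrow> \<exists>P' as. dz D {} U P' \<and> set as = F \<and> (\<forall>e. P e = P' (append_env as e))"
proof (induction F arbitrary: P rule: finite_induct)
  case empty
  then show ?case by (intro exI[of _ P] exI[of _ "[]"]) auto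
next
  case (insert a F)
  then obtain Q where Q: "dz D F U Q" "\<forall>e. P e = Q (a ## e)"
    using dz_abstract[OF insert.prems] by auto
  obtain P' as where "dz D {} U P'" "set as = F" "\<forall>e. Q e = P' (append_env as e)"
    using insert.IH[OF Q(1)] by auto
  then show ?case using Q by (intro exI[of _ P'] exI[of _ "as @ [a]"]) (auto simp: append_env_snoc)
qed

lemma dz_represent2:
  assumes "dz D C U (\<lambda>e. Q (e 0) (e 1))" "A \<in> U" "c \<in> C"
  shows "\<exists>p \<rho> \<sigma>. is_Delta00 p \<and> (\<forall>i. \<rho> i \<in> C) \<and> (\<forall>k. \<sigma> k \<in> U)
    \<and> (\<forall>z x. Q z x = sat D S (z ## x ## \<rho>) \<sigma> p)"
proof -
  obtain F where F: "finite F" "dz D F U (\<lambda>e. Q (e 0) (e 1))" and FC: "F \<subseteq> C"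
    using dz_finite[OF assms(1)] by auto
  obtain P' as where P': "dz D {} U P'" "set as = F" "\<And>e. Q (e 0) (e 1) = P' (append_env as e)"
    using dz_abstract_finite[OF F] by auto
  obtain p \<sigma> where p: "is_Delta00 p" "\<forall>k. \<sigma> k \<in> U" "\<And>e. P' e = sat D S e \<sigma> p"
    using dz_represent[OF P'(1) assms(2), where S = S] by auto
  define k where "k = length as"
  \<comment> \<open>\<open>P'\<close> has the parameters first and then \<open>z\<close> and
    \<open>x\<close>, whereas the formula shall have \<open>z\<close> and \<open>x\<close> first.
    All later positions become \<open>Zero\<close>, in agreement with the environment
    \<open>?e\<close> below.\<close>
  define f where "f = (\<lambda>i. if i < k then Var (i + 2) else if i = k then Var 0 else if i = Suc k then Var 1 else Zero)"
  define \<rho> where "\<rho> = (\<lambda>i. if i < k then as ! i else c)"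
  have "Q z x = sat D S (z ## x ## \<rho>) \<sigma> (subst_fml f (\<lambda>k. k) p)" for z x
  proof -
    let ?e = "z ## x ## (\<lambda>_. \<zero>)"
    have "append_env as ?e i = val (z ## x ## \<rho>) (f i)" for i
      by (auto simp: append_env_nth f_def \<rho>_def k_def split: nat.split)
    then have "append_env as ?e = (\<lambda>i. val (z ## x ## \<rho>) (f i))" by blast
    then show ?thesis using P'(3)[of ?e] p(3)[of "append_env as ?e"] by (simp add: sat_subst)
  qed
  moreover have "\<rho> i \<in> C" for i using P'(2) FC assms(3) by (auto simp: \<rho>_def k_def)
  ultimately show ?thesis using p is_Delta00_subst by blast
qed

end

section \<open>Models of \<open>RCA\<^sub>0\<close>\<close>

text \<open>Induction and comprehension are stated for Delta^0_0 predicates, with the one unbounded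
  quantifier written out. Arguments inside a model thereby need no formulas.\<close>

locale rca = ops +
  fixes D :: "'a set" and S :: "'a set set"
  assumes zero_in: "\<zero> \<in> D" and one_in: "\<one> \<in> D"
    and add_in: "x \<in> D \<Longrightarrow> y \<in> D \<Longrightarrow> x \<oplus> y \<in> D"
    and mul_in: "x \<in> D \<Longrightarrow> y \<in> D \<Longrightarrow> x \<odot> y \<in> D"
    and S_nonempty: "S \<noteq> {}"
    and succ_not_zero: "x \<in> D \<Longrightarrow> x \<oplus> \<one> \<noteq> \<zero>"
    and succ_inj: "x \<in> D \<Longrightarrow> y \<in> D \<Longrightarrow> x \<oplus> \<one> = y \<oplus> \<one> \<Longrightarrow> x = y"
    and add_zero: "x \<in> D \<Longrightarrow> x \<oplus> \<zero> = x"
    and add_succ: "x \<in> D \<Longrightarrow> y \<in> D \<Longrightarrow> x \<oplus> (y \<oplus> \<one>) = x \<oplus> y \<oplus> \<one>"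
    and mul_zero: "x \<in> D \<Longrightarrow> x \<odot> \<zero> = \<zero>"
    and mul_succ: "x \<in> D \<Longrightarrow> y \<in> D \<Longrightarrow> x \<odot> (y \<oplus> \<one>) = x \<odot> y \<oplus> x"
    and not_less_zero: "x \<in> D \<Longrightarrow> \<not> x \<prec> \<zero>"
    and less_succ: "x \<in> D \<Longrightarrow> y \<in> D \<Longrightarrow> x \<prec> y \<oplus> \<one> \<longleftrightarrow> x \<prec> y \<or> x = y"
    and Sigma1_induct: "dz D D S (\<lambda>e. Q (e 0) (e 1)) \<Longrightarrow> \<exists>z\<in>D. Q z \<zero>
      \<Longrightarrow> (\<And>x z. x \<in> D \<Longrightarrow> z \<in> D \<Longrightarrow> Q z x \<Longrightarrow> \<exists>z\<in>D. Q z (x \<oplus> \<one>))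
      \<Longrightarrow> x \<in> D \<Longrightarrow> \<exists>z\<in>D. Q z x"
    and comprehension: "dz D D S (\<lambda>e. Q (e 0) (e 1)) \<Longrightarrow> dz D D S (\<lambda>e. R (e 0) (e 1))
      \<Longrightarrow> (\<And>x. x \<in> D \<Longrightarrow> (\<exists>z\<in>D. Q z x) \<longleftrightarrow> (\<forall>z\<in>D. R z x))
      \<Longrightarrow> \<exists>X\<in>S. \<forall>x\<in>D. x \<in> X \<longleftrightarrow> (\<exists>z\<in>D. Q z x)"

context ops
begin

definition models :: "'m set \<Rightarrow> 'm set set \<Rightarrow> fml set \<Rightarrow> bool" where
  "models D S T \<longleftrightarrow> closed_dom D \<and> S \<noteq> {}
     \<and> (\<forall>p\<in>T. \<forall>e \<sigma>. (\<forall>i. e i \<in> D) \<longrightarrow> (\<forall>k. \<sigma> k \<in> S) \<longrightarrow> sat D S e \<sigma> p)"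

lemma models_closure:
  assumes "models D S T" "univ_closure p \<in> T" "\<And>i. e i \<in> D" "\<And>k. \<sigma> k \<in> S"
  shows "sat D S e \<sigma> p"
  using assms sat_univ_closure[of e D \<sigma> S p] unfolding models_def by blast

lemma Sigma1_ExN: "is_Delta00 p \<Longrightarrow> is_Sigma0 1 (ExN p)"
  using is_Sigma0_is_Pi0.intros(2,3) by force

lemma Pi1_AllN: "is_Delta00 p \<Longrightarrow> is_Pi0 1 (AllN p)"
  using is_Sigma0_is_Pi0.intros(1,4) by force

lemma sat_induction_fml:
  "sat D S e \<sigma> (induction_fml p) \<longleftrightarrow>
    (sat D S (\<zero> ## e) \<sigma> p \<longrightarrow>
     (\<forall>x\<in>D. sat D S (x ## e) \<sigma> p \<longrightarrow> sat D S ((x \<oplus> \<one>) ## e) \<sigma> p) \<longrightarrow>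
     (\<forall>x\<in>D. sat D S (x ## e) \<sigma> p))"
proof -
  have "(\<lambda>i. val (x ## e) ((Add (Var 0) One ## (\<lambda>i. Var (Suc i))) i)) = (x \<oplus> \<one>) ## e" for x
    by (auto simp: fun_eq_iff split: nat.split)
  then show ?thesis by (auto simp: induction_fml_def sat_instN sat_subst)
qed

lemma sat_comprehension_fml:
  "sat D S e \<sigma> (comprehension_fml p q) \<longleftrightarrow>
    ((\<forall>x\<in>D. sat D S (x ## e) \<sigma> p \<longleftrightarrow> sat D S (x ## e) \<sigma> q) \<longrightarrow>
     (\<exists>X\<in>S. \<forall>x\<in>D. x \<in> X \<longleftrightarrow> sat D S (x ## e) \<sigma> p))"
  by (auto simp: comprehension_fml_def sat_liftS)

lemma models_RCA0_rca:
  assumes M: "models D S RCA0"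
  shows "rca zero one add mul less D S"
proof
  have cl: "closed_dom D" using M by (simp add: models_def)
  show ne: "S \<noteq> {}" using M by (simp add: models_def)
  show Z: "\<zero> \<in> D" and "\<one> \<in> D" and "\<And>x y. x \<in> D \<Longrightarrow> y \<in> D \<Longrightarrow> x \<oplus> y \<in> D"
    and "\<And>x y. x \<in> D \<Longrightarrow> y \<in> D \<Longrightarrow> x \<odot> y \<in> D"
    using cl by (auto simp: closed_dom_def)
  obtain X where X: "X \<in> S" using ne by blast
  have ax: "sat D S (x ## (\<lambda>_. y)) (\<lambda>_. X) p" if "univ_closure p \<in> basic_axioms" "x \<in> D" "y \<in> D" for p x y
    by (rule models_closure[OF M]) (use that X in \<open>auto simp: RCA0_def split: nat.split\<close>)
  note bas = basic_axioms_def image_insert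
  show "x \<oplus> \<one> \<noteq> \<zero>" if "x \<in> D" for x
    using ax[of "Neg (Eq (Add (Var 0) One) Zero)" x x] that by (simp add: bas)
  show "x \<oplus> \<one> = y \<oplus> \<one> \<Longrightarrow> x = y" if "x \<in> D" "y \<in> D" for x y
    using ax[of "Imp (Eq (Add (Var 0) One) (Add (Var 1) One)) (Eq (Var 0) (Var 1))" x y] that by (simp add: bas)
  show "x \<oplus> \<zero> = x" if "x \<in> D" for x
    using ax[of "Eq (Add (Var 0) Zero) (Var 0)" x x] that by (simp add: bas)
  show "x \<oplus> (y \<oplus> \<one>) = x \<oplus> y \<oplus> \<one>" if "x \<in> D" "y \<in> D" for x y
    using ax[of "Eq (Add (Var 0) (Add (Var 1) One)) (Add (Add (Var 0) (Var 1)) One)" x y] that by (simp add: bas)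
  show "x \<odot> \<zero> = \<zero>" if "x \<in> D" for x
    using ax[of "Eq (Mul (Var 0) Zero) Zero" x x] that by (simp add: bas)
  show "x \<odot> (y \<oplus> \<one>) = x \<odot> y \<oplus> x" if "x \<in> D" "y \<in> D" for x y
    using ax[of "Eq (Mul (Var 0) (Add (Var 1) One)) (Add (Mul (Var 0) (Var 1)) (Var 0))" x y] that by (simp add: bas)
  show "\<not> x \<prec> \<zero>" if "x \<in> D" for x
    using ax[of "Neg (Lt (Var 0) Zero)" x x] that by (simp add: bas)
  show "x \<prec> y \<oplus> \<one> \<longleftrightarrow> x \<prec> y \<or> x = y" if "x \<in> D" "y \<in> D" for x y
    using ax[of "Iff (Lt (Var 0) (Add (Var 1) One)) (Dis (Lt (Var 0) (Var 1)) (Eq (Var 0) (Var 1)))" x y] that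
    by (simp add: bas) blast
  show "\<exists>z\<in>D. Q z x" if Q: "dz D D S (\<lambda>e. Q (e 0) (e 1))" and 0: "\<exists>z\<in>D. Q z \<zero>"
    and step: "\<And>x z. x \<in> D \<Longrightarrow> z \<in> D \<Longrightarrow> Q z x \<Longrightarrow> \<exists>z\<in>D. Q z (x \<oplus> \<one>)" and x: "x \<in> D" for Q x
  proof -
    obtain p \<rho> \<sigma> where p: "is_Delta00 p" "\<forall>i. \<rho> i \<in> D" "\<forall>k. \<sigma> k \<in> S"
      "\<forall>z x. Q z x = sat D S (z ## x ## \<rho>) \<sigma> p"
      using dz_represent2[OF Q X Z, where S = S] by auto
    have "sat D S \<rho> \<sigma> (induction_fml (ExN p))"
      by (rule models_closure[OF M]) (use p Sigma1_ExN in \<open>auto simp: RCA0_def\<close>)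
    then show ?thesis unfolding sat_induction_fml using p(4) 0 step x by simp blast
  qed
  show "\<exists>X\<in>S. \<forall>x\<in>D. x \<in> X \<longleftrightarrow> (\<exists>z\<in>D. Q z x)"
    if Q: "dz D D S (\<lambda>e. Q (e 0) (e 1))" and R: "dz D D S (\<lambda>e. R (e 0) (e 1))"
      and QR: "\<And>x. x \<in> D \<Longrightarrow> (\<exists>z\<in>D. Q z x) \<longleftrightarrow> (\<forall>z\<in>D. R z x)" for Q R
  proof -
    obtain p \<rho> \<sigma> where p: "is_Delta00 p" "\<forall>i. \<rho> i \<in> D" "\<forall>k. \<sigma> k \<in> S"
      "\<forall>z x. Q z x = sat D S (z ## x ## \<rho>) \<sigma> p"
      using dz_represent2[OF Q X Z, where S = S] by auto
    obtain q \<rho>' \<sigma>' where q: "is_Delta00 q" "\<forall>i. \<rho>' i \<in> D" "\<forall>k. \<sigma>' k \<in> S"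
      "\<forall>z x. R z x = sat D S (z ## x ## \<rho>') \<sigma>' q"
      using dz_represent2[OF R X Z, where S = S] by auto
    \<comment> \<open>The two matrices come with separate parameters, but the axiom has one
      assignment. Behind the shared variables \<open>z\<close> and \<open>x\<close> the parameters
      are interleaved, those with \<open>b = 0\<close> and those with \<open>b = 1\<close>
      alternating.\<close>
    define c where "c = (\<lambda>b i. case i of 0 \<Rightarrow> Var 0 | Suc j \<Rightarrow> (case j of 0 \<Rightarrow> Var 1 | Suc j \<Rightarrow> Var (2 + (2 * j + b))))"
    define \<rho>2 where "\<rho>2 = (\<lambda>i. if even i then \<rho> (i div 2) else \<rho>' (i div 2))"
    define \<sigma>2 where "\<sigma>2 = (\<lambda>i. if even i then \<sigma> (i div 2) else \<sigma>' (i div 2))"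
    define p' where "p' = subst_fml (c 0) (\<lambda>k. 2 * k) p"
    define q' where "q' = subst_fml (c 1) (\<lambda>k. 2 * k + 1) q"
    have "(\<lambda>i. val (z ## x ## \<rho>2) (c 0 i)) = z ## x ## \<rho>"
      "(\<lambda>i. val (z ## x ## \<rho>2) (c 1 i)) = z ## x ## \<rho>'"
      "(\<lambda>k. \<sigma>2 (2 * k)) = \<sigma>" "(\<lambda>k. \<sigma>2 (2 * k + 1)) = \<sigma>'" for z x
      by (auto simp: c_def \<rho>2_def \<sigma>2_def fun_eq_iff split: nat.split)
    then have p': "sat D S (z ## x ## \<rho>2) \<sigma>2 p' = Q z x"
      and q': "sat D S (z ## x ## \<rho>2) \<sigma>2 q' = R z x" for z x
      using p(4) q(4) by (simp_all add: p'_def q'_def sat_subst)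
    have "sat D S \<rho>2 \<sigma>2 (comprehension_fml (ExN p') (AllN q'))"
    proof (rule models_closure[OF M])
      have "is_Sigma0 1 (ExN p')" "is_Pi0 1 (AllN q')"
        unfolding p'_def q'_def
        using p(1) q(1) Sigma1_ExN Pi1_AllN is_Delta00_subst by blast+
      then show "univ_closure (comprehension_fml (ExN p') (AllN q')) \<in> RCA0"
        unfolding RCA0_def by blast
    qed (use p q in \<open>auto simp: \<rho>2_def \<sigma>2_def\<close>)
    then show ?thesis using QR unfolding sat_comprehension_fml by (simp add: p' q')
  qed
qed

end

section \<open>Arithmetic in models of \<open>RCA\<^sub>0\<close>\<close>

context ops
begin

abbreviation le (infix \<open>\<preceq>\<close> 50) where "x \<preceq> y \<equiv> x \<prec> y \<oplus> \<one>"

text \<open>With \<open>s\<close> the sum of the components, the value lies between the square of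
  \<open>s\<close> and the square of the successor of \<open>s\<close>, so it determines
  \<open>s\<close> and then \<open>x\<close>. No division by two is involved, so pairs are given by
  a term.\<close>

definition pr :: "'m \<Rightarrow> 'm \<Rightarrow> 'm" where
  "pr x y = (x \<oplus> y) \<odot> (x \<oplus> y) \<oplus> x"

text \<open>The bound on the quotient keeps divisibility Delta^0_0. It is automatic for a nonzero
  divisor.\<close>

definition dv :: "'m set \<Rightarrow> 'm \<Rightarrow> 'm \<Rightarrow> bool" where
  "dv D d x \<longleftrightarrow> (\<exists>q\<in>D. q \<prec> x \<oplus> \<one> \<and> x = q \<odot> d)"

text \<open>As for the beta function, the moduli \<open>(i + 1) m + 1\<close> are pairwise coprime for small \<open>i\<close> if \<open>m\<close>
  has enough divisors.\<close>

definition cd :: "'m set \<Rightarrow> 'm \<Rightarrow> 'm \<Rightarrow> 'm \<Rightarrow> bool" where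
  "cd D x m i \<longleftrightarrow> dv D ((i \<oplus> \<one>) \<odot> m \<oplus> \<one>) x"

lemma tm_pr: "tm C s \<Longrightarrow> tm C t \<Longrightarrow> tm C (\<lambda>e. pr (s e) (t e))"
  unfolding pr_def by (intro tm_add tm_mul)

lemma dz_dv: "tm C s \<Longrightarrow> tm C t \<Longrightarrow> dz D C U (\<lambda>e. dv D (s e) (t e))"
  unfolding dv_def
  by (intro dz_bex dz_eq tm_add tm_mul tm_one) (simp_all add: tm_shift tm_var)

lemma dz_cd: "tm C s \<Longrightarrow> tm C t \<Longrightarrow> tm C u \<Longrightarrow> dz D C U (\<lambda>e. cd D (s e) (t e) (u e))"
  unfolding cd_def by (intro dz_dv tm_add tm_mul tm_one)

lemma dz_sub1: "dz D C U (\<lambda>e. P (e 0)) \<Longrightarrow> tm C s \<Longrightarrow> dz D C U (\<lambda>e. P (s e))"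
  using dz_subst[where g = "\<lambda>e _. s e" and P = "\<lambda>e. P (e 0)"] by simp

lemma dz_sub4:
  assumes "dz D C U (\<lambda>e. P (e 0) (e 1) (e 2) (e 3))" "tm C s" "tm C t" "tm C u" "tm C v"
  shows "dz D C U (\<lambda>e. P (s e) (t e) (u e) (v e))"
  using dz_subst[OF assms(1), where g = "\<lambda>e. s e ## t e ## u e ## (\<lambda>_. v e)"] assms(2-5)
  by (simp add: tm_cons numeral_2_eq_2 numeral_3_eq_3)

lemma dz_sub3:
  "dz D C U (\<lambda>e. P (e 0) (e 1) (e 2)) \<Longrightarrow> tm C s \<Longrightarrow> tm C t \<Longrightarrow> tm C u
   \<Longrightarrow> dz D C U (\<lambda>e. P (s e) (t e) (u e))"
  using dz_sub4[where P = "\<lambda>x y z _. P x y z"] by blast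

lemma dz_sub2:
  "dz D C U (\<lambda>e. P (e 0) (e 1)) \<Longrightarrow> tm C s \<Longrightarrow> tm C t \<Longrightarrow> dz D C U (\<lambda>e. P (s e) (t e))"
  using dz_sub4[where P = "\<lambda>x y _ _. P x y"] by blast

end

context rca
begin

lemmas in_simps [simp] = zero_in one_in add_in mul_in

lemma pr_in [simp]: "x \<in> D \<Longrightarrow> y \<in> D \<Longrightarrow> pr x y \<in> D"
  by (simp add: pr_def)

lemma Delta0_induct:
  assumes "dz D D S (\<lambda>e. Q (e 0))" "Q \<zero>" "\<And>x. x \<in> D \<Longrightarrow> Q x \<Longrightarrow> Q (x \<oplus> \<one>)" "x \<in> D"
  shows "Q x"
proof -
  have "dz D D S (\<lambda>e. Q (e 1))" by (rule dz_sub1[OF assms(1) tm_var])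
  from Sigma1_induct[OF this, of x] show ?thesis using assms zero_in by blast
qed

subsection \<open>Semiring laws and order\<close>

lemma zero_a: assumes "x \<in> D" shows "\<zero> \<oplus> x = x"
proof (rule Delta0_induct[where Q = "\<lambda>x. \<zero> \<oplus> x = x"])
  show "dz D D S (\<lambda>e. \<zero> \<oplus> e 0 = e 0)" by (intro dz_intros)
qed (use assms in \<open>simp_all add: add_zero add_succ\<close>)

lemma succ_a: assumes "x \<in> D" "y \<in> D" shows "x \<oplus> \<one> \<oplus> y = x \<oplus> y \<oplus> \<one>"
proof (rule Delta0_induct[where Q = "\<lambda>y. x \<oplus> \<one> \<oplus> y = x \<oplus> y \<oplus> \<one>"])
  show "dz D D S (\<lambda>e. x \<oplus> \<one> \<oplus> e 0 = x \<oplus> e 0 \<oplus> \<one>)" by (intro dz_intros) (use assms in auto)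
qed (use assms in \<open>simp_all add: add_zero add_succ\<close>)

lemma a_comm: assumes "x \<in> D" "y \<in> D" shows "x \<oplus> y = y \<oplus> x"
proof (rule Delta0_induct[where Q = "\<lambda>y. x \<oplus> y = y \<oplus> x"])
  show "dz D D S (\<lambda>e. x \<oplus> e 0 = e 0 \<oplus> x)" by (intro dz_intros) (use assms in auto)
qed (use assms in \<open>simp_all add: add_zero add_succ zero_a succ_a\<close>)

lemma a_assoc: assumes "x \<in> D" "y \<in> D" "z \<in> D" shows "x \<oplus> y \<oplus> z = x \<oplus> (y \<oplus> z)"
proof (rule Delta0_induct[where Q = "\<lambda>z. x \<oplus> y \<oplus> z = x \<oplus> (y \<oplus> z)"])
  show "dz D D S (\<lambda>e. x \<oplus> y \<oplus> e 0 = x \<oplus> (y \<oplus> e 0))" by (intro dz_intros) (use assms in auto)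
qed (use assms in \<open>simp_all add: add_zero add_succ\<close>)

lemma a_lcomm: "x \<in> D \<Longrightarrow> y \<in> D \<Longrightarrow> z \<in> D \<Longrightarrow> x \<oplus> (y \<oplus> z) = y \<oplus> (x \<oplus> z)"
  by (metis a_assoc a_comm)

lemma zero_m: assumes "x \<in> D" shows "\<zero> \<odot> x = \<zero>"
proof (rule Delta0_induct[where Q = "\<lambda>x. \<zero> \<odot> x = \<zero>"])
  show "dz D D S (\<lambda>e. \<zero> \<odot> e 0 = \<zero>)" by (intro dz_intros) auto
qed (use assms in \<open>simp_all add: mul_zero mul_succ add_zero\<close>)

lemma succ_m: assumes "x \<in> D" "y \<in> D" shows "(x \<oplus> \<one>) \<odot> y = x \<odot> y \<oplus> y"
proof (rule Delta0_induct[where Q = "\<lambda>y. (x \<oplus> \<one>) \<odot> y = x \<odot> y \<oplus> y"])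
  show "dz D D S (\<lambda>e. (x \<oplus> \<one>) \<odot> e 0 = x \<odot> e 0 \<oplus> e 0)" by (intro dz_intros) (use assms in auto)
qed (use assms in \<open>simp_all add: mul_zero mul_succ add_zero a_assoc a_comm a_lcomm\<close>)

lemma m_comm: assumes "x \<in> D" "y \<in> D" shows "x \<odot> y = y \<odot> x"
proof (rule Delta0_induct[where Q = "\<lambda>y. x \<odot> y = y \<odot> x"])
  show "dz D D S (\<lambda>e. x \<odot> e 0 = e 0 \<odot> x)" by (intro dz_intros) (use assms in auto)
qed (use assms in \<open>simp_all add: mul_zero mul_succ zero_m succ_m\<close>)

lemma m_one: "x \<in> D \<Longrightarrow> x \<odot> \<one> = x"
  using mul_succ[of x \<zero>] by (simp add: zero_a mul_zero)

lemma one_m: "x \<in> D \<Longrightarrow> \<one> \<odot> x = x"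
  using m_one[of x] m_comm[of \<one> x] by simp

lemma dist_r: assumes "x \<in> D" "y \<in> D" "z \<in> D" shows "x \<odot> (y \<oplus> z) = x \<odot> y \<oplus> x \<odot> z"
proof (rule Delta0_induct[where Q = "\<lambda>z. x \<odot> (y \<oplus> z) = x \<odot> y \<oplus> x \<odot> z"])
  show "dz D D S (\<lambda>e. x \<odot> (y \<oplus> e 0) = x \<odot> y \<oplus> x \<odot> e 0)" by (intro dz_intros) (use assms in auto)
qed (use assms in \<open>simp_all add: mul_zero mul_succ add_zero flip: a_assoc\<close>)

lemma dist_l: "x \<in> D \<Longrightarrow> y \<in> D \<Longrightarrow> z \<in> D \<Longrightarrow> (y \<oplus> z) \<odot> x = y \<odot> x \<oplus> z \<odot> x"
  using m_comm[of "y \<oplus> z" x] m_comm[of y x] m_comm[of z x] dist_r[of x y z] by simp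

lemma m_assoc: assumes "x \<in> D" "y \<in> D" "z \<in> D" shows "x \<odot> y \<odot> z = x \<odot> (y \<odot> z)"
proof (rule Delta0_induct[where Q = "\<lambda>z. x \<odot> y \<odot> z = x \<odot> (y \<odot> z)"])
  show "dz D D S (\<lambda>e. x \<odot> y \<odot> e 0 = x \<odot> (y \<odot> e 0))" by (intro dz_intros) (use assms in auto)
qed (use assms in \<open>simp_all add: mul_zero mul_succ dist_r m_one\<close>)

lemma m_lcomm: "x \<in> D \<Longrightarrow> y \<in> D \<Longrightarrow> z \<in> D \<Longrightarrow> x \<odot> (y \<odot> z) = y \<odot> (x \<odot> z)"
  by (metis m_assoc m_comm)

lemmas arith = a_assoc a_comm a_lcomm m_assoc m_comm m_lcomm dist_l dist_r m_one one_m zero_m mul_zero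
  zero_a add_zero

lemma less_add_succ: assumes "x \<in> D" "y \<in> D" shows "x \<prec> x \<oplus> (y \<oplus> \<one>)"
proof (rule Delta0_induct[where Q = "\<lambda>y. x \<prec> x \<oplus> (y \<oplus> \<one>)"])
  show "dz D D S (\<lambda>e. x \<prec> x \<oplus> (e 0 \<oplus> \<one>))" by (intro dz_intros) (use assms in auto)
qed (use assms in \<open>simp_all add: zero_a add_succ less_succ\<close>)

text \<open>The order is primitive and its axioms speak only of zero and successor, so its link with
  addition has to be proved. The difference is the witness carried along by a Sigma^0_1
  induction.\<close>

lemma less_diff: assumes "x \<in> D" "y \<in> D" "x \<prec> y" shows "\<exists>z\<in>D. y = x \<oplus> (z \<oplus> \<one>)"
proof -
  have "\<exists>z\<in>D. x \<prec> y \<longrightarrow> y = x \<oplus> (z \<oplus> \<one>)"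
  proof (rule Sigma1_induct[where Q = "\<lambda>z y. x \<prec> y \<longrightarrow> y = x \<oplus> (z \<oplus> \<one>)"])
    show "dz D D S (\<lambda>e. x \<prec> e 1 \<longrightarrow> e 1 = x \<oplus> (e 0 \<oplus> \<one>))" by (intro dz_intros) (use assms in auto)
    show "\<exists>z\<in>D. x \<prec> \<zero> \<longrightarrow> \<zero> = x \<oplus> (z \<oplus> \<one>)" using not_less_zero assms zero_in by blast
    fix y z assume yz: "y \<in> D" "z \<in> D" "x \<prec> y \<longrightarrow> y = x \<oplus> (z \<oplus> \<one>)"
    show "\<exists>z\<in>D. x \<prec> y \<oplus> \<one> \<longrightarrow> y \<oplus> \<one> = x \<oplus> (z \<oplus> \<one>)"
    proof (cases "x = y")
      case True
      then show ?thesis using zero_in zero_a[OF one_in] by (intro bexI[of _ \<zero>]) auto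
    next
      case False
      then have "x \<prec> y \<oplus> \<one> \<longrightarrow> y \<oplus> \<one> = x \<oplus> (z \<oplus> \<one> \<oplus> \<one>)"
        using yz assms less_succ add_succ by auto
      then show ?thesis using yz by (intro bexI[of _ "z \<oplus> \<one>"]) auto
    qed
  qed (use assms in auto)
  then show ?thesis using assms by blast
qed

lemma a_cancel: assumes "x \<in> D" "y \<in> D" "z \<in> D" "x \<oplus> z = y \<oplus> z" shows "x = y"
proof -
  have "x \<oplus> z = y \<oplus> z \<longrightarrow> x = y"
  proof (rule Delta0_induct[where Q = "\<lambda>z. x \<oplus> z = y \<oplus> z \<longrightarrow> x = y"])
    show "dz D D S (\<lambda>e. x \<oplus> e 0 = y \<oplus> e 0 \<longrightarrow> x = y)" by (intro dz_intros) (use assms in auto)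
    show "x \<oplus> (z \<oplus> \<one>) = y \<oplus> (z \<oplus> \<one>) \<longrightarrow> x = y"
      if "z \<in> D" "x \<oplus> z = y \<oplus> z \<longrightarrow> x = y" for z
      using that assms succ_inj[of "x \<oplus> z" "y \<oplus> z"] by (simp add: add_succ)
  qed (use assms in \<open>simp_all add: add_zero\<close>)
  then show ?thesis using assms by blast
qed

lemma a_cancel_left: "x \<in> D \<Longrightarrow> y \<in> D \<Longrightarrow> z \<in> D \<Longrightarrow> z \<oplus> x = z \<oplus> y \<longleftrightarrow> x = y"
  using a_cancel a_comm by metis

lemma less_irrefl: assumes "x \<in> D" shows "\<not> x \<prec> x"
proof
  assume "x \<prec> x"
  then obtain z where "z \<in> D" "x \<oplus> \<zero> = x \<oplus> (z \<oplus> \<one>)" using less_diff assms add_zero by metis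
  then show False using a_cancel_left[of \<zero> "z \<oplus> \<one>" x] assms succ_not_zero by auto
qed

lemma less_trans: assumes "x \<in> D" "y \<in> D" "z \<in> D" "x \<prec> y" "y \<prec> z" shows "x \<prec> z"
proof -
  obtain u v where "u \<in> D" "y = x \<oplus> (u \<oplus> \<one>)" "v \<in> D" "z = y \<oplus> (v \<oplus> \<one>)"
    using less_diff assms by metis
  then have "z = x \<oplus> ((u \<oplus> \<one> \<oplus> v) \<oplus> \<one>)" using assms by (simp add: a_assoc)
  then show ?thesis using less_add_succ assms \<open>u \<in> D\<close> \<open>v \<in> D\<close> by simp
qed

lemma zero_less: assumes "x \<in> D" shows "x = \<zero> \<or> \<zero> \<prec> x"
proof (rule Delta0_induct[where Q = "\<lambda>x. x = \<zero> \<or> \<zero> \<prec> x"])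
  show "dz D D S (\<lambda>e. e 0 = \<zero> \<or> \<zero> \<prec> e 0)" by (intro dz_intros) (use assms in auto)
qed (use assms less_succ in auto)

lemma nonzero_succ: assumes "x \<in> D" "x \<noteq> \<zero>" shows "\<exists>y\<in>D. x = y \<oplus> \<one>"
proof -
  obtain y where "y \<in> D" "x = \<zero> \<oplus> (y \<oplus> \<one>)" using zero_less less_diff assms zero_in by metis
  then show ?thesis by (auto simp: zero_a)
qed

lemma less_linear: assumes "x \<in> D" "y \<in> D" shows "x \<prec> y \<or> x = y \<or> y \<prec> x"
proof (rule Delta0_induct[where Q = "\<lambda>x. x \<prec> y \<or> x = y \<or> y \<prec> x"])
  show "dz D D S (\<lambda>e. e 0 \<prec> y \<or> e 0 = y \<or> y \<prec> e 0)" by (intro dz_intros) (use assms in auto)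
  show "\<zero> \<prec> y \<or> \<zero> = y \<or> y \<prec> \<zero>" using zero_less assms by auto
  fix x assume x: "x \<in> D" "x \<prec> y \<or> x = y \<or> y \<prec> x"
  show "x \<oplus> \<one> \<prec> y \<or> x \<oplus> \<one> = y \<or> y \<prec> x \<oplus> \<one>"
  proof (cases "x \<prec> y")
    case True
    then obtain z where z: "z \<in> D" "y = x \<oplus> (z \<oplus> \<one>)" using less_diff x assms by blast
    show ?thesis
    proof (cases "z = \<zero>")
      case True
      then show ?thesis using z by (simp add: zero_a)
    next
      case False
      then obtain w where "w \<in> D" "z = w \<oplus> \<one>" using nonzero_succ z by blast
      then have "y = x \<oplus> \<one> \<oplus> (w \<oplus> \<one>)" using z x by (simp add: a_assoc a_comm a_lcomm)
      then show ?thesis using less_add_succ[of "x \<oplus> \<one>" w] x \<open>w \<in> D\<close> by simp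
    qed
  next
    case False
    then show ?thesis using x less_succ assms by auto
  qed
qed (use assms in auto)

lemma le_iff: "x \<in> D \<Longrightarrow> y \<in> D \<Longrightarrow> x \<preceq> y \<longleftrightarrow> (\<exists>z\<in>D. y = x \<oplus> z)"
proof
  assume *: "x \<in> D" "y \<in> D" "x \<preceq> y"
  then show "\<exists>z\<in>D. y = x \<oplus> z"
    using less_succ[of x y] less_diff[of x y] add_zero[of x] zero_in one_in add_in by metis
next
  assume *: "x \<in> D" "y \<in> D" "\<exists>z\<in>D. y = x \<oplus> z"
  then obtain z where z: "z \<in> D" "y = x \<oplus> z" by blast
  then show "x \<preceq> y" using less_add_succ[of x z] * by (simp add: a_assoc)
qed

lemma le_add: "x \<in> D \<Longrightarrow> y \<in> D \<Longrightarrow> x \<preceq> x \<oplus> y" "x \<in> D \<Longrightarrow> y \<in> D \<Longrightarrow> x \<preceq> y \<oplus> x"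
  using le_iff[of x "x \<oplus> y"] le_iff[of x "y \<oplus> x"] a_comm by auto

lemma le_refl: "x \<in> D \<Longrightarrow> x \<preceq> x"
  using less_succ by simp

lemma le_trans: "x \<in> D \<Longrightarrow> y \<in> D \<Longrightarrow> z \<in> D \<Longrightarrow> x \<preceq> y \<Longrightarrow> y \<preceq> z \<Longrightarrow> x \<preceq> z"
  using less_succ less_trans by metis

lemma le_less_trans: "x \<in> D \<Longrightarrow> y \<in> D \<Longrightarrow> z \<in> D \<Longrightarrow> x \<preceq> y \<Longrightarrow> y \<prec> z \<Longrightarrow> x \<prec> z"
  using less_succ less_trans by metis

lemma less_le_trans: "x \<in> D \<Longrightarrow> y \<in> D \<Longrightarrow> z \<in> D \<Longrightarrow> x \<prec> y \<Longrightarrow> y \<preceq> z \<Longrightarrow> x \<prec> z"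
  using less_succ less_trans by metis

lemma less_le: "x \<in> D \<Longrightarrow> y \<in> D \<Longrightarrow> x \<prec> y \<Longrightarrow> x \<preceq> y"
  using less_succ by simp

lemma not_less: "x \<in> D \<Longrightarrow> y \<in> D \<Longrightarrow> \<not> x \<prec> y \<longleftrightarrow> y \<preceq> x"
  using less_linear less_succ less_irrefl less_trans by metis

subsection \<open>Pairing\<close>

lemma pr_less:
  assumes D: "x \<in> D" "y \<in> D" "x' \<in> D" "y' \<in> D" and less: "x \<oplus> y \<prec> x' \<oplus> y'"
  shows "pr x y \<prec> pr x' y'"
proof -
  obtain z where z: "z \<in> D" "x' \<oplus> y' = x \<oplus> y \<oplus> (z \<oplus> \<one>)" using less_diff[OF _ _ less] D by auto
  \<comment> \<open>This is the expanded difference of the two pairs, less one, when the sums differ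
    by \<open>z \<oplus> \<one>\<close>.\<close>
  define w where "w = (x \<oplus> y) \<odot> (z \<oplus> \<one>) \<oplus> (z \<odot> (x \<oplus> y) \<oplus> (y \<oplus> (z \<odot> (z \<oplus> \<one>) \<oplus> (z \<oplus> x'))))"
  have w: "w \<in> D" using z D by (simp add: w_def)
  have "pr x' y' = pr x y \<oplus> (w \<oplus> \<one>)"
    using z(1) D unfolding pr_def z(2) w_def by (simp add: arith)
  then show ?thesis using less_add_succ w D by simp
qed

lemma pr_inj:
  assumes D: "x \<in> D" "y \<in> D" "x' \<in> D" "y' \<in> D" and eq: "pr x y = pr x' y'"
  shows "x = x' \<and> y = y'"
proof -
  have s: "x \<oplus> y = x' \<oplus> y'"
    using less_linear[of "x \<oplus> y" "x' \<oplus> y'"] pr_less[of x y x' y'] pr_less[of x' y' x y] D eq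
      less_irrefl[of "pr x y"] by auto
  then have "x = x'" using eq D a_cancel_left[of x x' "(x \<oplus> y) \<odot> (x \<oplus> y)"] by (simp add: pr_def)
  then show ?thesis using s D a_cancel_left[of y y' x] by simp
qed

lemma pr_iff: "x \<in> D \<Longrightarrow> y \<in> D \<Longrightarrow> x' \<in> D \<Longrightarrow> y' \<in> D \<Longrightarrow> pr x y = pr x' y' \<longleftrightarrow> x = x' \<and> y = y'"
  using pr_inj by blast

lemma pr_le1: "x \<in> D \<Longrightarrow> y \<in> D \<Longrightarrow> x \<preceq> pr x y"
  unfolding pr_def using le_add by simp

lemma pr_le2: assumes "x \<in> D" "y \<in> D" shows "y \<preceq> pr x y"
proof (cases "x \<oplus> y = \<zero>")
  case True
  then have "y = \<zero>" using nonzero_succ[of y] succ_not_zero assms add_succ by (metis add_in)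
  then show ?thesis using assms le_add(1)[of \<zero> "pr x y"] by (simp add: zero_a)
next
  case False
  then obtain w where w: "w \<in> D" "x \<oplus> y = w \<oplus> \<one>" using nonzero_succ[of "x \<oplus> y"] assms by auto
  have "pr x y = (w \<odot> (x \<oplus> y) \<oplus> (x \<oplus> x)) \<oplus> y"
    unfolding pr_def using assms w(1) by (subst (1) w(2)) (simp add: arith)
  then show ?thesis using le_add(2)[of y "w \<odot> (x \<oplus> y) \<oplus> (x \<oplus> x)"] assms w by simp
qed

subsection \<open>Bounding and least elements\<close>

text \<open>The level of bounding that \<open>RCA0\<close> does prove: the bound collected so far is
  the existential witness of a Sigma^0_1 induction.\<close>

lemma bounding:
  assumes P: "dz D D S (\<lambda>e. P (e 0) (e 1))" and m: "m \<in> D"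
    and ex: "\<And>i. i \<in> D \<Longrightarrow> i \<prec> m \<Longrightarrow> \<exists>j\<in>D. P j i"
  shows "\<exists>n\<in>D. \<forall>i\<in>D. i \<prec> m \<longrightarrow> (\<exists>j\<in>D. j \<prec> n \<and> P j i)"
proof -
  \<comment> \<open>The induction rule requires the step on all of \<open>D\<close>, while witnesses
    are given only below \<open>m\<close>; the guard makes the step trivial from \<open>m\<close>
    on.\<close>
  let ?Q = "\<lambda>n k. \<forall>i\<in>D. i \<prec> k \<longrightarrow> i \<prec> m \<longrightarrow> (\<exists>j\<in>D. j \<prec> n \<and> P j i)"
  have "\<exists>n\<in>D. ?Q n m"
  proof (rule Sigma1_induct[where Q = ?Q])
    show "dz D D S (\<lambda>e. ?Q (e 0) (e 1))" by (intro dz_intros dz_sub2[OF P] m)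
    show "\<exists>n\<in>D. ?Q n \<zero>" using zero_in not_less_zero by blast
    fix k n assume k: "k \<in> D" "n \<in> D" "?Q n k"
    show "\<exists>n\<in>D. ?Q n (k \<oplus> \<one>)"
    proof (cases "k \<prec> m")
      case True
      then obtain j where j: "j \<in> D" "P j k" using ex k by blast
      have "?Q (n \<oplus> (j \<oplus> \<one>)) (k \<oplus> \<one>)"
      proof (intro ballI impI)
        fix i assume i: "i \<in> D" "i \<preceq> k" "i \<prec> m"
        show "\<exists>j'\<in>D. j' \<prec> n \<oplus> (j \<oplus> \<one>) \<and> P j' i"
        proof (cases "i = k")
          case True
          then show ?thesis using j k le_add(2)[of j n] by (intro bexI[of _ j]) (auto simp: a_assoc)
        next
          case False
          then have "i \<prec> k" using i k less_succ by blast
          then obtain j' where j': "j' \<in> D" "j' \<prec> n" "P j' i" using k i by blast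
          then show ?thesis using less_trans[of j' n "n \<oplus> (j \<oplus> \<one>)"] less_add_succ[of n j] k j by auto
        qed
      qed
      then show ?thesis using k j by (intro bexI[of _ "n \<oplus> (j \<oplus> \<one>)"]) auto
    next
      case False
      then have "?Q n (k \<oplus> \<one>)" using k less_succ by metis
      then show ?thesis using k by blast
    qed
  qed (rule m)
  then show ?thesis by blast
qed

text \<open>Without a least element, refutations for all numbers up to \<open>t\<close> could be
  collected below one bound \<open>n\<close>: if everything below \<open>k\<close> is refuted, then
  \<open>k\<close> is refuted as well. The existence of \<open>n\<close> is Sigma^0_1, so induction
  reaches \<open>t\<close> and refutes it.\<close>

lemma least_Pi1:
  assumes P: "dz D D S (\<lambda>e. P (e 0) (e 1))" and t: "t \<in> D" "\<forall>z\<in>D. P z t"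
  shows "\<exists>t\<in>D. (\<forall>z\<in>D. P z t) \<and> (\<forall>t'\<in>D. t' \<prec> t \<longrightarrow> (\<exists>z\<in>D. \<not> P z t'))"
proof (rule ccontr)
  assume no: "\<not> ?thesis"
  let ?Q = "\<lambda>n k. \<forall>i\<in>D. i \<prec> k \<longrightarrow> (\<exists>z\<in>D. z \<prec> n \<and> \<not> P z i)"
  have "\<exists>n\<in>D. ?Q n (t \<oplus> \<one>)"
  proof (rule Sigma1_induct[where Q = ?Q])
    show "dz D D S (\<lambda>e. ?Q (e 0) (e 1))" by (intro dz_intros dz_sub2[OF P])
    show "\<exists>n\<in>D. ?Q n \<zero>" using zero_in not_less_zero by blast
    fix k n assume k: "k \<in> D" "n \<in> D" "?Q n k"
    then obtain j where j: "j \<in> D" "\<not> P j k" using no by blast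
    have "?Q (n \<oplus> (j \<oplus> \<one>)) (k \<oplus> \<one>)"
    proof (intro ballI impI)
      fix i assume i: "i \<in> D" "i \<preceq> k"
      show "\<exists>j'\<in>D. j' \<prec> n \<oplus> (j \<oplus> \<one>) \<and> \<not> P j' i"
      proof (cases "i = k")
        case True
        then show ?thesis using j k le_add(2)[of j n] by (intro bexI[of _ j]) (auto simp: a_assoc)
      next
        case False
        then have "i \<prec> k" using i k less_succ by blast
        then obtain j' where j': "j' \<in> D" "j' \<prec> n" "\<not> P j' i" using k i by blast
        then show ?thesis using less_trans[of j' n "n \<oplus> (j \<oplus> \<one>)"] less_add_succ[of n j] k j by auto
      qed
    qed
    then show "\<exists>n\<in>D. ?Q n (k \<oplus> \<one>)" using k j by (intro bexI[of _ "n \<oplus> (j \<oplus> \<one>)"]) auto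
  qed (use t in simp)
  then show False using t le_refl by blast
qed

lemma least:
  assumes P: "dz D D S (\<lambda>e. P (e 0))" and t: "t \<in> D" "P t"
  shows "\<exists>t\<in>D. P t \<and> (\<forall>t'\<in>D. t' \<prec> t \<longrightarrow> \<not> P t')"
proof -
  have "dz D D S (\<lambda>e. P (e 1))" by (rule dz_sub1[OF P tm_var])
  from least_Pi1[OF this t(1)] show ?thesis using t zero_in by blast
qed

end

section \<open>Finite sets and recursion\<close>

context rca
begin

section \<open>Divisibility and coprime moduli\<close>

lemma m_nonzero: assumes "x \<in> D" "y \<in> D" "x \<noteq> \<zero>" "y \<noteq> \<zero>" shows "x \<odot> y \<noteq> \<zero>"
proof -
  obtain u v where "u \<in> D" "x = u \<oplus> \<one>" "v \<in> D" "y = v \<oplus> \<one>" using nonzero_succ assms by metis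
  then have "x \<odot> y = (x \<odot> v \<oplus> u) \<oplus> \<one>" using assms by (simp add: mul_succ a_assoc)
  then show ?thesis using succ_not_zero[of "x \<odot> v \<oplus> u"] \<open>u \<in> D\<close> \<open>v \<in> D\<close> assms by simp
qed

lemma le_mult: assumes "x \<in> D" "y \<in> D" "y \<noteq> \<zero>" shows "x \<preceq> x \<odot> y"
proof -
  obtain v where "v \<in> D" "y = v \<oplus> \<one>" using nonzero_succ assms by metis
  then show ?thesis using le_add(2)[of x "x \<odot> v"] assms by (simp add: mul_succ)
qed

lemma dv_iff: "d \<in> D \<Longrightarrow> x \<in> D \<Longrightarrow> d \<noteq> \<zero> \<Longrightarrow> dv D d x \<longleftrightarrow> (\<exists>q\<in>D. x = q \<odot> d)"
  unfolding dv_def using le_mult[of _ d] by blast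

text \<open>There is no subtraction, so the quotients have to be compared. If the quotient of the
  sum is the smaller one, cancellation forces \<open>b = \<zero>\<close>.\<close>

lemma dvd_diff:
  assumes D: "d \<in> D" "a \<in> D" "b \<in> D" and q: "q \<in> D" "a \<oplus> b = q \<odot> d" and r: "r \<in> D" "a = r \<odot> d"
  shows "\<exists>s\<in>D. b = s \<odot> d"
proof (cases "q \<prec> r")
  case True
  then obtain s where s: "s \<in> D" "r = q \<oplus> (s \<oplus> \<one>)" using less_diff q r by blast
  have "a = (a \<oplus> b) \<oplus> (s \<oplus> \<one>) \<odot> d" using q r s D by (simp add: arith)
  then have "a \<oplus> \<zero> = a \<oplus> (b \<oplus> (s \<oplus> \<one>) \<odot> d)" using D s by (simp add: add_zero a_assoc)
  then have *: "\<zero> = b \<oplus> (s \<oplus> \<one>) \<odot> d" using D s by (simp add: a_cancel_left)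
  have "b = \<zero>"
  proof (rule ccontr)
    assume "b \<noteq> \<zero>"
    then obtain c where "c \<in> D" "b = c \<oplus> \<one>" using nonzero_succ D by blast
    then have "b \<oplus> (s \<oplus> \<one>) \<odot> d = (c \<oplus> (s \<oplus> \<one>) \<odot> d) \<oplus> \<one>" using D s by (simp add: succ_a)
    then show False using * succ_not_zero[of "c \<oplus> (s \<oplus> \<one>) \<odot> d"] \<open>c \<in> D\<close> D s by simp
  qed
  then show ?thesis using D by (intro bexI[of _ \<zero>]) (auto simp: zero_m)
next
  case False
  then obtain s where s: "s \<in> D" "q = r \<oplus> s" using not_less le_iff q r by blast
  then have "a \<oplus> b = a \<oplus> s \<odot> d" using q r D by (simp add: dist_l)
  then show ?thesis using D s a_cancel_left by auto
qed

abbreviation md :: "'a \<Rightarrow> 'a \<Rightarrow> 'a" where "md m i \<equiv> (i \<oplus> \<one>) \<odot> m \<oplus> \<one>"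

text \<open>If \<open>i\<close> and \<open>j\<close> differ by \<open>z \<oplus> \<one>\<close>,
  then so do \<open>(j \<oplus> \<one>) \<odot> md m i\<close> and
  \<open>(i \<oplus> \<one>) \<odot> md m j\<close>. Hence \<open>md m j\<close> divides
  \<open>y \<odot> (z \<oplus> \<one>)\<close>, and as \<open>z \<oplus> \<one>\<close> divides
  \<open>m\<close>, it divides \<open>y \<odot> m\<close>. Finally \<open>y\<close> is the
  difference of \<open>y \<odot> md m j\<close> and
  \<open>(j \<oplus> \<one>) \<odot> (y \<odot> m)\<close>.\<close>

lemma md_cancel:
  assumes D: "i \<in> D" "j \<in> D" "m \<in> D" "y \<in> D" "N \<in> D" and ij: "i \<noteq> j" "i \<prec> N" "j \<prec> N"
    and m: "\<And>z. z \<in> D \<Longrightarrow> z \<prec> N \<Longrightarrow> \<exists>q\<in>D. m = q \<odot> (z \<oplus> \<one>)"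
    and dvd: "q \<in> D" "y \<odot> md m i = q \<odot> md m j"
  shows "\<exists>r\<in>D. y = r \<odot> md m j"
proof -
  have "\<exists>z\<in>D. z \<prec> N \<and> (\<exists>s\<in>D. y \<odot> (z \<oplus> \<one>) = s \<odot> md m j)"
  proof (cases "j \<prec> i")
    case True
    then obtain z where z: "z \<in> D" "i = j \<oplus> (z \<oplus> \<one>)" using less_diff D by blast
    have "z \<prec> i" using less_add_succ[of z j] z D by (simp add: arith)
    then have zN: "z \<prec> N" using less_trans z D ij by blast
    have "(j \<oplus> \<one>) \<odot> (y \<odot> md m i) \<oplus> y \<odot> (z \<oplus> \<one>) = (y \<odot> (i \<oplus> \<one>)) \<odot> md m j"
      using z(1) D unfolding z(2) by (simp add: arith)
    moreover have "(j \<oplus> \<one>) \<odot> (y \<odot> md m i) = ((j \<oplus> \<one>) \<odot> q) \<odot> md m j"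
      using dvd D by (simp add: m_assoc)
    ultimately have "\<exists>s\<in>D. y \<odot> (z \<oplus> \<one>) = s \<odot> md m j"
      using D z dvd(1) by (intro dvd_diff[of "md m j" "(j \<oplus> \<one>) \<odot> (y \<odot> md m i)" _ "y \<odot> (i \<oplus> \<one>)" "(j \<oplus> \<one>) \<odot> q"]) simp_all
    then show ?thesis using z zN by blast
  next
    case False
    then have "i \<prec> j" using less_linear D ij by blast
    then obtain z where z: "z \<in> D" "j = i \<oplus> (z \<oplus> \<one>)" using less_diff D by blast
    have "z \<prec> j" using less_add_succ[of z i] z D by (simp add: arith)
    then have zN: "z \<prec> N" using less_trans z D ij by blast
    have "(y \<odot> (i \<oplus> \<one>)) \<odot> md m j \<oplus> y \<odot> (z \<oplus> \<one>) = (j \<oplus> \<one>) \<odot> (y \<odot> md m i)"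
      using z(1) D unfolding z(2) by (simp add: arith)
    moreover have "(j \<oplus> \<one>) \<odot> (y \<odot> md m i) = ((j \<oplus> \<one>) \<odot> q) \<odot> md m j"
      using dvd D by (simp add: m_assoc)
    ultimately have "\<exists>s\<in>D. y \<odot> (z \<oplus> \<one>) = s \<odot> md m j"
      using D z dvd(1) by (intro dvd_diff[of "md m j" "(y \<odot> (i \<oplus> \<one>)) \<odot> md m j" _ "(j \<oplus> \<one>) \<odot> q" "y \<odot> (i \<oplus> \<one>)"]) simp_all
    then show ?thesis using z zN by blast
  qed
  then obtain z s where z: "z \<in> D" "z \<prec> N" and s: "s \<in> D" "y \<odot> (z \<oplus> \<one>) = s \<odot> md m j" by blast
  obtain r where r: "r \<in> D" "m = r \<odot> (z \<oplus> \<one>)" using m z by blast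
  have "(j \<oplus> \<one>) \<odot> (y \<odot> m) = (j \<oplus> \<one>) \<odot> (r \<odot> (y \<odot> (z \<oplus> \<one>)))"
    using D r(1) z unfolding r(2) by (simp add: m_lcomm)
  also have "\<dots> = ((j \<oplus> \<one>) \<odot> (r \<odot> s)) \<odot> md m j"
    using D r(1) z s by (simp add: m_assoc)
  finally have "(j \<oplus> \<one>) \<odot> (y \<odot> m) = ((j \<oplus> \<one>) \<odot> (r \<odot> s)) \<odot> md m j" .
  moreover have "(j \<oplus> \<one>) \<odot> (y \<odot> m) \<oplus> y = y \<odot> md m j" using D by (simp add: arith)
  ultimately show ?thesis
    using D r s by (intro dvd_diff[of "md m j" "(j \<oplus> \<one>) \<odot> (y \<odot> m)" _ y "(j \<oplus> \<one>) \<odot> (r \<odot> s)"]) simp_all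
qed

text \<open>Plays the role of a factorial or a product over all \<open>z \<prec> N\<close>, neither
  of which is a term. Sigma^0_1 induction multiplies in one factor at a time.\<close>

lemma common_multiple:
  assumes f: "tm D (\<lambda>e. f (e 0))" "\<And>k. k \<in> D \<Longrightarrow> f k \<in> D \<and> f k \<noteq> \<zero>" and N: "N \<in> D"
  shows "\<exists>m\<in>D. m \<noteq> \<zero> \<and> (\<forall>z\<in>D. z \<prec> N \<longrightarrow> dv D (f z) m)"
proof (rule Sigma1_induct[where Q = "\<lambda>m k. m \<noteq> \<zero> \<and> (\<forall>z\<in>D. z \<prec> k \<longrightarrow> dv D (f z) m)"])
  show "dz D D S (\<lambda>e. e 0 \<noteq> \<zero> \<and> (\<forall>z\<in>D. z \<prec> e 1 \<longrightarrow> dv D (f z) (e 0)))"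
    by (intro dz_conj dz_not dz_eq dz_ball dz_dv tm_var tm_zero f(1))
  show "\<exists>m\<in>D. m \<noteq> \<zero> \<and> (\<forall>z\<in>D. z \<prec> \<zero> \<longrightarrow> dv D (f z) m)"
    using not_less_zero succ_not_zero[OF zero_in] by (intro bexI[of _ "\<zero> \<oplus> \<one>"]) auto
  fix k m assume k: "k \<in> D" "m \<in> D" "m \<noteq> \<zero> \<and> (\<forall>z\<in>D. z \<prec> k \<longrightarrow> dv D (f z) m)"
  let ?m = "m \<odot> f k"
  have m': "?m \<in> D" "?m \<noteq> \<zero>" using k f m_nonzero by auto
  have "dv D (f z) ?m" if z: "z \<in> D" "z \<preceq> k" for z
  proof (cases "z = k")
    case True
    then show ?thesis using f k m' by (subst dv_iff) auto
  next
    case False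
    then have "z \<prec> k" using z k less_succ by blast
    then obtain q where q: "q \<in> D" "m = q \<odot> f z" using k z f dv_iff[of "f z" m] by blast
    then have "?m = (q \<odot> f k) \<odot> f z" using f(2) k z by (simp add: m_assoc m_comm m_lcomm)
    then have "\<exists>q\<in>D. ?m = q \<odot> f z" using q(1) f(2)[OF k(1)] mul_in by blast
    then show ?thesis using f(2)[OF z(1)] m' by (subst dv_iff) auto
  qed
  then show "\<exists>m\<in>D. m \<noteq> \<zero> \<and> (\<forall>z\<in>D. z \<prec> k \<oplus> \<one> \<longrightarrow> dv D (f z) m)" using m' by blast
qed (rule N)

text \<open>The code of a set is the least common multiple of its moduli, hence is bounded by a common
  multiple of all of them, independently of the set.\<close>

lemma code_exists:
  assumes N: "N \<in> D"
  shows "\<exists>m\<in>D. \<exists>B\<in>D. \<forall>X. dz D D S (\<lambda>e. X (e 0)) \<longrightarrow>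
    (\<exists>x\<in>D. x \<preceq> B \<and> (\<forall>i\<in>D. i \<prec> N \<longrightarrow> (cd D x m i \<longleftrightarrow> X i)))"
proof -
  obtain m where m: "m \<in> D" "m \<noteq> \<zero>" "\<forall>z\<in>D. z \<prec> N \<longrightarrow> dv D (z \<oplus> \<one>) m"
    using common_multiple[of "\<lambda>k. k \<oplus> \<one>" N] N succ_not_zero tm_add[OF tm_var tm_one] by auto
  have mdD: "md m i \<in> D" "md m i \<noteq> \<zero>" if "i \<in> D" for i using that m succ_not_zero by auto
  have mq: "\<exists>q\<in>D. m = q \<odot> (z \<oplus> \<one>)" if "z \<in> D" "z \<prec> N" for z
    using m(3) that dv_iff[of "z \<oplus> \<one>" m] m(1) succ_not_zero by auto
  have "tm D (\<lambda>e. md m (e 0))" by (intro tm_intros) (use m in auto)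
  then obtain B where B: "B \<in> D" "B \<noteq> \<zero>" "\<forall>i\<in>D. i \<prec> N \<longrightarrow> dv D (md m i) B"
    using common_multiple[of "md m" N] N mdD by auto
  have "\<exists>x\<in>D. x \<preceq> B \<and> (\<forall>i\<in>D. i \<prec> N \<longrightarrow> (cd D x m i \<longleftrightarrow> X i))" if X: "dz D D S (\<lambda>e. X (e 0))" for X
  proof -
    \<comment> \<open>Zero is divisible by every modulus, so it has to be excluded before a least
      \<open>x\<close> is taken.\<close>
    let ?Q = "\<lambda>x. x \<noteq> \<zero> \<and> (\<forall>i\<in>D. i \<prec> N \<longrightarrow> X i \<longrightarrow> cd D x m i)"
    have dzQ: "dz D D S (\<lambda>e. ?Q (e 0))" by (intro dz_intros dz_cd dz_sub1[OF X] m N)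
    have QB: "?Q B" using B by (simp add: cd_def)
    obtain x where x: "x \<in> D" "?Q x" and least: "\<forall>x'\<in>D. x' \<prec> x \<longrightarrow> \<not> ?Q x'"
      using least[OF dzQ B(1) QB] by blast
    \<comment> \<open>If a modulus with \<open>i\<close> outside \<open>X\<close> divided
      \<open>x\<close>, it could be cancelled. By \<open>md_cancel\<close> the smaller quotient
      would keep all required divisors, against minimality.\<close>
    have "X i" if i: "i \<in> D" "i \<prec> N" "cd D x m i" for i
    proof (rule ccontr)
      assume "\<not> X i"
      obtain y where y: "y \<in> D" "x = y \<odot> md m i" using i x mdD dv_iff[of "md m i" x] by (auto simp: cd_def)
      have y0: "y \<noteq> \<zero>" using y x i mdD zero_m by auto
      have "(i \<oplus> \<one>) \<odot> m \<noteq> \<zero>" using m_nonzero[of "i \<oplus> \<one>" m] i m succ_not_zero by auto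
      then obtain w where w: "w \<in> D" "y \<odot> ((i \<oplus> \<one>) \<odot> m) = w \<oplus> \<one>"
        using nonzero_succ[of "y \<odot> ((i \<oplus> \<one>) \<odot> m)"] m_nonzero[of y "(i \<oplus> \<one>) \<odot> m"] y y0 i m by auto
      have "x = y \<oplus> (w \<oplus> \<one>)" 
        using mul_succ[of y "(i \<oplus> \<one>) \<odot> m"] y i m w a_comm[of y "w \<oplus> \<one>"] by simp
      then have "y \<prec> x" using less_add_succ y w by simp
      moreover have "?Q y"
      proof (intro conjI ballI impI)
        fix j assume j: "j \<in> D" "j \<prec> N" "X j"
        then have "cd D x m j" using x by blast
        then obtain q where q: "q \<in> D" "x = q \<odot> md m j" using j x mdD dv_iff[of "md m j" x] by (auto simp: cd_def)
        have "\<exists>r\<in>D. y = r \<odot> md m j"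
          by (rule md_cancel[of i j m y N q]) (use i j m y q N mq \<open>\<not> X i\<close> in auto)
        then show "cd D y m j" using j y mdD dv_iff[of "md m j" y] by (simp add: cd_def)
      qed (rule y0)
      ultimately show False using least y by blast
    qed
    moreover have "x \<preceq> B" using least QB B x less_linear[of x B] less_succ[of x B] by blast
    ultimately show ?thesis using x by blast
  qed
  then show ?thesis using m B by blast
qed

section \<open>Recursion for sets\<close>

lemma upper_bound2: assumes "x \<in> D" "y \<in> D" shows "\<exists>w\<in>D. x \<prec> w \<and> y \<prec> w"
  using le_add(1)[of x y] le_add(2)[of y x] assms by (intro bexI[of _ "x \<oplus> y \<oplus> \<one>"]) auto

text \<open>Every initial segment of the desired set has a code, and two codes of the same segment
  agree. So \<open>t\<close> belongs to the set if some correct code contains it, equivalently if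
  all correct codes do, and Delta^0_1 comprehension applies.\<close>

lemma set_recursion:
  fixes G :: "'a \<Rightarrow> 'a set \<Rightarrow> bool"
  assumes loc: "\<And>t X X'. t \<in> D \<Longrightarrow> (\<And>u. u \<in> D \<Longrightarrow> u \<prec> t \<Longrightarrow> u \<in> X \<longleftrightarrow> u \<in> X') \<Longrightarrow> G t X = G t X'"
    and G: "dz D D S (\<lambda>e. G (e 0) {u. cd D (e 1) (e 2) u})"
  shows "\<exists>T\<in>S. \<forall>t\<in>D. t \<in> T \<longleftrightarrow> G t T"
proof -
  define W where "W = (\<lambda>x m t. \<forall>i\<in>D. i \<prec> t \<longrightarrow> (cd D x m i \<longleftrightarrow> G i {u. cd D x m u}))"
  note G' = dz_sub3[where P = "\<lambda>a b c. G a {u. cd D b c u}", OF G]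
  have dzW: "dz D D S (\<lambda>e. W (e 0) (e 1) (e 2))"
    unfolding W_def by (intro dz_ball dz_iff dz_cd G' tm_var)
  note W' = dz_sub3[where P = W, OF dzW]
  have ex: "\<exists>m\<in>D. \<exists>x\<in>D. W x m N" if N: "N \<in> D" for N
  proof -
    obtain m B where m: "m \<in> D" "B \<in> D" and code: "\<And>X. dz D D S (\<lambda>e. X (e 0)) \<Longrightarrow>
      \<exists>x\<in>D. x \<preceq> B \<and> (\<forall>i\<in>D. i \<prec> N \<longrightarrow> (cd D x m i \<longleftrightarrow> X i))" using code_exists[OF N] by blast
    \<comment> \<open>Since \<open>m\<close> and \<open>B\<close> serve all segments up to
      \<open>N\<close>, the search for \<open>x\<close> is bounded and the induction statement is
      Delta^0_0.\<close>
    let ?Q = "\<lambda>t. t \<preceq> N \<longrightarrow> (\<exists>x\<in>D. x \<preceq> B \<and> W x m t)"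
    have "?Q N"
    proof (rule Delta0_induct[where Q = ?Q])
      show "dz D D S (\<lambda>e. ?Q (e 0))" by (intro dz_intros W' N m)
      show "?Q \<zero>" using le_add(1)[of \<zero> B] m not_less_zero by (auto simp: W_def zero_a intro!: bexI[of _ \<zero>])
      fix t assume t: "t \<in> D" "?Q t"
      show "?Q (t \<oplus> \<one>)"
      proof
        assume le: "t \<oplus> \<one> \<preceq> N"
        then have tN: "t \<prec> N" using le_refl[of t] less_le_trans[of t "t \<oplus> \<one>" N] t N by simp
        then obtain x where x: "x \<in> D" "W x m t" using t N less_le by blast
        let ?X = "\<lambda>i. (i \<prec> t \<and> cd D x m i) \<or> (i = t \<and> G t {u. cd D x m u})"
        have "dz D D S (\<lambda>e. ?X (e 0))" by (intro dz_intros dz_cd G' t m x)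
        from code[OF this] obtain x' where x': "x' \<in> D" "x' \<preceq> B" "\<And>i. i \<in> D \<Longrightarrow> i \<prec> N \<Longrightarrow> cd D x' m i \<longleftrightarrow> ?X i"
          by blast
        have same: "cd D x' m i \<longleftrightarrow> cd D x m i" if "i \<in> D" "i \<prec> t" for i
          using x'(3)[of i] that less_trans[of i t N] t N tN less_irrefl by blast
        have "cd D x' m i \<longleftrightarrow> G i {u. cd D x' m u}" if i: "i \<in> D" "i \<preceq> t" for i
        proof -
          have eq: "G i {u. cd D x' m u} = G i {u. cd D x m u}"
          proof (rule loc)
            fix u assume u: "u \<in> D" "u \<prec> i"
            then have "u \<prec> t" using less_le_trans[of u i t] i t by blast
            then show "u \<in> {u. cd D x' m u} \<longleftrightarrow> u \<in> {u. cd D x m u}" using same u by simp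
          qed (rule i)
          show ?thesis
          proof (cases "i = t")
            case True
            then show ?thesis using x'(3)[of t] t tN less_irrefl eq by auto
          next
            case False
            then have "i \<prec> t" using i t less_succ by blast
            then show ?thesis using eq same[OF i(1)] x(2) i unfolding W_def by blast
          qed
        qed
        then show "\<exists>x\<in>D. x \<preceq> B \<and> W x m (t \<oplus> \<one>)" using x' unfolding W_def by blast
      qed
    qed (rule N)
    then show ?thesis using m N le_refl by blast
  qed
  have unique: "cd D x m i \<longleftrightarrow> cd D x' m' i"
    if D: "x \<in> D" "m \<in> D" "x' \<in> D" "m' \<in> D" "t \<in> D" and W: "W x m t" "W x' m' t"
      and i: "i \<in> D" "i \<prec> t" for x m x' m' t i
  proof (rule ccontr)
    let ?P = "\<lambda>i. i \<prec> t \<and> \<not> (cd D x m i \<longleftrightarrow> cd D x' m' i)"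
    assume "\<not> (cd D x m i \<longleftrightarrow> cd D x' m' i)"
    then have i': "?P i" using i by blast
    have "dz D D S (\<lambda>e. ?P (e 0))" by (intro dz_intros dz_cd D)
    from least[OF this i(1) i'] obtain j where j: "j \<in> D" "?P j" "\<forall>i\<in>D. i \<prec> j \<longrightarrow> \<not> ?P i" by blast
    have "G j {u. cd D x m u} = G j {u. cd D x' m' u}"
    proof (rule loc)
      fix u assume u: "u \<in> D" "u \<prec> j"
      then have "u \<prec> t" using less_trans[of u j t] j D by blast
      then show "u \<in> {u. cd D x m u} \<longleftrightarrow> u \<in> {u. cd D x' m' u}" using j u by simp
    qed (rule j)
    then show False using j W unfolding W_def by blast
  qed
  \<comment> \<open>A single \<open>n\<close> bounds both components of the code, which leaves the
    one unbounded quantifier that comprehension allows.\<close>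
  let ?Q = "\<lambda>n t. \<exists>m\<in>D. m \<prec> n \<and> (\<exists>x\<in>D. x \<prec> n \<and> W x m (t \<oplus> \<one>) \<and> cd D x m t)"
  let ?R = "\<lambda>n t. \<forall>m\<in>D. m \<prec> n \<longrightarrow> (\<forall>x\<in>D. x \<prec> n \<longrightarrow> W x m (t \<oplus> \<one>) \<longrightarrow> cd D x m t)"
  have R_iff: "(\<forall>n\<in>D. ?R n t) \<longleftrightarrow> cd D x m t" "(\<exists>n\<in>D. ?Q n t) \<longleftrightarrow> cd D x m t"
    if a: "t \<in> D" "x \<in> D" "m \<in> D" "W x m (t \<oplus> \<one>)" for t x m
  proof -
    have u: "cd D x m t \<longleftrightarrow> cd D x' m' t" if "x' \<in> D" "m' \<in> D" "W x' m' (t \<oplus> \<one>)" for x' m'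
      by (rule unique[of _ _ _ _ "t \<oplus> \<one>"]) (use that a le_refl in auto)
    obtain n where "n \<in> D" "x \<prec> n" "m \<prec> n" using upper_bound2[OF a(2,3)] by blast
    then show "(\<forall>n\<in>D. ?R n t) \<longleftrightarrow> cd D x m t" "(\<exists>n\<in>D. ?Q n t) \<longleftrightarrow> cd D x m t" using u a by blast+
  qed
  have QR: "dz D D S (\<lambda>e. ?Q (e 0) (e 1))" "dz D D S (\<lambda>e. ?R (e 0) (e 1))"
    by (intro dz_intros dz_cd W')+
  have "(\<exists>n\<in>D. ?Q n t) \<longleftrightarrow> (\<forall>n\<in>D. ?R n t)" if "t \<in> D" for t
  proof -
    obtain m x where "m \<in> D" "x \<in> D" "W x m (t \<oplus> \<one>)" using ex[of "t \<oplus> \<one>"] \<open>t \<in> D\<close> by auto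
    from R_iff[OF \<open>t \<in> D\<close> this(2,1,3)] show ?thesis by simp
  qed
  from comprehension[of ?Q ?R, OF QR this]
  obtain T where T: "T \<in> S" "\<forall>t\<in>D. t \<in> T \<longleftrightarrow> (\<exists>n\<in>D. ?Q n t)" by blast
  have "t \<in> T \<longleftrightarrow> G t T" if t: "t \<in> D" for t
  proof -
    obtain m x where mx: "m \<in> D" "x \<in> D" "W x m (t \<oplus> \<one>)" using ex[of "t \<oplus> \<one>"] t by auto
    have agree: "i \<in> T \<longleftrightarrow> cd D x m i" if i: "i \<in> D" "i \<preceq> t" for i
    proof -
      have "W x m (i \<oplus> \<one>)" unfolding W_def
      proof (intro ballI impI)
        fix j assume "j \<in> D" "j \<preceq> i"
        then show "cd D x m j \<longleftrightarrow> G j {u. cd D x m u}" using mx(3) le_trans[of j i t] i t unfolding W_def by blast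
      qed
      then show ?thesis using R_iff(2)[OF i(1) mx(2,1)] T i by blast
    qed
    have "G t T = G t {u. cd D x m u}"
    proof (rule loc)
      fix u assume u: "u \<in> D" "u \<prec> t"
      then show "u \<in> T \<longleftrightarrow> u \<in> {u. cd D x m u}" using agree[of u] less_le[of u t] t by simp
    qed (rule t)
    then show ?thesis using agree[OF t le_refl[OF t]] mx(3) t le_refl[OF t] unfolding W_def by blast
  qed
  then show ?thesis using T by blast
qed

end

section \<open>Models with a universal set\<close>

primrec num :: "nat \<Rightarrow> trm" where
  "num 0 = Zero"
| "num (Suc n) = Add (num n) One"

abbreviation pair_trm :: "trm \<Rightarrow> trm \<Rightarrow> trm" where
  "pair_trm s t \<equiv> Add (Mul (Add s t) (Add s t)) s"

abbreviation triple_trm :: "trm \<Rightarrow> trm \<Rightarrow> trm \<Rightarrow> trm" where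
  "triple_trm r s t \<equiv> Add (pair_trm r (pair_trm s t)) One"

text \<open>With number variable 0 for \<open>c\<close> and set variables 0 and 1 for \<open>A\<close> and \<open>T\<close>, this says that for
  all \<open>t\<close>, \<open>\<forall>s \<langle>p,t,s\<rangle> \<in> T\<close> iff \<open>\<forall>z p(z,t,c,\<dots>,c;A,T,\<dots>,T)\<close>.\<close>

definition univ_fml :: "fml \<Rightarrow> fml" where
  "univ_fml p = AllN (Iff (AllN (Mem (triple_trm (num (to_nat p)) (Var 1) (Var 0)) 1))
     (AllN (subst_fml (\<lambda>i. Var (min i 2)) (\<lambda>k. min k 1) p)))"

lemma boundN_trm_subst: "(\<And>i. boundN_trm (f i) \<le> N) \<Longrightarrow> boundN_trm (subst_trm f t) \<le> N"
  by (induction t) auto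

lemma boundN_trm_lift: "boundN_trm (lift_trm t) \<le> Suc (boundN_trm t)"
  by (induction t) auto

lemma boundN_subst: "(\<And>i. boundN_trm (f i) \<le> N) \<Longrightarrow> boundN (subst_fml f g p) \<le> N"
proof (induction p arbitrary: f g N)
  case (AllN p)
  have "boundN_trm ((Var 0 ## (\<lambda>i. lift_trm (f i))) i) \<le> Suc N" for i
    using AllN.prems[of "i - 1"] boundN_trm_lift[of "f (i - 1)"] by (cases i) auto
  from AllN.IH[where f = "Var 0 ## (\<lambda>i. lift_trm (f i))" and g = g, OF this] show ?case by simp
next
  case (Imp p q)
  then show ?case by simp
qed (auto intro: boundN_trm_subst)

lemma boundS_subst: "(\<And>k. g k < N) \<Longrightarrow> boundS (subst_fml f g p) \<le> N"
proof (induction p arbitrary: f g N)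
  case (AllS p)
  have "(0 ## (\<lambda>k. Suc (g k))) k < Suc N" for k
    using AllS.prems by (cases k) auto
  from AllS.IH[where g = "0 ## (\<lambda>k. Suc (g k))" and f = f, OF this] show ?case by simp
next
  case (Mem t k)
  then show ?case by (simp add: Suc_leI)
qed auto

lemma boundN_num [simp]: "boundN_trm (num n) = 0"
  by (induction n) auto

lemma bound_univ_fml: "boundN (univ_fml p) \<le> 1" "boundS (univ_fml p) \<le> 2"
  using boundN_subst[of "\<lambda>i. Var (min i 2)" 3 "\<lambda>k. min k 1" p]
    boundS_subst[of "\<lambda>k. min k 1" 2 "\<lambda>i. Var (min i 2)" p]
  by (auto simp: univ_fml_def)

context ops
begin

primrec nm :: "nat \<Rightarrow> 'm" where
  "nm 0 = \<zero>"
| "nm (Suc n) = nm n \<oplus> \<one>"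

definition tr :: "'m \<Rightarrow> 'm \<Rightarrow> 'm \<Rightarrow> 'm" where
  "tr x y z = pr x (pr y z) \<oplus> \<one>"

lemma tm_tr: "tm C s \<Longrightarrow> tm C t \<Longrightarrow> tm C u \<Longrightarrow> tm C (\<lambda>e. tr (s e) (t e) (u e))"
  unfolding tr_def by (intro tm_add tm_pr tm_one)

lemma val_num: "val e (num n) = nm n"
  by (induction n) auto

lemma tm_nm: "tm C (\<lambda>e. nm n)"
  by (induction n) (auto intro: tm_intros)

lemma sat_univ_fml:
  "sat D S e \<sigma> (univ_fml p) \<longleftrightarrow> (\<forall>t\<in>D. (\<forall>s\<in>D. tr (nm (to_nat p)) t s \<in> \<sigma> 1)
     \<longleftrightarrow> (\<forall>z\<in>D. sat D S (z ## t ## (\<lambda>_. e 0)) (\<sigma> 0 ## (\<lambda>_. \<sigma> 1)) p))"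
proof -
  have "(\<lambda>i. val (z ## t ## e) (Var (min i 2))) = z ## t ## (\<lambda>_. e 0)" for z t
    by (auto simp: fun_eq_iff min_def numeral_2_eq_2 split: nat.split)
  moreover have "(\<lambda>k. \<sigma> (min k 1)) = \<sigma> 0 ## (\<lambda>_. \<sigma> 1)"
    by (auto simp: fun_eq_iff min_def split: nat.split)
  ultimately show ?thesis
    by (auto simp: univ_fml_def sat_subst val_num tr_def pr_def)
qed

lemma dz_finite_bex: "finite F \<Longrightarrow> (\<And>p. p \<in> F \<Longrightarrow> dz D C U (P p)) \<Longrightarrow> dz D C U (\<lambda>e. \<exists>p\<in>F. P p e)"
proof (induction F rule: finite_induct)
  case empty
  then show ?case by (simp add: dz_False)
next
  case (insert q F)
  then have "dz D C U (\<lambda>e. P q e \<or> (\<exists>p\<in>F. P p e))" by (intro dz_disj) auto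
  then show ?case by simp
qed

text \<open>All set variables but the first are read as the set coded by \<open>g e\<close> and
  \<open>h e\<close>. This makes a recursion clause that evaluates a formula on its own initial
  segment Delta^0_0 in the code.\<close>

lemma Delta00_dz_code:
  "is_Delta00 p \<Longrightarrow> (\<And>i. tm C (\<lambda>e. f e i)) \<Longrightarrow> tm C g \<Longrightarrow> tm C h \<Longrightarrow> A \<in> U
   \<Longrightarrow> dz D C U (\<lambda>e. sat D S (f e) (A ## (\<lambda>_. {u. cd D (g e) (h e) u})) p)"
proof (induction arbitrary: f g h rule: is_Delta00.induct)
  case (3 t k)
  then show ?case by (cases k) (simp_all add: dz_mem dz_cd tm_val)
next
  case (6 p t)
  let ?l = "\<lambda>g e. g (\<lambda>j. e (Suc j))"
  have "dz D C U (\<lambda>e. sat D S (e 0 ## ?l f e) (A ## (\<lambda>_. {u. cd D (?l g e) (?l h e) u})) p)"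
    by (rule 6(2)) (intro tm_cons tm_var tm_shift[OF 6(3)] tm_shift[OF 6(4)] tm_shift[OF 6(5)] 6(6))+
  from dz.dz_ball_env[OF tm_val[where g = f and t = t, OF 6(3)] this] show ?case by (simp add: val_lift)
next
  case (7 p t)
  let ?l = "\<lambda>g e. g (\<lambda>j. e (Suc j))"
  have "dz D C U (\<lambda>e. sat D S (e 0 ## ?l f e) (A ## (\<lambda>_. {u. cd D (?l g e) (?l h e) u})) p)"
    by (rule 7(2)) (intro tm_cons tm_var tm_shift[OF 7(3)] tm_shift[OF 7(4)] tm_shift[OF 7(5)] 7(6))+
  from dz_not[OF dz.dz_ball_env[OF tm_val[where g = f and t = t, OF 7(3)] dz_not[OF this]]] show ?case by (simp add: val_lift)
qed (simp_all add: dz.dz_eq dz.dz_lt dz.dz_False dz.dz_imp tm_val)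

end

context rca
begin

section \<open>Standard numbers, triples and monotonicity of terms\<close>

lemma nm_in [simp]: "nm n \<in> D"
  by (induction n) auto

lemma nm_inj: "nm m = nm n \<Longrightarrow> m = n"
proof (induction m arbitrary: n)
  case 0
  then show ?case using succ_not_zero[OF nm_in, of "n - 1"] by (cases n) auto
next
  case (Suc m)
  then show ?case using succ_not_zero[OF nm_in, of m] succ_inj[OF nm_in nm_in, of m "n - 1"]
    by (cases n) auto
qed

lemma nm_less: "m < n \<Longrightarrow> nm m \<prec> nm n"
  by (induction n) (auto simp: less_Suc_eq less_succ)

lemma tr_in [simp]: "x \<in> D \<Longrightarrow> y \<in> D \<Longrightarrow> z \<in> D \<Longrightarrow> tr x y z \<in> D"
  by (simp add: tr_def)

lemma tr_iff:
  assumes "x \<in> D" "y \<in> D" "z \<in> D" "x' \<in> D" "y' \<in> D" "z' \<in> D"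
  shows "tr x y z = tr x' y' z' \<longleftrightarrow> x = x' \<and> y = y' \<and> z = z'"
  using assms succ_inj[of "pr x (pr y z)" "pr x' (pr y' z')"] by (auto simp: tr_def pr_iff)

lemma less_tr: assumes "x \<in> D" "y \<in> D" "z \<in> D" shows "y \<prec> tr x y z" "z \<prec> tr x y z"
  using assms le_trans[of y "pr y z" "pr x (pr y z)"] le_trans[of z "pr y z" "pr x (pr y z)"]
  by (simp_all add: tr_def pr_le1 pr_le2)

lemma add_mono:
  assumes "x \<in> D" "y \<in> D" "x' \<in> D" "y' \<in> D" "x \<preceq> x'" "y \<preceq> y'" shows "x \<oplus> y \<preceq> x' \<oplus> y'"
proof -
  obtain u v where "u \<in> D" "x' = x \<oplus> u" "v \<in> D" "y' = y \<oplus> v" using assms le_iff by metis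
  then have "x' \<oplus> y' = x \<oplus> y \<oplus> (u \<oplus> v)" using assms by (simp add: a_assoc a_lcomm)
  then show ?thesis using le_add(1)[of "x \<oplus> y" "u \<oplus> v"] assms \<open>u \<in> D\<close> \<open>v \<in> D\<close> by simp
qed

lemma mul_mono:
  assumes "x \<in> D" "y \<in> D" "x' \<in> D" "y' \<in> D" "x \<preceq> x'" "y \<preceq> y'" shows "x \<odot> y \<preceq> x' \<odot> y'"
proof -
  obtain u v where uv: "u \<in> D" "x' = x \<oplus> u" "v \<in> D" "y' = y \<oplus> v" using assms le_iff by metis
  then have "x' \<odot> y' = x \<odot> y \<oplus> (x \<odot> v \<oplus> u \<odot> y')" using assms by (simp add: dist_l dist_r a_assoc a_lcomm)
  then show ?thesis using le_add(1)[of "x \<odot> y" "x \<odot> v \<oplus> u \<odot> y'"] assms uv by simp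
qed

lemma closed_D: "closed_dom D"
  by (simp add: closed_dom_def)

lemma val_mono:
  assumes "\<And>i. e i \<in> D" "\<And>i. e' i \<in> D" "\<And>i. e i \<preceq> e' i" shows "val e t \<preceq> val e' t"
  using assms by (induction t) (auto intro: add_mono mul_mono val_closed[OF closed_D] le_refl)

text \<open>The truth of a \<open>\<Delta>\<^sup>0\<^sub>0\<close> formula depends only on the elements of its sets up to the value of some
  term; this makes the following recursion for a universal set well-founded.\<close>

definition query_bounded :: "fml \<Rightarrow> trm \<Rightarrow> bool" where
  "query_bounded p b \<longleftrightarrow> (\<forall>e \<sigma> \<sigma>'. (\<forall>i. e i \<in> D) \<longrightarrow>
     (\<forall>k. \<forall>u\<in>D. u \<preceq> val e b \<longrightarrow> (u \<in> \<sigma> k \<longleftrightarrow> u \<in> \<sigma>' k)) \<longrightarrow> sat D S e \<sigma> p = sat D S e \<sigma>' p)"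

lemma query_boundedD:
  "query_bounded p b \<Longrightarrow> \<forall>i. e i \<in> D \<Longrightarrow> \<forall>k. \<forall>u\<in>D. u \<preceq> val e b \<longrightarrow> (u \<in> \<sigma> k \<longleftrightarrow> u \<in> \<sigma>' k)
   \<Longrightarrow> sat D S e \<sigma> p = sat D S e \<sigma>' p"
  unfolding query_bounded_def by blast

text \<open>Terms are monotone, so putting the bound \<open>t\<close> for the quantified variable in
  the query bound covers all of its values.\<close>

lemma query_bounded_quantifiers:
  assumes b: "query_bounded p b"
  shows "query_bounded (BAll t p) (subst_trm (t ## Var) b)" "query_bounded (BEx t p) (subst_trm (t ## Var) b)"
proof -
  have *: "sat D S (y ## e) \<sigma> p = sat D S (y ## e) \<sigma>' p"
    if e: "\<forall>i. e i \<in> D" and y: "y \<in> D" "y \<prec> val e t"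
      and agree: "\<forall>k. \<forall>u\<in>D. u \<preceq> val e (subst_trm (t ## Var) b) \<longrightarrow> (u \<in> \<sigma> k \<longleftrightarrow> u \<in> \<sigma>' k)" for e \<sigma> \<sigma>' y
  proof (rule query_boundedD[OF b])
    have D: "val e t \<in> D" "val (y ## e) b \<in> D" "val (val e t ## e) b \<in> D"
      using e y by (auto intro!: val_closed[OF closed_D] case_nat_in)
    have "val (y ## e) b \<preceq> val (val e t ## e) b"
      by (rule val_mono) (use e y D in \<open>auto simp: le_refl less_le split: nat.split\<close>)
    then show "\<forall>k. \<forall>u\<in>D. u \<preceq> val (y ## e) b \<longrightarrow> (u \<in> \<sigma> k \<longleftrightarrow> u \<in> \<sigma>' k)"
      using agree le_trans[OF _ D(2,3)] by (simp add: val_subst case_nat_val)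
  qed (use e y in \<open>auto intro!: case_nat_in\<close>)
  have "sat D S e \<sigma> (BAll t p) = sat D S e \<sigma>' (BAll t p) \<and> sat D S e \<sigma> (BEx t p) = sat D S e \<sigma>' (BEx t p)"
    if "\<forall>i. e i \<in> D" "\<forall>k. \<forall>u\<in>D. u \<preceq> val e (subst_trm (t ## Var) b) \<longrightarrow> (u \<in> \<sigma> k \<longleftrightarrow> u \<in> \<sigma>' k)" for e \<sigma> \<sigma>'
    using *[OF that(1) _ _ that(2)] by (auto simp: val_lift)
  then show "query_bounded (BAll t p) (subst_trm (t ## Var) b)" "query_bounded (BEx t p) (subst_trm (t ## Var) b)"
    unfolding query_bounded_def by blast+
qed

lemma query_bound: "is_Delta00 p \<Longrightarrow> \<exists>b. query_bounded p b"
proof (induction rule: is_Delta00.induct)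
  case (3 t k)
  show ?case by (rule exI[of _ t]) (auto simp: query_bounded_def val_closed[OF closed_D] le_refl)
next
  case (5 p q)
  then obtain b b' where b: "query_bounded p b" and b': "query_bounded q b'" by blast
  show ?case
  proof (intro exI[of _ "Add b b'"], unfold query_bounded_def, intro allI impI)
    fix e and \<sigma> \<sigma>' :: "nat \<Rightarrow> 'a set" assume e: "\<forall>i. e i \<in> D"
      and *: "\<forall>k. \<forall>u\<in>D. u \<preceq> val e (Add b b') \<longrightarrow> (u \<in> \<sigma> k \<longleftrightarrow> u \<in> \<sigma>' k)"
    have D: "val e b \<in> D" "val e b' \<in> D" using e val_closed[OF closed_D] by auto
    have "u \<preceq> val e b \<Longrightarrow> u \<preceq> val e (Add b b')" "u \<preceq> val e b' \<Longrightarrow> u \<preceq> val e (Add b b')" if "u \<in> D" for u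
      using that D le_trans[of u "val e b" "val e (Add b b')"] le_trans[of u "val e b'" "val e (Add b b')"]
      by (auto simp: le_add)
    then show "sat D S e \<sigma> (Imp p q) = sat D S e \<sigma>' (Imp p q)"
      using query_boundedD[OF b e, of \<sigma> \<sigma>'] query_boundedD[OF b' e, of \<sigma> \<sigma>'] * by auto
  qed
next
  case (6 p t)
  then show ?case using query_bounded_quantifiers(1) by blast
next
  case (7 p t)
  then show ?case using query_bounded_quantifiers(2) by blast
qed (auto simp: query_bounded_def)

text \<open>The clause for the triple of \<open>p\<close>, \<open>t\<close> and \<open>s\<close>
  evaluates \<open>p\<close> only at those \<open>z\<close> up to \<open>s\<close> whose queries to
  \<open>T\<close> also stay up to \<open>s\<close>. These queries are smaller than the triple
  itself, so the recursion may refer to \<open>T\<close>, and every \<open>z\<close> is treated at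
  some \<open>s\<close>.\<close>

lemma universal_set:
  assumes F: "finite F" "\<And>p. p \<in> F \<Longrightarrow> is_Delta00 p" and A: "A \<in> S" and c: "c \<in> D"
  shows "\<exists>T\<in>S. \<forall>p\<in>F. \<forall>t\<in>D. (\<forall>s\<in>D. tr (nm (to_nat p)) t s \<in> T)
    \<longleftrightarrow> (\<forall>z\<in>D. sat D S (z ## t ## (\<lambda>_. c)) (A ## (\<lambda>_. T)) p)"
proof -
  obtain b where b: "\<And>p. p \<in> F \<Longrightarrow> query_bounded p (b p)"
    using query_bound[OF F(2)] by metis
  define en where "en = (\<lambda>z x. z ## x ## (\<lambda>_::nat. c))"
  have en: "en z x i \<in> D" if "z \<in> D" "x \<in> D" for z x i
    using that c by (auto simp: en_def intro!: case_nat_in)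
  define H where "H = (\<lambda>p x s X. \<forall>z\<in>D. z \<preceq> s \<longrightarrow> val (en z x) (b p) \<preceq> s \<longrightarrow> sat D S (en z x) (A ## (\<lambda>_. X)) p)"
  define G where "G = (\<lambda>t X. \<exists>p\<in>F. \<exists>x\<in>D. x \<prec> t \<and> (\<exists>s\<in>D. s \<prec> t \<and> t = tr (nm (to_nat p)) x s \<and> H p x s X))"
  have "\<exists>T\<in>S. \<forall>t\<in>D. t \<in> T \<longleftrightarrow> G t T"
  proof (rule set_recursion)
    show "dz D D S (\<lambda>e. G (e 0) {u. cd D (e 1) (e 2) u})"
      unfolding G_def H_def en_def
      by (intro dz_finite_bex F(1) dz_bex dz_conj dz_eq dz_ball dz_imp dz_lt Delta00_dz_code
          tm_val tm_cons tm_tr tm_nm tm_add tm_one tm_var tm_const F(2) A c)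
  next
    fix t X X' assume t: "t \<in> D" and XX: "\<And>u. u \<in> D \<Longrightarrow> u \<prec> t \<Longrightarrow> u \<in> X \<longleftrightarrow> u \<in> X'"
    have "H p x s X = H p x s X'" if "p \<in> F" "x \<in> D" "s \<in> D" "s \<prec> t" for p x s
    proof -
      have "sat D S (en z x) (A ## (\<lambda>_. X)) p = sat D S (en z x) (A ## (\<lambda>_. X')) p"
        if z: "z \<in> D" "val (en z x) (b p) \<preceq> s" for z
      proof (rule query_boundedD[OF b[OF \<open>p \<in> F\<close>]], use en z \<open>x \<in> D\<close> in blast, intro allI ballI impI)
        fix k u assume u: "u \<in> D" "u \<preceq> val (en z x) (b p)"
        have "val (en z x) (b p) \<in> D" using val_closed[OF closed_D] en z \<open>x \<in> D\<close> by blast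
        then have "u \<prec> t" using u z le_trans[of u "val (en z x) (b p)" s] le_less_trans[of u s t] \<open>s \<in> D\<close> t \<open>s \<prec> t\<close> by blast
        then show "u \<in> (A ## (\<lambda>_. X)) k \<longleftrightarrow> u \<in> (A ## (\<lambda>_. X')) k" using XX u by (simp split: nat.split)
      qed
      then show ?thesis unfolding H_def by blast
    qed
    then show "G t X = G t X'" unfolding G_def by blast
  qed
  then obtain T where T: "T \<in> S" "\<And>t. t \<in> D \<Longrightarrow> t \<in> T \<longleftrightarrow> G t T" by blast
  have "(\<forall>s\<in>D. tr (nm (to_nat p)) t s \<in> T) \<longleftrightarrow> (\<forall>z\<in>D. sat D S (en z t) (A ## (\<lambda>_. T)) p)"
    if p: "p \<in> F" and t: "t \<in> D" for p t
  proof -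
    have *: "tr (nm (to_nat p)) t s \<in> T \<longleftrightarrow> H p t s T" if s: "s \<in> D" for s
    proof -
      have "G (tr (nm (to_nat p)) t s) T \<longleftrightarrow> H p t s T"
      proof
        assume "G (tr (nm (to_nat p)) t s) T"
        then obtain q x s' where q: "q \<in> F" "x \<in> D" "s' \<in> D"
          "tr (nm (to_nat p)) t s = tr (nm (to_nat q)) x s'" "H q x s' T" unfolding G_def by blast
        then have "nm (to_nat p) = nm (to_nat q) \<and> t = x \<and> s = s'" using tr_iff s t by simp
        then show "H p t s T" using q nm_inj[of "to_nat p" "to_nat q"] by auto
      next
        assume "H p t s T"
        then show "G (tr (nm (to_nat p)) t s) T"
          unfolding G_def using p s t less_tr[of "nm (to_nat p)" t s]
          by (intro bexI[of _ p] bexI[of _ t] bexI[of _ s] conjI) auto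
      qed
      then show ?thesis using T s t by simp
    qed
    show ?thesis
    proof
      assume L: "\<forall>s\<in>D. tr (nm (to_nat p)) t s \<in> T"
      show "\<forall>z\<in>D. sat D S (en z t) (A ## (\<lambda>_. T)) p"
      proof
        fix z assume z: "z \<in> D"
        have v: "val (en z t) (b p) \<in> D" using val_closed[OF closed_D] en z t by blast
        \<comment> \<open>This stage is large enough to admit both \<open>z\<close> and the queries
          made at \<open>z\<close>.\<close>
        then have "H p t (z \<oplus> val (en z t) (b p)) T" using L * z by simp
        then show "sat D S (en z t) (A ## (\<lambda>_. T)) p" using z v le_add unfolding H_def by simp
      qed
    qed (use * in \<open>auto simp: H_def\<close>)
  qed
  then show ?thesis unfolding en_def by (intro bexI[OF _ T(1)] ballI)
qed

end

section \<open>A nonstandard model with a universal set, by compactness\<close>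

context ops
begin

definition universal_model where
  "universal_model D S A T c \<Psi> \<longleftrightarrow> models D S RCA0 \<and> A \<in> S \<and> T \<in> S \<and> c \<in> D
    \<and> (\<forall>e \<sigma>. (\<forall>i. e i \<in> D) \<longrightarrow> (\<forall>Y\<in>S. sat D S e (Y ## A ## \<sigma>) \<Psi>))
    \<and> (\<forall>n. nm n \<prec> c)
    \<and> (\<forall>p. is_Delta00 p \<longrightarrow> (\<forall>t\<in>D. (\<forall>s\<in>D. tr (nm (to_nat p)) t s \<in> T)
         \<longleftrightarrow> (\<forall>z\<in>D. sat D S (z ## t ## (\<lambda>_. c)) (A ## (\<lambda>_. T)) p)))"

lemma models_sentences:
  assumes "closed_dom D" "\<And>i. e i \<in> D" "\<And>k. \<sigma> k \<in> S"
    and "\<And>p. p \<in> T \<Longrightarrow> is_sentence p" "\<And>p. p \<in> T \<Longrightarrow> sat D S e \<sigma> p"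
  shows "models D S T"
proof -
  have "sat D S e' \<sigma>' p" if "p \<in> T" for e' \<sigma>' p
    using assms(4,5)[OF that] sat_cong[of p e e' \<sigma> \<sigma>' D S] by (simp add: is_sentence_def)
  then show ?thesis unfolding models_def using assms by blast
qed

end

lemma RCA0_sentence: "p \<in> RCA0 \<Longrightarrow> is_sentence p"
  by (auto simp: RCA0_def basic_axioms_def is_sentence_def bound_univ_closure)

text \<open>Number variable 0 and set variables 0 and 1 act as names for \<open>c\<close>,
  \<open>A\<close> and \<open>T\<close>. A finite part of the theory already holds in any model of
  the consistent theory, with a standard value for \<open>c\<close> and a set \<open>T\<close> that
  handles only finitely many formulas.\<close>

theorem universal_model_exists:
  assumes sen: "is_sentence (ExS (AllS \<Psi>))" and con: "is_consistent (RCA0 \<union> {ExS (AllS \<Psi>)})"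
  shows "\<exists>(z::trm set) u a m l D S A T c. ops.universal_model z u a m l D S A T c \<Psi>"
proof -
  have psi: "boundN \<Psi> = 0" "boundS \<Psi> \<le> 2" using sen by (auto simp: is_sentence_def)
  define \<Gamma> where "\<Gamma> = RCA0 \<union> {AllS \<Psi>} \<union> range (\<lambda>n. Lt (num n) (Var 0)) \<union> univ_fml ` {p. is_Delta00 p}"
  have few: "few_vars \<Gamma>"
    unfolding few_vars_def
  proof (rule exI[of _ 2], rule ballI)
    fix q assume "q \<in> \<Gamma>"
    then consider "q \<in> RCA0" | "q = AllS \<Psi>" | n where "q = Lt (num n) (Var 0)" | p where "q = univ_fml p"
      unfolding \<Gamma>_def by blast
    then show "boundN q \<le> 2 \<and> boundS q \<le> 2"
    proof cases
      case 1
      then show ?thesis using RCA0_sentence by (simp add: is_sentence_def)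
    next
      case 4
      then show ?thesis using bound_univ_fml[of p] by simp
    qed (use psi in auto)
  qed
  have fin: "is_consistent F" if F: "finite F" "F \<subseteq> \<Gamma>" for F
  proof -
    have sen0: "is_sentence p" if "p \<in> RCA0 \<union> {ExS (AllS \<Psi>)}" for p
      using that RCA0_sentence sen by auto
    have "few_vars (RCA0 \<union> {ExS (AllS \<Psi>)})"
      unfolding few_vars_def using sen0 by (intro exI[of _ 0]) (auto simp: is_sentence_def)
    from henkin_model[OF con this refl] obtain z :: "trm set" and u a m l D S e \<sigma>
      where M0: "ops.closed_dom z u a m D" "\<And>i. e i \<in> D" "\<And>k. \<sigma> k \<in> S"
        "\<And>p. p \<in> RCA0 \<union> {ExS (AllS \<Psi>)} \<Longrightarrow> ops.sat z u a m l D S e \<sigma> p" by metis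
    interpret ops z u a m l .
    have M: "models D S RCA0"
      by (rule models_sentences[where e = e and \<sigma> = \<sigma>, OF M0(1-3)]) (use RCA0_sentence M0(4) in auto)
    interpret rca z u a m l D S using models_RCA0_rca[OF M] .
    obtain A where A: "A \<in> S" "sat D S e (A ## \<sigma>) (AllS \<Psi>)"
      using M0(4)[of "ExS (AllS \<Psi>)"] by auto
    obtain N where N: "finite N" "F \<inter> range (\<lambda>n. Lt (num n) (Var 0)) = (\<lambda>n. Lt (num n) (Var 0)) ` N"
      using finite_subset_image[of "F \<inter> range (\<lambda>n. Lt (num n) (Var 0))" "\<lambda>n. Lt (num n) (Var 0)" UNIV] F by auto
    obtain P where P: "finite P" "P \<subseteq> {p. is_Delta00 p}" "F \<inter> univ_fml ` {p. is_Delta00 p} = univ_fml ` P"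
      using finite_subset_image[of "F \<inter> univ_fml ` {p. is_Delta00 p}" univ_fml "{p. is_Delta00 p}"] F by auto
    \<comment> \<open>Finitely many lower bounds are demanded, so the successor of the largest
      suffices; the inserted 0 covers the case that there are none.\<close>
    define c where "c = nm (Suc (Max (insert 0 N)))"
    obtain T where T: "T \<in> S" "\<forall>p\<in>P. \<forall>t\<in>D. (\<forall>s\<in>D. tr (nm (to_nat p)) t s \<in> T)
        \<longleftrightarrow> (\<forall>z\<in>D. sat D S (z ## t ## (\<lambda>_. c)) (A ## (\<lambda>_. T)) p)"
      using universal_set[OF P(1) _ A(1), of c] P(2) unfolding c_def using nm_in by blast
    let ?e = "\<lambda>_::nat. c" and ?\<sigma> = "A ## (\<lambda>_. T)"
    have env: "\<And>i. ?e i \<in> D" "\<And>k. ?\<sigma> k \<in> S" using A T nm_in by (auto simp: c_def split: nat.split)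
    have "sat D S ?e ?\<sigma> q" if "q \<in> F" for q
    proof -
      consider "q \<in> RCA0" | "q = AllS \<Psi>" | "q \<in> (\<lambda>n. Lt (num n) (Var 0)) ` N" | "q \<in> univ_fml ` P"
        using F \<open>q \<in> F\<close> N P unfolding \<Gamma>_def by blast
      then show ?thesis
      proof cases
        case 1
        moreover have "\<forall>i. ?e i \<in> D" "\<forall>k. ?\<sigma> k \<in> S" using env by blast+
        ultimately show ?thesis using M unfolding models_def by metis
      next
        case 2
        have "sat D S e (A ## \<sigma>) (AllS \<Psi>) = sat D S ?e ?\<sigma> (AllS \<Psi>)"
          by (rule sat_cong) (use psi in \<open>auto split: nat.split\<close>)
        then show ?thesis using A 2 by simp
      next
        case 3
        then obtain n where "n \<in> N" "q = Lt (num n) (Var 0)" by blast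
        moreover have "n < Suc (Max (insert 0 N))" using \<open>n \<in> N\<close> N by (simp add: less_Suc_eq_le)
        ultimately show ?thesis using nm_less[of n "Suc (Max (insert 0 N))"] by (simp add: val_num c_def del: nm.simps)
      next
        case 4
        then obtain p where "p \<in> P" "q = univ_fml p" by blast
        then show ?thesis using T by (simp add: sat_univ_fml)
      qed
    qed
    then have "\<not> F \<turnstile> Fls" 
      using soundness[of F Fls D ?e ?\<sigma> S, OF _ M0(1) env] by auto
    then show ?thesis by (simp add: is_consistent_def)
  qed
  from compactness[OF few fin] obtain z :: "trm set" and u a m l D S e \<sigma>
    where M: "ops.closed_dom z u a m D" "\<And>i. e i \<in> D" "\<And>k. \<sigma> k \<in> S" "\<And>p. p \<in> \<Gamma> \<Longrightarrow> ops.sat z u a m l D S e \<sigma> p"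
    by metis
  interpret ops z u a m l .
  have "universal_model D S (\<sigma> 0) (\<sigma> 1) (e 0) \<Psi>"
    unfolding universal_model_def
  proof (intro conjI allI impI ballI)
    show "models D S RCA0"
      by (rule models_sentences[where e = e and \<sigma> = \<sigma>, OF M(1-3)]) (use RCA0_sentence M(4) in \<open>auto simp: \<Gamma>_def\<close>)
    show "\<sigma> 0 \<in> S" "\<sigma> 1 \<in> S" "e 0 \<in> D" using M by auto
    show "l (nm n) (e 0)" for n using M(4)[of "Lt (num n) (Var 0)"] by (simp add: \<Gamma>_def val_num)
    show "sat D S e' (Y ## \<sigma> 0 ## \<sigma>') \<Psi>" if "Y \<in> S" for e' \<sigma>' Y
    proof -
      have "sat D S e (Y ## \<sigma>) \<Psi>" using M(4)[of "AllS \<Psi>"] that by (simp add: \<Gamma>_def)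
      moreover have "sat D S e (Y ## \<sigma>) \<Psi> = sat D S e' (Y ## \<sigma> 0 ## \<sigma>') \<Psi>"
        by (rule sat_cong) (use psi in \<open>auto split: nat.split\<close>)
      ultimately show ?thesis by simp
    qed
    show "(\<forall>s\<in>D. tr (nm (to_nat p)) t s \<in> \<sigma> 1)
         \<longleftrightarrow> (\<forall>z\<in>D. sat D S (z ## t ## (\<lambda>_. e 0)) (\<sigma> 0 ## (\<lambda>_. \<sigma> 1)) p)"
      if "is_Delta00 p" "t \<in> D" for p t
      using M(4)[of "univ_fml p"] that by (simp add: \<Gamma>_def sat_univ_fml)
  qed
  then show ?thesis by blast
qed

section \<open>The hull\<close>

context ops
begin

text \<open>Terms contain no projections. As a pair bounds its components, unpairing can be done by
  bounded quantifiers, and it fails on numbers that are not pairs.\<close>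

definition unp :: "'m set \<Rightarrow> 'm \<Rightarrow> ('m \<Rightarrow> 'm \<Rightarrow> bool) \<Rightarrow> bool" where
  "unp D t B \<longleftrightarrow> (\<exists>x\<in>D. x \<prec> t \<oplus> \<one> \<and> (\<exists>y\<in>D. y \<prec> t \<oplus> \<one> \<and> t = pr x y \<and> B x y))"

lemma dz_unp:
  assumes t: "tm C t" and B: "dz D C U (\<lambda>e. B (e 1) (e 0) (\<lambda>i. e (Suc (Suc i))))"
  shows "dz D C U (\<lambda>e. unp D (t e) (\<lambda>x y. B x y e))"
  unfolding unp_def
  by (intro dz_bex dz_conj dz_eq tm_add tm_one tm_pr tm_var tm_shift[OF t] t
      tm_shift[OF tm_shift[OF t], simplified] B[simplified])

end

context rca
begin

lemma unp_pr: "x \<in> D \<Longrightarrow> y \<in> D \<Longrightarrow> unp D (pr x y) B \<longleftrightarrow> B x y"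
proof -
  assume xy: "x \<in> D" "y \<in> D"
  have "unp D (pr x y) B" if "B x y"
    unfolding unp_def by (rule bexI[OF _ xy(1)], rule conjI[OF pr_le1[OF xy]], rule bexI[OF _ xy(2)])
      (simp add: pr_le2 xy that)
  moreover have "B x y" if "unp D (pr x y) B"
    using that xy unfolding unp_def by (auto simp: pr_iff)
  ultimately show ?thesis by blast
qed

lemma unpE:
  assumes "unp D t B" obtains x y where "x \<in> D" "y \<in> D" "t = pr x y" "B x y"
  using assms unfolding unp_def by blast

lemma pr_mono:
  assumes "x \<in> D" "y \<in> D" "x' \<in> D" "y' \<in> D" "x \<preceq> x'" "y \<preceq> y'" shows "pr x y \<preceq> pr x' y'"
  unfolding pr_def using assms by (intro add_mono mul_mono) simp_all

lemma tm_in: "tm C t \<Longrightarrow> C \<subseteq> D \<Longrightarrow> (\<And>i. e i \<in> D) \<Longrightarrow> t e \<in> D"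
  by (induction rule: tm.induct) auto

end

locale umodel = rca +
  fixes A T c
  assumes A: "A \<in> S" and T: "T \<in> S" and c: "c \<in> D" and nm_c: "nm n \<prec> c"
    and univ: "is_Delta00 p \<Longrightarrow> t \<in> D \<Longrightarrow> (\<forall>s\<in>D. tr (nm (to_nat p)) t s \<in> T)
         \<longleftrightarrow> (\<forall>z\<in>D. sat D S (z ## t ## (\<lambda>_. c)) (A ## (\<lambda>_. T)) p)"
begin

text \<open>The index is the code of an actual formula, hence standard. Only \<open>c\<close> can
  occur as a number parameter, since every variable other than those for \<open>z\<close> and
  \<open>t\<close> is read as \<open>c\<close>.\<close>

lemma universality:
  assumes "dz D {c} {A, T} (\<lambda>e. Q (e 0) (e 1))"
  shows "\<exists>n. \<forall>t\<in>D. (\<forall>s\<in>D. tr (nm n) t s \<in> T) \<longleftrightarrow> (\<forall>z\<in>D. Q z t)"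
proof -
  obtain p \<rho> \<sigma> where p: "is_Delta00 p" "\<forall>i. \<rho> i \<in> {c}" "\<forall>k. \<sigma> k \<in> {A, T}"
    "\<forall>z x. Q z x = sat D S (z ## x ## \<rho>) \<sigma> p"
    using dz_represent2[OF assms, of A c S] by auto
  define q where "q = subst_fml Var (\<lambda>k. if \<sigma> k = A then 0 else 1) p"
  have \<rho>: "\<rho> = (\<lambda>_. c)" using p(2) by auto
  have "(\<lambda>k. (A ## (\<lambda>_. T)) (if \<sigma> k = A then 0 else 1)) = \<sigma>"
    using p(3) by (auto simp: fun_eq_iff)
  then have "Q z x = sat D S (z ## x ## (\<lambda>_. c)) (A ## (\<lambda>_. T)) q" for z x
    using p(4) \<rho> by (simp add: q_def sat_subst)
  moreover have "is_Delta00 q" using p(1) by (simp add: q_def is_Delta00_subst)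
  ultimately show ?thesis using univ by (intro exI[of _ "to_nat q"]) simp
qed

definition isleast :: "nat \<Rightarrow> 'a \<Rightarrow> bool" where
  "isleast n t \<longleftrightarrow> t \<in> D \<and> (\<forall>s\<in>D. tr (nm n) t s \<in> T) \<and> (\<forall>t'\<in>D. t' \<prec> t \<longrightarrow> (\<exists>s\<in>D. tr (nm n) t' s \<notin> T))"

lemma isleast_unique: "isleast n t \<Longrightarrow> isleast n t' \<Longrightarrow> t = t'"
  using less_linear[of t t'] unfolding isleast_def by blast

text \<open>The Skolem hull of \<open>c\<close> for \<open>\<Sigma>\<^sup>0\<^sub>2(A, T)\<close> formulas.\<close>

definition K :: "'a set" where
  "K = {x \<in> D. \<exists>n. \<exists>y\<in>D. isleast n (pr x y)}"

lemma K_D: "K \<subseteq> D"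
  by (auto simp: K_def)

lemma K_in [simp]: "x \<in> K \<Longrightarrow> x \<in> D"
  using K_D by blast

lemma AT_S: "{A, T} \<subseteq> S"
  using A T by simp

text \<open>The pairs \<open>pr u r\<close> whose components satisfy the matrix form a Pi^0_1 class,
  and the first component of its least element is in \<open>K\<close> by definition. Nothing is
  claimed about the second component of that element.\<close>

lemma hull_pair_witness:
  assumes Q: "dz D {c} {A, T} (\<lambda>e. Q (e 0) (e 1) (e 2))" and ur: "u \<in> D" "r \<in> D" "\<forall>v\<in>D. Q v u r"
  shows "\<exists>u\<in>K. \<exists>r\<in>D. \<forall>v\<in>D. Q v u r"
proof -
  let ?G = "\<lambda>z t. unp D t (\<lambda>u r. Q z u r)"
  have G: "dz D {c} {A, T} (\<lambda>e. ?G (e 0) (e 1))"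
    by (intro dz_unp dz_sub3[OF Q] tm_var)
  have G': "dz D D S (\<lambda>e. ?G (e 0) (e 1))" using dz_mono[OF G _ AT_S] c by blast
  have G0: "\<forall>z\<in>D. ?G z (pr u r)" using ur by (simp add: unp_pr)
  obtain t where t: "t \<in> D" "\<forall>z\<in>D. ?G z t" "\<forall>t'\<in>D. t' \<prec> t \<longrightarrow> (\<exists>z\<in>D. \<not> ?G z t')"
    using least_Pi1[of ?G, OF G' _ G0] ur by auto
  obtain n where n: "\<forall>t\<in>D. (\<forall>s\<in>D. tr (nm n) t s \<in> T) \<longleftrightarrow> (\<forall>z\<in>D. ?G z t)"
    using universality[of ?G, OF G] by blast
  have least: "isleast n t" unfolding isleast_def using t n by blast
  obtain u' r' where u': "u' \<in> D" "r' \<in> D" "t = pr u' r'" using t(2) zero_in unpE by metis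
  then have "\<forall>v\<in>D. Q v u' r'" using t(2) by (simp add: unp_pr)
  moreover have "u' \<in> K" unfolding K_def using u' least by blast
  ultimately show ?thesis using u' by blast
qed

lemma c_K: "c \<in> K"
proof -
  have "dz D {c} {A, T} (\<lambda>e. e 1 = c)" by (intro dz_eq tm_var tm_const) simp
  from hull_pair_witness[where Q = "\<lambda>v u r. u = c", OF this c c] show ?thesis using zero_in by blast
qed

text \<open>Parameters from \<open>K\<close> are eliminated by adding their definitions to the
  matrix. Being the least element with a given index becomes Pi^0_1 once a bound on the refutations
  of smaller elements is given, so \<open>r\<close> stores both least elements and a common bound
  \<open>w\<close>.\<close>

lemma hull_witness2:
  assumes P: "dz D {c} {A, T} (\<lambda>e. P (e 0) (e 1) (e 2) (e 3))"
    and a: "a1 \<in> K" "a2 \<in> K" and u: "u \<in> D" "\<forall>v\<in>D. P v u a1 a2"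
  shows "\<exists>u\<in>K. \<forall>v\<in>D. P v u a1 a2"
proof -
  obtain n1 b1 where 1: "b1 \<in> D" "isleast n1 (pr a1 b1)" using a(1) unfolding K_def by blast
  obtain n2 b2 where 2: "b2 \<in> D" "isleast n2 (pr a2 b2)" using a(2) unfolding K_def by blast
  have aD: "a1 \<in> D" "a2 \<in> D" using a K_D by auto
  define Y where "Y = (\<lambda>n t w. \<forall>t'\<in>D. t' \<prec> t \<longrightarrow> (\<exists>s\<in>D. s \<prec> w \<and> tr (nm n) t' s \<notin> T))"
  have dzY: "dz D {c} {A, T} (\<lambda>e. Y n (e 0) (e 1))" for n
    unfolding Y_def by (intro dz_ball dz_bex dz_conj dz_lt dz_not dz_mem tm_tr tm_nm tm_var) simp
  have Y_ex: "\<exists>w\<in>D. Y n t w" if "isleast n t" for n t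
    unfolding Y_def
  proof (rule bounding[where P = "\<lambda>s t'. tr (nm n) t' s \<notin> T"])
    show "dz D D S (\<lambda>e. tr (nm n) (e 1) (e 0) \<notin> T)" by (intro dz_not dz_mem tm_tr tm_nm tm_var T)
  qed (use that in \<open>auto simp: isleast_def\<close>)
  have Y_least: "isleast n t" if "t \<in> D" "\<forall>z\<in>D. tr (nm n) t z \<in> T" "Y n t w" for n t w
    using that unfolding isleast_def Y_def by blast
  let ?B = "\<lambda>z u w t1 t2 x x'. P z u x x' \<and> tr (nm n1) t1 z \<in> T \<and> tr (nm n2) t2 z \<in> T \<and> Y n1 t1 w \<and> Y n2 t2 w"
  let ?Q = "\<lambda>z u r. unp D r (\<lambda>q w. unp D q (\<lambda>t1 t2. unp D t1 (\<lambda>x y. unp D t2 (\<lambda>x' y'. ?B z u w t1 t2 x x'))))"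
  have Q: "dz D {c} {A, T} (\<lambda>e. ?Q (e 0) (e 1) (e 2))"
    by (intro dz_unp dz_conj dz_sub4[OF P] dz_sub2[OF dzY] dz_mem tm_tr tm_nm tm_var) simp_all
  obtain w1 w2 where w: "w1 \<in> D" "Y n1 (pr a1 b1) w1" "w2 \<in> D" "Y n2 (pr a2 b2) w2"
    using Y_ex 1 2 by blast
  define w where "w = w1 \<oplus> w2"
  have Y_mono: "Y n t w'" if "Y n t w" "w \<in> D" "w' \<in> D" "w \<preceq> w'" for n t w w'
    using that less_le_trans unfolding Y_def by blast
  have wY: "w \<in> D" "Y n1 (pr a1 b1) w" "Y n2 (pr a2 b2) w"
    using w le_add Y_mono[OF w(2)] Y_mono[OF w(4)] by (auto simp: w_def)
  let ?r = "pr (pr (pr a1 b1) (pr a2 b2)) w"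
  have "\<forall>z\<in>D. ?Q z u ?r"
    using u aD 1 2 wY by (simp add: unp_pr isleast_def)
  then obtain u' r where u': "u' \<in> K" "r \<in> D" "\<forall>z\<in>D. ?Q z u' r"
    using hull_pair_witness[of ?Q, OF Q u(1), of ?r] aD 1 2 wY by auto
  then have "?Q \<zero> u' r" using zero_in by blast
  then obtain x y x' y' w' where xy: "x \<in> D" "y \<in> D" "x' \<in> D" "y' \<in> D" "w' \<in> D" "r = pr (pr (pr x y) (pr x' y')) w'"
    by (elim unpE) (metis (no_types))
  then have B: "\<forall>z\<in>D. ?B z u' w' (pr x y) (pr x' y') x x'" using u'(3) by (simp add: unp_pr)
  \<comment> \<open>The decoded elements are least elements with the same indices as before, so by
    uniqueness they carry the original parameters.\<close>
  then have "isleast n1 (pr x y)" "isleast n2 (pr x' y')"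
    using Y_least[of "pr x y" n1 w'] Y_least[of "pr x' y'" n2 w'] xy zero_in by auto
  then have "pr x y = pr a1 b1" "pr x' y' = pr a2 b2" using isleast_unique 1 2 by blast+
  then have "x = a1" "x' = a2" using xy aD 1 2 by (auto simp: pr_iff)
  then show ?thesis using B u' by blast
qed

section \<open>Closure of the hull and packing of parameters\<close>

lemma pr_K: assumes "a \<in> K" "b \<in> K" shows "pr a b \<in> K"
proof -
  have P: "dz D {c} {A, T} (\<lambda>e. e 1 = pr (e 2) (e 3))" by (intro dz_eq tm_pr tm_var)
  obtain u where "u \<in> K" "\<forall>v\<in>D. u = pr a b"
    using hull_witness2[where P = "\<lambda>v u x y. u = pr x y", OF P assms, of "pr a b"] assms by auto
  then show ?thesis using zero_in by blast
qed

lemma closed_K: "closed_dom K"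
proof -
  have *: "f a b \<in> K" if P: "dz D {c} {A, T} (\<lambda>e. e 1 = f (e 2) (e 3))" and ab: "a \<in> K" "b \<in> K" "f a b \<in> D" for f a b
  proof -
    obtain u where "u \<in> K" "\<forall>v\<in>D. u = f a b"
      using hull_witness2[where P = "\<lambda>v u x y. u = f x y", OF P ab(1,2), of "f a b"] ab(3) by auto
    then show ?thesis using zero_in by blast
  qed
  have "\<zero> \<in> K"
    by (rule *[of "\<lambda>_ _. \<zero>" c c]) (rule dz_eq[OF tm_var tm_zero] c_K zero_in)+
  moreover have "\<one> \<in> K"
    by (rule *[of "\<lambda>_ _. \<one>" c c]) (rule dz_eq[OF tm_var tm_one] c_K one_in)+
  moreover have "a \<oplus> b \<in> K" if "a \<in> K" "b \<in> K" for a b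
    by (rule *[of "(\<oplus>)", OF dz_eq[OF tm_var tm_add[OF tm_var tm_var]]]) (simp_all add: that)
  moreover have "a \<odot> b \<in> K" if "a \<in> K" "b \<in> K" for a b
    by (rule *[of "(\<odot>)", OF dz_eq[OF tm_var tm_mul[OF tm_var tm_var]]]) (simp_all add: that)
  ultimately show ?thesis by (simp add: closed_dom_def)
qed

lemma dz_merge:
  assumes P: "dz D {a, b} U P" and ab: "a \<in> D" "b \<in> D"
  shows "dz D {pr a b} U P"
proof -
  obtain P1 where P1: "dz D {b} U P1" "\<forall>e. P e = P1 (a ## e)" using dz_abstract[OF P] by auto
  obtain P2 where P2: "dz D {} U P2" "\<forall>e. P1 e = P2 (b ## e)" using dz_abstract[OF P1(1)] by auto
  have P2': "dz D {pr a b} U P2" by (rule dz_mono[OF P2(1)]) auto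
  have "dz D {pr a b} U (\<lambda>e. P2 (e 0 ## e 1 ## (\<lambda>i. e (Suc (Suc i)))))"
    by (intro dz_subst[OF P2'] tm_cons tm_var)
  from dz_unp[where B = "\<lambda>x y e. P2 (y ## x ## e)" and t = "\<lambda>e. pr a b", OF tm_const this]
  have "dz D {pr a b} U (\<lambda>e. unp D (pr a b) (\<lambda>x y. P2 (y ## x ## e)))" by simp
  moreover have "P = (\<lambda>e. unp D (pr a b) (\<lambda>x y. P2 (y ## x ## e)))"
    using P1(2) P2(2) ab by (auto simp: unp_pr fun_eq_iff)
  ultimately show ?thesis by (simp only:)
qed

lemma dz_single_parameter:
  assumes "finite F" "F \<noteq> {}" "F \<subseteq> K" "dz D F U P"
  shows "\<exists>a\<in>K. dz D {a} U P"
  using assms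
proof (induction F arbitrary: P rule: finite_ne_induct)
  case (insert a F)
  obtain P1 where P1: "dz D F U P1" "\<forall>e. P e = P1 (a ## e)" using dz_abstract[OF insert.prems(2)] by auto
  obtain b where b: "b \<in> K" "dz D {b} U P1" using insert.IH[OF _ P1(1)] insert.prems by auto
  have P1': "dz D {a, b} U P1" by (rule dz_mono[OF b(2)]) auto
  have "dz D {a, b} U (\<lambda>e. P1 (a ## e))"
    by (intro dz_subst[OF P1'] tm_cons tm_var tm_const) simp
  moreover have "P = (\<lambda>e. P1 (a ## e))" using P1(2) by blast
  ultimately have "dz D {a, b} U P" by (simp only:)
  then have "dz D {pr a b} U P" using dz_merge insert.prems(1) b K_D by blast
  then show ?case using pr_K insert.prems(1) b by blast
qed auto

text \<open>The finitely many parameters that occur are packed into one by pairing, under which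
  \<open>K\<close> is closed, and \<open>hull_witness2\<close> eliminates that one.\<close>

lemma hull_witness_AT:
  assumes Q: "dz D K {A, T} (\<lambda>e. Q (e 0) (e 1))" and u: "u \<in> D" "\<forall>v\<in>D. Q v u"
  shows "\<exists>u\<in>K. \<forall>v\<in>D. Q v u"
proof -
  obtain F where F: "finite F" "F \<subseteq> K" "dz D F {A, T} (\<lambda>e. Q (e 0) (e 1))" using dz_finite[OF Q] by auto
  \<comment> \<open>Inserting \<open>c\<close> ensures that there is at least one parameter to
    pack.\<close>
  have "dz D (insert c F) {A, T} (\<lambda>e. Q (e 0) (e 1))" by (rule dz_mono[OF F(3)]) auto
  then obtain a where a: "a \<in> K" "dz D {a} {A, T} (\<lambda>e. Q (e 0) (e 1))"
    using dz_single_parameter[of "insert c F" "{A, T}" "\<lambda>e. Q (e 0) (e 1)"] F c_K by auto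
  obtain P where P: "dz D {} {A, T} P" "\<And>e. Q (e 0) (e 1) = P (a ## e)" using dz_abstract[OF a(2)] by auto
  have P': "dz D {c} {A, T} P" by (rule dz_mono[OF P(1)]) auto
  have dzP: "dz D {c} {A, T} (\<lambda>e. P (e 2 ## e 0 ## e 1 ## (\<lambda>_. \<zero>)))"
    by (intro dz_subst[OF P'] tm_cons tm_var tm_zero)
  have eq: "Q v u = P (a ## v ## u ## (\<lambda>_. \<zero>))" for v u
    using P(2)[of "v ## u ## (\<lambda>_. \<zero>)"] by simp
  show ?thesis
    using hull_witness2[where P = "\<lambda>v u x y. P (x ## v ## u ## (\<lambda>_. \<zero>))", OF dzP a(1) a(1) u(1)] u(2)
    unfolding eq by blast
qed

end

section \<open>Elementarity of the hull\<close>

context umodel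
begin

text \<open>Both definitions have to agree with \<open>Y\<close> on all of \<open>D\<close> and not
  merely on \<open>K\<close>. They can then replace \<open>Y\<close> in formulas evaluated in
  \<open>D\<close>, where witnesses are first found.\<close>

definition SK :: "'a set set" where
  "SK = {Y \<in> S. \<exists>Q R. dz D K {A, T} (\<lambda>e. Q (e 0) (e 1)) \<and> dz D K {A, T} (\<lambda>e. R (e 0) (e 1))
     \<and> (\<forall>x\<in>D. (x \<in> Y \<longleftrightarrow> (\<exists>z\<in>D. Q z x)) \<and> (x \<in> Y \<longleftrightarrow> (\<forall>z\<in>D. R z x)))}"

lemma SK_S: "SK \<subseteq> S"
  by (auto simp: SK_def)

lemma AT_SK: "A \<in> SK" "T \<in> SK"
proof -
  have "X \<in> SK" if X: "X \<in> {A, T}" for X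
  proof -
    have "dz D K {A, T} (\<lambda>e. e 1 \<in> X)" by (intro dz_mem tm_var X)
    then have "dz D K {A, T} (\<lambda>e. e 1 \<in> X) \<and> dz D K {A, T} (\<lambda>e. e 1 \<in> X)
      \<and> (\<forall>x\<in>D. (x \<in> X \<longleftrightarrow> (\<exists>z\<in>D. x \<in> X)) \<and> (x \<in> X \<longleftrightarrow> (\<forall>z\<in>D. x \<in> X)))" using zero_in by blast
    then show ?thesis using X A T unfolding SK_def
      by (intro CollectI conjI exI[of _ "\<lambda>z x. x \<in> X"]) auto
  qed
  then show "A \<in> SK" "T \<in> SK" by auto
qed

definition Delta1 :: "((nat \<Rightarrow> 'a) \<Rightarrow> bool) \<Rightarrow> bool" where
  "Delta1 P \<longleftrightarrow> (\<exists>Q R. dz D K {A, T} Q \<and> dz D K {A, T} R \<and> (\<forall>e. (\<forall>i. e i \<in> D) \<longrightarrow>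
     (P e \<longleftrightarrow> (\<exists>z\<in>D. Q (z ## e))) \<and> (P e \<longleftrightarrow> (\<forall>z\<in>D. R (z ## e)))))"

lemma Delta1I:
  assumes "dz D K {A, T} Q" "dz D K {A, T} R"
    and "\<And>e. \<forall>i. e i \<in> D \<Longrightarrow> P e \<longleftrightarrow> (\<exists>z\<in>D. Q (z ## e))"
    and "\<And>e. \<forall>i. e i \<in> D \<Longrightarrow> P e \<longleftrightarrow> (\<forall>z\<in>D. R (z ## e))"
  shows "Delta1 P"
  unfolding Delta1_def by (rule exI[of _ Q], rule exI[of _ R]) (use assms in simp)

lemma Delta1_base:
  assumes "dz D K {A, T} P" shows "Delta1 P"
proof -
  have "dz D K {A, T} (\<lambda>e. P (\<lambda>i. e (Suc i)))"
    by (intro dz_subst[OF assms] tm_var)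
  then show ?thesis by (rule Delta1I[OF _ \<open>dz D K {A, T} (\<lambda>e. P (\<lambda>i. e (Suc i)))\<close>]) (use zero_in in auto)
qed

text \<open>Bounded quantifiers are absorbed by \<open>B\<Sigma>\<^sup>0\<^sub>1\<close>.\<close>

lemma Delta1_dz: "dz D K SK P \<Longrightarrow> Delta1 P"
proof (induction rule: dz.induct)
  case (dz_eq s t)
  show ?case by (intro Delta1_base dz.dz_eq dz_eq)
next
  case (dz_lt s t)
  show ?case by (intro Delta1_base dz.dz_lt dz_lt)
next
  case dz_False
  show ?case by (intro Delta1_base dz.dz_False)
next
  case (dz_mem t Y)
  obtain Q R where QR: "dz D K {A, T} (\<lambda>e. Q (e 0) (e 1))" "dz D K {A, T} (\<lambda>e. R (e 0) (e 1))"
    "\<forall>x\<in>D. (x \<in> Y \<longleftrightarrow> (\<exists>z\<in>D. Q z x)) \<and> (x \<in> Y \<longleftrightarrow> (\<forall>z\<in>D. R z x))"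
    using dz_mem(2) unfolding SK_def by auto
  show ?case
  proof (rule Delta1I)
    show "dz D K {A, T} (\<lambda>e. Q (e 0) (t (\<lambda>i. e (Suc i))))"
      by (rule dz_sub2[OF QR(1) tm_var tm_shift[OF dz_mem(1)]])
    show "dz D K {A, T} (\<lambda>e. R (e 0) (t (\<lambda>i. e (Suc i))))"
      by (rule dz_sub2[OF QR(2) tm_var tm_shift[OF dz_mem(1)]])
  qed (use QR(3) tm_in[OF dz_mem(1) K_D] in auto)
next
  case (dz_imp P P')
  obtain Q R where Q: "dz D K {A, T} Q" and R: "dz D K {A, T} R"
    and QR: "\<forall>e. (\<forall>i. e i \<in> D) \<longrightarrow> (P e \<longleftrightarrow> (\<exists>z\<in>D. Q (z ## e))) \<and> (P e \<longleftrightarrow> (\<forall>z\<in>D. R (z ## e)))"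
    using dz_imp.IH(1) unfolding Delta1_def by auto
  obtain Q' R' where Q': "dz D K {A, T} Q'" and R': "dz D K {A, T} R'"
    and QR': "\<forall>e. (\<forall>i. e i \<in> D) \<longrightarrow> (P' e \<longleftrightarrow> (\<exists>z\<in>D. Q' (z ## e))) \<and> (P' e \<longleftrightarrow> (\<forall>z\<in>D. R' (z ## e)))"
    using dz_imp.IH(2) unfolding Delta1_def by auto
  show ?case
  proof (rule Delta1I)
    show "dz D K {A, T} (\<lambda>e. R e \<longrightarrow> Q' e)" by (intro dz.dz_imp R Q')
    \<comment> \<open>The implication yields two universal quantifiers, one from the negated
      \<open>Q\<close> and one from \<open>R'\<close>; the variable \<open>e 0\<close> bounds both
      and merges them into one.\<close>
    show "dz D K {A, T} (\<lambda>e. \<forall>z\<in>D. z \<prec> e 0 \<longrightarrow> (\<forall>z'\<in>D. z' \<prec> e 0 \<longrightarrow>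
      Q (z ## (\<lambda>i. e (Suc i))) \<longrightarrow> R' (z' ## (\<lambda>i. e (Suc i)))))"
      by (intro dz_ball dz.dz_imp dz_subst[OF Q] dz_subst[OF R'] tm_cons tm_var)
  next
    fix e :: "nat \<Rightarrow> 'a" assume e: "\<forall>i. e i \<in> D"
    have QRe: "P e \<longleftrightarrow> (\<exists>z\<in>D. Q (z ## e))" "P e \<longleftrightarrow> (\<forall>z\<in>D. R (z ## e))"
      "P' e \<longleftrightarrow> (\<exists>z\<in>D. Q' (z ## e))" "P' e \<longleftrightarrow> (\<forall>z\<in>D. R' (z ## e))"
      using QR QR' e by metis+
    show "(P e \<longrightarrow> P' e) \<longleftrightarrow> (\<exists>z\<in>D. R (z ## e) \<longrightarrow> Q' (z ## e))"
      using QRe(2,3) zero_in by blast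
    show "(P e \<longrightarrow> P' e) \<longleftrightarrow> (\<forall>w\<in>D. \<forall>z\<in>D. z \<prec> (w ## e) 0 \<longrightarrow> (\<forall>z'\<in>D. z' \<prec> (w ## e) 0 \<longrightarrow>
      Q (z ## (\<lambda>i. (w ## e) (Suc i))) \<longrightarrow> R' (z' ## (\<lambda>i. (w ## e) (Suc i)))))" (is "_ \<longleftrightarrow> ?R")
    proof -
      have "?R \<longleftrightarrow> (\<forall>z\<in>D. \<forall>z'\<in>D. Q (z ## e) \<longrightarrow> R' (z' ## e))"
        using upper_bound2 by simp blast
      then show ?thesis using QRe(1,4) by blast
    qed
  qed
next
  case (dz_ball_env t P)
  obtain Q R where Q: "dz D K {A, T} Q" and R: "dz D K {A, T} R"
    and QR: "\<forall>e. (\<forall>i. e i \<in> D) \<longrightarrow> (P e \<longleftrightarrow> (\<exists>z\<in>D. Q (z ## e))) \<and> (P e \<longleftrightarrow> (\<forall>z\<in>D. R (z ## e)))"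
    using dz_ball_env.IH unfolding Delta1_def by auto
  note t' = tm_shift[OF dz_ball_env.hyps(1)]
  show ?case
  proof (rule Delta1I)
    show "dz D K {A, T} (\<lambda>e. \<forall>y\<in>D. y \<prec> t (\<lambda>i. e (Suc i)) \<longrightarrow> (\<exists>z\<in>D. z \<prec> e 0 \<and> Q (z ## y ## (\<lambda>i. e (Suc i)))))"
      by (intro dz_ball dz_bex dz_subst[OF Q] tm_cons tm_var t')
    show "dz D K {A, T} (\<lambda>e. \<forall>y\<in>D. y \<prec> t (\<lambda>i. e (Suc i)) \<longrightarrow> R (e 0 ## y ## (\<lambda>i. e (Suc i))))"
      by (intro dz_ball dz_subst[OF R] tm_cons tm_var t')
  next
    fix e :: "nat \<Rightarrow> 'a" assume e: "\<forall>i. e i \<in> D"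
    have te: "t e \<in> D" using tm_in[OF dz_ball_env.hyps(1) K_D] e by blast
    have ye: "\<forall>i. (y ## e) i \<in> D" if "y \<in> D" for y using e that by (simp split: nat.split)
    have QRy: "P (y ## e) \<longleftrightarrow> (\<exists>z\<in>D. Q (z ## y ## e))"
      "P (y ## e) \<longleftrightarrow> (\<forall>z\<in>D. R (z ## y ## e))" if "y \<in> D" for y
      using QR ye[OF that] by metis+
    have dzQ: "dz D D S (\<lambda>e'. Q (e' 0 ## e' 1 ## e))"
      by (intro dz_subst[OF dz_mono[OF Q K_D AT_S]] tm_cons tm_var tm_const) (use e in blast)
    show "(\<forall>y\<in>D. y \<prec> t e \<longrightarrow> P (y ## e)) \<longleftrightarrow> (\<exists>w\<in>D. \<forall>y\<in>D. y \<prec> t (\<lambda>i. (w ## e) (Suc i)) \<longrightarrow>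
      (\<exists>z\<in>D. z \<prec> (w ## e) 0 \<and> Q (z ## y ## (\<lambda>i. (w ## e) (Suc i)))))" (is "?L \<longleftrightarrow> ?R")
    proof
      assume L: ?L
      have "\<exists>n\<in>D. \<forall>y\<in>D. y \<prec> t e \<longrightarrow> (\<exists>z\<in>D. z \<prec> n \<and> Q (z ## y ## e))"
        by (rule bounding[where P = "\<lambda>z y. Q (z ## y ## e)", OF dzQ te]) (use L QRy in blast)
      then show ?R by simp
    next
      assume ?R
      then show ?L using QRy by simp blast
    qed
    show "(\<forall>y\<in>D. y \<prec> t e \<longrightarrow> P (y ## e)) \<longleftrightarrow> (\<forall>z\<in>D. \<forall>y\<in>D. y \<prec> t (\<lambda>i. (z ## e) (Suc i)) \<longrightarrow>
      R (((z ## e) 0) ## y ## (\<lambda>i. (z ## e) (Suc i))))"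
      using QRy by simp blast
  qed
qed

text \<open>The matrix is Pi^0_1 in \<open>A\<close> and \<open>T\<close>, so its unbounded
  quantifier merges with the one over \<open>v\<close>, and the statement stays Sigma^0_2 in
  \<open>A\<close> and \<open>T\<close>.\<close>

lemma hull_witness:
  assumes Q: "dz D K SK (\<lambda>e. Q (e 0) (e 1))" and u: "u \<in> D" "\<forall>v\<in>D. Q v u"
  shows "\<exists>u\<in>K. \<forall>v\<in>D. Q v u"
proof -
  obtain R where R: "dz D K {A, T} R"
    and QR: "\<And>e. (\<forall>i. e i \<in> D) \<Longrightarrow> Q (e 0) (e 1) \<longleftrightarrow> (\<forall>z\<in>D. R (z ## e))"
    using Delta1_dz[OF Q] unfolding Delta1_def by auto
  let ?e = "\<lambda>v u. v ## u ## (\<lambda>_. \<zero>)"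
  have QR': "Q v u \<longleftrightarrow> (\<forall>z\<in>D. R (z ## (?e v u)))" if "v \<in> D" "u \<in> D" for v u
    using QR[of "?e v u"] that by (simp split: nat.split)
  let ?R = "\<lambda>w u. \<forall>v\<in>D. v \<prec> w \<longrightarrow> (\<forall>z\<in>D. z \<prec> w \<longrightarrow> R (z ## (?e v u)))"
  have R': "dz D K {A, T} (\<lambda>e. ?R (e 0) (e 1))"
    by (intro dz_ball dz_subst[OF R] tm_cons tm_var tm_zero)
  have R_iff: "(\<forall>w\<in>D. ?R w u) \<longleftrightarrow> (\<forall>v\<in>D. Q v u)" if "u \<in> D" for u
    using QR' that upper_bound2 by blast
  obtain u' where "u' \<in> K" "\<forall>w\<in>D. ?R w u'"
    using hull_witness_AT[of ?R, OF R' u(1)] R_iff[OF u(1)] u(2) by auto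
  then show ?thesis using R_iff[of u'] by auto
qed

lemma hull_bex:
  assumes "dz D K SK (\<lambda>e. Q (e 1))" shows "(\<exists>u\<in>K. Q u) \<longleftrightarrow> (\<exists>u\<in>D. Q u)"
  using hull_witness[where Q = "\<lambda>v. Q", OF assms] zero_in K_in by blast

text \<open>Each component is the only solution of a Delta^0_0 condition with the pair as parameter,
  so reflection has to return that component.\<close>

lemma K_unpair:
  assumes "pr x y \<in> K" "x \<in> D" "y \<in> D" shows "x \<in> K" "y \<in> K"
proof -
  have "dz D K SK (\<lambda>e. unp D (pr x y) (\<lambda>a b. a = e 1))" "dz D K SK (\<lambda>e. unp D (pr x y) (\<lambda>a b. b = e 1))"
    by (intro dz_unp dz_eq tm_var tm_const assms)+
  from hull_bex[where Q = "\<lambda>u. unp D (pr x y) (\<lambda>a b. a = u)", OF this(1)]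
    hull_bex[where Q = "\<lambda>u. unp D (pr x y) (\<lambda>a b. b = u)", OF this(2)]
  show "x \<in> K" "y \<in> K" using assms by (auto simp: unp_pr)
qed

lemma hull_witness_pair:
  assumes Q: "dz D K SK (\<lambda>e. Q (e 0) (e 1) (e 2))" and xz: "x \<in> D" "z \<in> D" "\<forall>v\<in>D. Q v z x"
  shows "\<exists>x\<in>K. \<exists>z\<in>K. \<forall>v\<in>D. Q v z x"
proof -
  have 1: "dz D K SK (\<lambda>e. unp D (e 1) (\<lambda>x z. Q (e 0) z x))"
    by (intro dz_unp dz_sub3[OF Q] tm_var)
  obtain u where u: "u \<in> K" "\<forall>v\<in>D. unp D u (\<lambda>x z. Q v z x)"
    using hull_witness[where Q = "\<lambda>v u. unp D u (\<lambda>x z. Q v z x)", OF 1, of "pr x z"] xz by (auto simp: unp_pr)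
  obtain x' z' where xz': "x' \<in> D" "z' \<in> D" "u = pr x' z'" using u(2) zero_in unpE by metis
  then have "x' \<in> K" "z' \<in> K" using K_unpair[of x' z'] u(1) by blast+
  moreover have "\<forall>v\<in>D. Q v z' x'" using u xz' by (simp add: unp_pr)
  ultimately show ?thesis by blast
qed

text \<open>The hull need not be an initial segment of \<open>D\<close>, so even a bounded
  quantifier changes its range. A counterexample or witness below the bound is reflected into
  \<open>K\<close>.\<close>

lemma elementary_Delta00:
  "is_Delta00 p \<Longrightarrow> (\<And>i. e i \<in> K) \<Longrightarrow> (\<And>k. \<sigma> k \<in> SK) \<Longrightarrow> sat K SK e \<sigma> p = sat D S e \<sigma> p"
proof (induction arbitrary: e rule: is_Delta00.induct)
  case (6 p t)
  have tK: "val e t \<in> K" using val_closed[OF closed_K] 6 by blast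
  have IH: "sat K SK (y ## e) \<sigma> p = sat D S (y ## e) \<sigma> p" if "y \<in> K" for y
    by (rule 6) (use that 6 in \<open>auto split: nat.split\<close>)
  have dz: "dz D K SK (\<lambda>e'. e' 1 \<prec> val e t \<and> \<not> sat D S (e' 1 ## e) \<sigma> p)"
    by (intro dz_conj dz_lt dz_not dz_subst[OF dz_sat] tm_cons tm_var tm_const tK 6)
  show ?case
    using hull_bex[where Q = "\<lambda>u. u \<prec> val e t \<and> \<not> sat D S (u ## e) \<sigma> p", OF dz] by (auto simp: val_lift IH)
next
  case (7 p t)
  have tK: "val e t \<in> K" using val_closed[OF closed_K] 7 by blast
  have IH: "sat K SK (y ## e) \<sigma> p = sat D S (y ## e) \<sigma> p" if "y \<in> K" for y
    by (rule 7) (use that 7 in \<open>auto split: nat.split\<close>)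
  have dz: "dz D K SK (\<lambda>e'. e' 1 \<prec> val e t \<and> sat D S (e' 1 ## e) \<sigma> p)"
    by (intro dz_conj dz_lt dz_not dz_subst[OF dz_sat] tm_cons tm_var tm_const tK 7)
  show ?case
    using hull_bex[where Q = "\<lambda>u. u \<prec> val e t \<and> sat D S (u ## e) \<sigma> p", OF dz] by (auto simp: val_lift IH)
qed auto

lemma elementary_Sigma1:
  assumes "is_Delta00 p" "\<And>i. e i \<in> K" "\<And>k. \<sigma> k \<in> SK"
  shows "(\<exists>z\<in>K. sat K SK (z ## e) \<sigma> p) \<longleftrightarrow> (\<exists>z\<in>D. sat D S (z ## e) \<sigma> p)"
proof -
  have "dz D K SK (\<lambda>e'. sat D S (e' 1 ## e) \<sigma> p)"
    by (intro dz_subst[OF dz_sat] tm_cons tm_var tm_const assms)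
  moreover have "sat K SK (z ## e) \<sigma> p = sat D S (z ## e) \<sigma> p" if "z \<in> K" for z
    by (rule elementary_Delta00) (use that assms in \<open>auto split: nat.split\<close>)
  ultimately show ?thesis using hull_bex[where Q = "\<lambda>u. sat D S (u ## e) \<sigma> p"] by simp
qed

lemma elementary_Pi1:
  assumes "is_Delta00 p" "\<And>i. e i \<in> K" "\<And>k. \<sigma> k \<in> SK"
  shows "(\<forall>z\<in>K. sat K SK (z ## e) \<sigma> p) \<longleftrightarrow> (\<forall>z\<in>D. sat D S (z ## e) \<sigma> p)"
  using elementary_Sigma1[of "Neg p" e \<sigma>] assms is_Delta00.intros(4,5) by auto

end

section \<open>The hull as a model\<close>

lemma is_Pi0_0: "is_Pi0 0 p \<Longrightarrow> is_Delta00 p"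
  by (cases "0::nat" p rule: is_Pi0.cases) auto

lemma is_Sigma0_0: "is_Sigma0 0 p \<Longrightarrow> is_Delta00 p"
  by (cases "0::nat" p rule: is_Sigma0.cases) auto

lemma is_Sigma0_SucE: "is_Sigma0 (Suc k) p \<Longrightarrow> \<exists>q. p = ExN q \<and> is_Pi0 k q"
  by (cases "Suc k" p rule: is_Sigma0.cases) auto

lemma is_Pi0_SucE: "is_Pi0 (Suc k) p \<Longrightarrow> \<exists>q. p = AllN q \<and> is_Sigma0 k q"
  by (cases "Suc k" p rule: is_Pi0.cases) auto

lemma is_Sigma0_1E: "is_Sigma0 1 p \<Longrightarrow> \<exists>q. p = ExN q \<and> is_Delta00 q"
  using is_Sigma0_SucE[of 0 p] is_Pi0_0 by auto

lemma is_Pi0_1E: "is_Pi0 1 p \<Longrightarrow> \<exists>q. p = AllN q \<and> is_Delta00 q"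
  using is_Pi0_SucE[of 0 p] is_Sigma0_0 by auto

lemma is_Pi0_3E: "is_Pi0 3 p \<Longrightarrow> \<exists>q. p = AllN (ExN (AllN q)) \<and> is_Delta00 q"
  using is_Pi0_SucE[of 2 p] is_Sigma0_SucE[of 1] is_Pi0_1E by (force simp: numeral_3_eq_3 numeral_2_eq_2)

context ops
begin

lemma sat_bounding_fml:
  "sat D S e \<sigma> (bounding_fml p) \<longleftrightarrow>
    ((\<forall>i\<in>D. \<exists>j\<in>D. sat D S (j ## i ## e) \<sigma> p) \<longrightarrow>
     (\<forall>m\<in>D. \<exists>n\<in>D. \<forall>i\<in>D. i \<prec> m \<longrightarrow> (\<exists>j\<in>D. j \<prec> n \<and> sat D S (j ## i ## e) \<sigma> p)))"
proof -
  have "(\<lambda>k. val (j ## i ## n ## m ## e) (Var (if k < 2 then k else k + 2)))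
    = j ## i ## e" for i j m n
    by (auto simp: fun_eq_iff numeral_2_eq_2 split: nat.split)
  then show ?thesis by (auto simp: bounding_fml_def sat_subst)
qed

end

section \<open>The axioms of \<open>RCA0\<close> and Pi^0_3 formulas in the hull\<close>

context umodel
begin

text \<open>A failing induction step in \<open>D\<close> says that some \<open>x\<close> and
  \<open>z\<close> have a Pi^0_1 property. It would be reflected into \<open>K\<close>, where the
  step is assumed. So the step holds on all of \<open>D\<close> and induction in \<open>D\<close>
  applies.\<close>

lemma K_induction:
  assumes p: "is_Delta00 p" and e: "\<And>i. e i \<in> K" and \<sigma>: "\<And>k. \<sigma> k \<in> SK"
  shows "sat K SK e \<sigma> (induction_fml (ExN p))"
proof -
  let ?\<phi> = "\<lambda>z x. sat D S (z ## x ## e) \<sigma> p"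
  have elem: "sat K SK (x ## e) \<sigma> (ExN p) \<longleftrightarrow> (\<exists>z\<in>D. ?\<phi> z x)" if "x \<in> K" for x
    using elementary_Sigma1[OF p, of "x ## e" \<sigma>] that e \<sigma> by (simp split: nat.split)
  have K01: "\<zero> \<in> K" "\<And>x. x \<in> K \<Longrightarrow> x \<oplus> \<one> \<in> K" using closed_K by (auto simp: closed_dom_def)
  have "\<exists>z\<in>D. ?\<phi> z b"
    if 0: "\<exists>z\<in>D. ?\<phi> z \<zero>" and step: "\<forall>x\<in>K. (\<exists>z\<in>D. ?\<phi> z x) \<longrightarrow> (\<exists>z\<in>D. ?\<phi> z (x \<oplus> \<one>))" and b: "b \<in> K" for b
  proof (rule Sigma1_induct[where Q = ?\<phi>])
    show "dz D D S (\<lambda>e'. ?\<phi> (e' 0) (e' 1))"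
      by (intro dz_subst[OF dz_sat[OF p]] tm_cons tm_var tm_const) (use \<sigma> SK_S e in auto)
    fix x z assume xz: "x \<in> D" "z \<in> D" "?\<phi> z x"
    show "\<exists>z\<in>D. ?\<phi> z (x \<oplus> \<one>)"
    proof (rule ccontr)
      assume no: "\<not> (\<exists>z\<in>D. ?\<phi> z (x \<oplus> \<one>))"
      have dz: "dz D K SK (\<lambda>e'. ?\<phi> (e' 1) (e' 2) \<and> \<not> ?\<phi> (e' 0) (e' 2 \<oplus> \<one>))"
        by (intro dz_conj dz_not dz_subst[OF dz_sat[OF p]] tm_cons tm_var tm_add tm_one tm_const e \<sigma>)
      obtain x' z' where "x' \<in> K" "z' \<in> K" "\<forall>v\<in>D. ?\<phi> z' x' \<and> \<not> ?\<phi> v (x' \<oplus> \<one>)"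
        using hull_witness_pair[where Q = "\<lambda>v z x. ?\<phi> z x \<and> \<not> ?\<phi> v (x \<oplus> \<one>)", OF dz xz(1,2)] xz no by blast
      then show False using step zero_in K_in by blast
    qed
  qed (use 0 b in auto)
  then show ?thesis unfolding sat_induction_fml using elem K01 by simp
qed

text \<open>A disagreement of the two formulas anywhere in \<open>D\<close> would be reflected into
  \<open>K\<close>, so they agree on \<open>D\<close> and comprehension there gives a set in
  \<open>S\<close>. It belongs to \<open>SK\<close> because its two definitions can be rewritten
  with \<open>A\<close> and \<open>T\<close> as the only sets.\<close>

lemma K_comprehension:
  assumes p: "is_Delta00 p" and q: "is_Delta00 q" and e: "\<And>i. e i \<in> K" and \<sigma>: "\<And>k. \<sigma> k \<in> SK"
  shows "sat K SK e \<sigma> (comprehension_fml (ExN p) (AllN q))"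
proof -
  let ?\<phi> = "\<lambda>z x. sat D S (z ## x ## e) \<sigma> p"
  let ?\<psi> = "\<lambda>z x. sat D S (z ## x ## e) \<sigma> q"
  have elemp: "sat K SK (x ## e) \<sigma> (ExN p) \<longleftrightarrow> (\<exists>z\<in>D. ?\<phi> z x)" if "x \<in> K" for x
    using elementary_Sigma1[OF p, of "x ## e" \<sigma>] that e \<sigma> by (simp split: nat.split)
  have elemq: "sat K SK (x ## e) \<sigma> (AllN q) \<longleftrightarrow> (\<forall>z\<in>D. ?\<psi> z x)" if "x \<in> K" for x
    using elementary_Pi1[OF q, of "x ## e" \<sigma>] that e \<sigma> by (simp split: nat.split)
  note inst = dz_subst[OF dz_sat[OF p \<sigma>]] dz_subst[OF dz_sat[OF q \<sigma>]] tm_cons tm_const[OF e]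
  have "\<exists>X\<in>SK. \<forall>x\<in>K. x \<in> X \<longleftrightarrow> (\<exists>z\<in>D. ?\<phi> z x)"
    if eq: "\<forall>x\<in>K. (\<exists>z\<in>D. ?\<phi> z x) \<longleftrightarrow> (\<forall>z\<in>D. ?\<psi> z x)"
  proof -
    have eqD: "(\<exists>z\<in>D. ?\<phi> z x) \<longleftrightarrow> (\<forall>z\<in>D. ?\<psi> z x)" if x: "x \<in> D" for x
    proof (rule ccontr)
      assume "\<not> ?thesis"
      then consider "\<exists>z\<in>D. ?\<phi> z x" "\<exists>z\<in>D. \<not> ?\<psi> z x" | "\<forall>z\<in>D. \<not> ?\<phi> z x \<and> ?\<psi> z x" by blast
      then show False
      proof cases
        case 1
        then obtain z z' w where z: "z \<in> D" "?\<phi> z x" "z' \<in> D" "\<not> ?\<psi> z' x" "w \<in> D" "z \<prec> w" "z' \<prec> w"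
          using upper_bound2 by blast
        let ?Q = "\<lambda>v w x. (\<exists>z\<in>D. z \<prec> w \<and> ?\<phi> z x) \<and> (\<exists>z\<in>D. z \<prec> w \<and> \<not> ?\<psi> z x)"
        have "dz D K SK (\<lambda>e'. ?Q (e' 0) (e' 1) (e' 2))"
          by (intro dz_conj dz_bex dz_not inst tm_var)
        from hull_witness_pair[of ?Q, OF this x z(5)] obtain x' w' where "x' \<in> K" "\<forall>v\<in>D. ?Q v w' x'"
          using z by blast
        then show False using eq zero_in by blast
      next
        case 2
        have "dz D K SK (\<lambda>e'. \<not> ?\<phi> (e' 0) (e' 1) \<and> ?\<psi> (e' 0) (e' 1))"
          by (intro dz_conj dz_not inst tm_var)
        from hull_witness[where Q = "\<lambda>z x. \<not> ?\<phi> z x \<and> ?\<psi> z x", OF this x 2] show False using eq zero_in by blast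
      qed
    qed
    have dzK: "dz D K SK (\<lambda>e'. ?\<phi> (e' 0) (e' 1))" "dz D K SK (\<lambda>e'. ?\<psi> (e' 0) (e' 1))"
      by (intro inst tm_var)+
    note dzD = dz_mono[OF dzK(1) K_D SK_S] dz_mono[OF dzK(2) K_D SK_S]
    obtain X where X: "X \<in> S" "\<forall>x\<in>D. x \<in> X \<longleftrightarrow> (\<exists>z\<in>D. ?\<phi> z x)"
      using comprehension[of ?\<phi> ?\<psi>, OF dzD eqD] by blast
    obtain Q where Q: "dz D K {A, T} Q"
      and Q_iff: "\<And>e. (\<forall>i. e i \<in> D) \<Longrightarrow> ?\<phi> (e 0) (e 1) \<longleftrightarrow> (\<exists>z\<in>D. Q (z ## e))"
      using Delta1_dz[OF dzK(1)] unfolding Delta1_def by auto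
    obtain R where R: "dz D K {A, T} R"
      and R_iff: "\<And>e. (\<forall>i. e i \<in> D) \<Longrightarrow> ?\<psi> (e 0) (e 1) \<longleftrightarrow> (\<forall>z\<in>D. R (z ## e))"
      using Delta1_dz[OF dzK(2)] unfolding Delta1_def by auto
    let ?e = "\<lambda>z x. z ## x ## (\<lambda>_. \<zero>)"
    have Q1: "?\<phi> z x \<longleftrightarrow> (\<exists>y\<in>D. Q (y ## (?e z x)))" and R1: "?\<psi> z x \<longleftrightarrow> (\<forall>y\<in>D. R (y ## (?e z x)))"
      if "z \<in> D" "x \<in> D" for z x
      using Q_iff[of "?e z x"] R_iff[of "?e z x"] that by (simp_all split: nat.split)
    let ?Q = "\<lambda>w x. \<exists>z\<in>D. z \<prec> w \<and> (\<exists>y\<in>D. y \<prec> w \<and> Q (y ## (?e z x)))"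
    let ?R = "\<lambda>w x. \<forall>z\<in>D. z \<prec> w \<longrightarrow> (\<forall>y\<in>D. y \<prec> w \<longrightarrow> R (y ## (?e z x)))"
    have "dz D K {A, T} (\<lambda>e. ?Q (e 0) (e 1))" "dz D K {A, T} (\<lambda>e. ?R (e 0) (e 1))"
      by (intro dz_bex dz_ball dz_subst[OF Q] dz_subst[OF R] tm_cons tm_var tm_zero)+
    moreover have "x \<in> X \<longleftrightarrow> (\<exists>w\<in>D. ?Q w x)" if "x \<in> D" for x
      using X that Q1[OF _ that] upper_bound2 by blast
    moreover have "x \<in> X \<longleftrightarrow> (\<forall>w\<in>D. ?R w x)" if "x \<in> D" for x
      using X that eqD[OF that] R1[OF _ that] upper_bound2 by blast
    ultimately have "X \<in> SK"
      unfolding SK_def using X(1) by (intro CollectI conjI exI[of _ ?Q] exI[of _ ?R]) auto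
    then show ?thesis using X(2) K_in by blast
  qed
  then show ?thesis unfolding sat_comprehension_fml using elemp elemq by simp
qed

lemma K_models: "models K SK RCA0"
  unfolding models_def
proof (intro conjI ballI allI impI)
  show "closed_dom K" by (rule closed_K)
  show "SK \<noteq> {}" using AT_SK by blast
 fix p and e :: "nat \<Rightarrow> 'a" and \<sigma> :: "nat \<Rightarrow> 'a set"
  assume p: "p \<in> RCA0" and e: "\<forall>i. e i \<in> K" and \<sigma>: "\<forall>k. \<sigma> k \<in> SK"
  have closure: "sat K SK e \<sigma> (univ_closure q)"
    if "\<And>e \<sigma>. (\<And>i. e i \<in> K) \<Longrightarrow> (\<And>k. \<sigma> k \<in> SK) \<Longrightarrow> sat K SK e \<sigma> q" for q
    using sat_univ_closure[of e K \<sigma> SK q] that e \<sigma> by blast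
  consider "p \<in> basic_axioms" | q where "p = univ_closure (induction_fml q)" "is_Sigma0 1 q"
    | q r where "p = univ_closure (comprehension_fml q r)" "is_Sigma0 1 q" "is_Pi0 1 r"
    using p unfolding RCA0_def by blast
  then show "sat K SK e \<sigma> p"
  proof cases
    case 1
    have ax: "sat K SK e \<sigma> (univ_closure q)"
      if "\<And>e \<sigma>. e 0 \<in> D \<Longrightarrow> e (Suc 0) \<in> D \<Longrightarrow> sat K SK e \<sigma> q" for q
      by (rule closure) (use that K_in in blast)
    show ?thesis
      using 1 unfolding basic_axioms_def image_insert image_empty
    proof (elim insertE emptyE; hypsubst_thin)
      show "sat K SK e \<sigma> (univ_closure (Imp (Eq (Add (Var 0) One) (Add (Var 1) One)) (Eq (Var 0) (Var 1))))"
        by (rule ax) (use succ_inj in \<open>simp; blast\<close>)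
      show "sat K SK e \<sigma> (univ_closure (Iff (Lt (Var 0) (Add (Var 1) One)) (Dis (Lt (Var 0) (Var 1)) (Eq (Var 0) (Var 1)))))"
        by (rule ax) (use less_succ in \<open>simp; blast\<close>)
    qed (rule ax, simp add: succ_not_zero add_zero add_succ mul_zero mul_succ not_less_zero)+
  next
    case 2
    then obtain r where "q = ExN r" "is_Delta00 r" using is_Sigma0_1E by blast
    then show ?thesis unfolding 2 by (intro closure) (simp add: K_induction del: sat.simps)
  next
    case 3
    then obtain q' r' where "q = ExN q'" "is_Delta00 q'" "r = AllN r'" "is_Delta00 r'"
      using is_Sigma0_1E is_Pi0_1E by meson
    then show ?thesis unfolding 3 by (intro closure) (simp add: K_comprehension del: sat.simps)
  qed
qed

text \<open>For fixed \<open>x\<close> in \<open>K\<close> the rest of the formula is Sigma^0_2 with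
  parameters from the hull, so its witness can be taken in \<open>K\<close>.\<close>

lemma K_Pi3:
  assumes "is_Pi0 3 \<Psi>" and e: "\<And>i. e i \<in> K" and \<sigma>: "\<And>k. \<sigma> k \<in> SK" and sat: "sat D S e \<sigma> \<Psi>"
  shows "sat K SK e \<sigma> \<Psi>"
proof -
  obtain q where q: "\<Psi> = AllN (ExN (AllN q))" "is_Delta00 q" using is_Pi0_3E assms(1) by blast
  have "\<exists>y\<in>K. \<forall>z\<in>K. sat K SK (z ## y ## x ## e) \<sigma> q" if x: "x \<in> K" for x
  proof -
    let ?e = "x ## e"
    have xe: "?e i \<in> K" for i using x e by (simp split: nat.split)
    obtain y where y: "y \<in> D" "\<forall>z\<in>D. sat D S (z ## y ## ?e) \<sigma> q"
      using sat K_in[OF x] unfolding q(1) by auto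
    have "dz D K SK (\<lambda>e'. sat D S (e' 0 ## e' 1 ## ?e) \<sigma> q)"
      by (intro dz_subst[OF dz_sat[OF q(2) \<sigma>]] tm_cons tm_var tm_const xe e x)
    from hull_witness[where Q = "\<lambda>z y. sat D S (z ## y ## ?e) \<sigma> q", OF this y]
    obtain y' where y': "y' \<in> K" "\<forall>z\<in>D. sat D S (z ## y' ## ?e) \<sigma> q" by blast
    have "(y' ## ?e) i \<in> K" for i using y' xe by (simp split: nat.split)
    then show ?thesis using elementary_Pi1[OF q(2), of "y' ## ?e" \<sigma>] y' \<sigma> by blast
  qed
  then show ?thesis unfolding q(1) by auto
qed

text \<open>\<open>Dl s i r x\<close> is the \<open>\<Delta>\<^sup>0\<^sub>0\<close> matrix of ``\<open>x\<close> is the element of the hull with index \<open>i\<close>'': \<open>r\<close>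
  consists of the least \<open>t\<close> with \<open>\<forall>s \<langle>i,t,s\<rangle> \<in> T\<close>, whose first component is \<open>x\<close>, and of a bound for
  witnesses that no smaller \<open>t\<close> has this property.\<close>

definition Dl :: "'a \<Rightarrow> 'a \<Rightarrow> 'a \<Rightarrow> 'a \<Rightarrow> bool" where
  "Dl s i r x \<longleftrightarrow> unp D r (\<lambda>t w. unp D t (\<lambda>x' y. x' = x) \<and> tr i t s \<in> T
     \<and> (\<forall>t'\<in>D. t' \<prec> t \<longrightarrow> (\<exists>s'\<in>D. s' \<prec> w \<and> tr i t' s' \<notin> T)))"

lemma dz_Dl: "tm C s \<Longrightarrow> tm C i \<Longrightarrow> tm C r \<Longrightarrow> tm C x \<Longrightarrow> dz D C {A, T} (\<lambda>e. Dl (s e) (i e) (r e) (x e))"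
proof -
  have *: "dz D C {A, T} (\<lambda>e. Dl (e 0) (e 1) (e 2) (e 3))"
    unfolding Dl_def
    by (intro dz_unp dz_conj dz_mem dz_ball dz_bex dz_not dz_eq tm_tr tm_var) simp_all
  assume "tm C s" "tm C i" "tm C r" "tm C x"
  then show ?thesis by (rule dz_sub4[OF *])
qed

section \<open>Failure of Sigma^0_2 bounding in the hull\<close>

lemma Dl_exists: assumes "x \<in> K" shows "\<exists>n. \<exists>r\<in>D. \<forall>s\<in>D. Dl s (nm n) r x"
proof -
  obtain n y where y: "y \<in> D" "isleast n (pr x y)" using assms unfolding K_def by blast
  have "\<exists>w\<in>D. \<forall>t'\<in>D. t' \<prec> pr x y \<longrightarrow> (\<exists>s\<in>D. s \<prec> w \<and> tr (nm n) t' s \<notin> T)"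
  proof (rule bounding[where P = "\<lambda>s t'. tr (nm n) t' s \<notin> T"])
    show "dz D D S (\<lambda>e. tr (nm n) (e 1) (e 0) \<notin> T)" by (intro dz_not dz_mem tm_tr tm_nm tm_var T)
  qed (use y in \<open>auto simp: isleast_def\<close>)
  then obtain w where w: "w \<in> D" "\<forall>t'\<in>D. t' \<prec> pr x y \<longrightarrow> (\<exists>s\<in>D. s \<prec> w \<and> tr (nm n) t' s \<notin> T)" by blast
  have "Dl s (nm n) (pr (pr x y) w) x" if "s \<in> D" for s
    using y w assms that unfolding Dl_def isleast_def by (simp add: unp_pr)
  then show ?thesis using y w assms by (intro exI[of _ n] bexI[of _ "pr (pr x y) w"]) auto
qed

text \<open>This holds for every \<open>i\<close>, standard or not: the numbers \<open>t\<close>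
  given by \<open>i\<close> have at most one least element, whatever bound on refutations is stored
  along with it.\<close>

lemma Dl_unique:
  assumes "\<forall>s\<in>D. Dl s i r x" "\<forall>s\<in>D. Dl s i r' x'"
  shows "x = x'"
proof -
  have least: "\<exists>t\<in>D. unp D t (\<lambda>a y. a = x) \<and> (\<forall>s\<in>D. tr i t s \<in> T) \<and> (\<forall>u\<in>D. u \<prec> t \<longrightarrow> (\<exists>s\<in>D. tr i u s \<notin> T))"
    if Dl: "\<forall>s\<in>D. Dl s i r x" for r x
  proof -
    have "Dl \<zero> i r x" using Dl zero_in by blast
    then obtain t w where t: "t \<in> D" "w \<in> D" "r = pr t w" unfolding Dl_def by (rule unpE)
    have "\<forall>s\<in>D. unp D t (\<lambda>a y. a = x) \<and> tr i t s \<in> T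
        \<and> (\<forall>u\<in>D. u \<prec> t \<longrightarrow> (\<exists>s'\<in>D. s' \<prec> w \<and> tr i u s' \<notin> T))"
      using Dl t unfolding Dl_def by (simp add: unp_pr)
    then show ?thesis using t(1) zero_in by blast
  qed
  obtain t t' where t: "t \<in> D" "unp D t (\<lambda>a y. a = x)" "\<forall>s\<in>D. tr i t s \<in> T" "\<forall>u\<in>D. u \<prec> t \<longrightarrow> (\<exists>s\<in>D. tr i u s \<notin> T)"
    and t': "t' \<in> D" "unp D t' (\<lambda>a y. a = x')" "\<forall>s\<in>D. tr i t' s \<in> T" "\<forall>u\<in>D. u \<prec> t' \<longrightarrow> (\<exists>s\<in>D. tr i u s \<notin> T)"
    using least[OF assms(1)] least[OF assms(2)] by blast
  have "t = t'" using less_linear[of t t'] t t' by blast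
  moreover obtain a y where "a \<in> D" "y \<in> D" "t = pr a y" "a = x" using t(2) by (rule unpE)
  ultimately show ?thesis using t'(2) unp_pr[of a y "\<lambda>a y. a = x'"] by blast
qed

text \<open>The instance of bounding asks, for each \<open>x\<close>, for a pair of an index below
  \<open>c\<close> and the data \<open>r\<close> belonging to it. A bound on these pairs still
  leaves the relation between index and element Pi^0_1. Sigma^0_1 bounding in the hull then makes it
  Delta^0_0 on the relevant range, so that the diagonal set can be coded.\<close>

lemma K_not_bounding: "\<exists>p e \<sigma>. is_Sigma0 2 p \<and> (\<forall>i. e i \<in> K) \<and> (\<forall>k. \<sigma> k \<in> SK) \<and> \<not> sat K SK e \<sigma> (bounding_fml p)"
proof -
  interpret H: rca zero one add mul less K SK by (rule models_RCA0_rca[OF K_models])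
  let ?z = "\<lambda>_::nat. \<zero>"
  have K0: "\<zero> \<in> K" using closed_K by (simp add: closed_dom_def)
  have AT: "{A, T} \<subseteq> SK" using AT_SK by blast
  have "dz D {} {A, T} (\<lambda>e. Dl (e 0) (e 1) (e 2) (e 3))" by (intro dz_Dl tm_var)
  from dz_represent[OF this, of A S] obtain q \<sigma> where q: "is_Delta00 q" "\<And>k. \<sigma> k \<in> {A, T}"
    "\<And>e. Dl (e 0) (e 1) (e 2) (e 3) = sat D S e \<sigma> q" by auto
  have \<sigma>: "\<sigma> k \<in> SK" for k using q(2)[of k] AT by blast
  let ?v = "\<lambda>i r x. i ## r ## x ## ?z"
  define DK where "DK = (\<lambda>s i r x. sat K SK (s ## (?v i r x)) \<sigma> q)"
  have DK: "DK s i r x = Dl s i r x" if "s \<in> K" "i \<in> K" "r \<in> K" "x \<in> K" for s i r x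
  proof -
    have "DK s i r x = sat D S (s ## (?v i r x)) \<sigma> q"
      unfolding DK_def by (rule elementary_Delta00[OF q(1)]) (use that K0 \<sigma> in \<open>auto split: nat.split\<close>)
    then show ?thesis using q(3)[of "s ## (?v i r x)"] by (simp add: numeral_2_eq_2 numeral_3_eq_3)
  qed
  have DK_all: "(\<forall>s\<in>K. DK s i r x) \<longleftrightarrow> (\<forall>s\<in>D. Dl s i r x)" if "i \<in> K" "r \<in> K" "x \<in> K" for i r x
  proof -
    have "(\<forall>s\<in>K. DK s i r x) \<longleftrightarrow> (\<forall>s\<in>D. sat D S (s ## (?v i r x)) \<sigma> q)"
      unfolding DK_def by (rule elementary_Pi1[OF q(1)]) (use that K0 \<sigma> in \<open>auto split: nat.split\<close>)
    moreover have "Dl s i r x = sat D S (s ## (?v i r x)) \<sigma> q" for s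
      using q(3)[of "s ## (?v i r x)"] by (simp add: numeral_2_eq_2 numeral_3_eq_3)
    ultimately show ?thesis by simp
  qed
  have dzDK: "dz K K SK (\<lambda>e. DK (s e) (i e) (r e) (x e))"
    if tms: "tm K s" "tm K i" "tm K r" "tm K x" for s i r x
    unfolding DK_def by (intro dz_subst[OF dz_sat[OF q(1) \<sigma>]] tm_cons tm_zero tms)
  let ?F = "\<lambda>s j x. unp D j (\<lambda>i r. i \<prec> c \<and> Dl s i r x)"
  \<comment> \<open>Position 1 is kept for a dummy existential quantifier, which gives the Pi^0_1
    condition the prefix of a Sigma^0_2 formula. Position 4 is the first parameter and will hold
    \<open>c\<close>.\<close>
  have "dz D {} {A, T} (\<lambda>e. unp D (e 2) (\<lambda>i r. i \<prec> e 4 \<and> Dl (e 0) i r (e 3)))"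
    by (intro dz_unp dz_conj dz_lt dz_Dl tm_var)
  from dz_represent[OF this, of A S] obtain p \<tau> where p: "is_Delta00 p" "\<And>k. \<tau> k \<in> {A, T}"
    "\<And>e. unp D (e 2) (\<lambda>i r. i \<prec> e 4 \<and> Dl (e 0) i r (e 3)) = sat D S e \<tau> p" by auto
  have \<tau>: "\<tau> k \<in> SK" for k using p(2)[of k] AT by blast
  let ?e = "\<lambda>_::nat. c"
  have satp: "sat K SK (j ## x ## ?e) \<tau> (ExN (AllN p)) \<longleftrightarrow> (\<forall>s\<in>D. ?F s j x)"
    if jx: "j \<in> K" "x \<in> K" for j x
  proof -
    have "(\<forall>s\<in>K. sat K SK (s ## w ## j ## x ## ?e) \<tau> p)
      \<longleftrightarrow> (\<forall>s\<in>D. sat D S (s ## w ## j ## x ## ?e) \<tau> p)" if "w \<in> K" for w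
      by (rule elementary_Pi1[OF p(1)]) (use jx that c_K \<tau> in \<open>auto split: nat.split\<close>)
    moreover have "sat D S (s ## w ## j ## x ## ?e) \<tau> p \<longleftrightarrow> ?F s j x" for s w
      using p(3)[of "s ## w ## j ## x ## ?e"]
      by (simp add: numeral_2_eq_2 numeral_3_eq_3 eval_nat_numeral)
    ultimately have "(\<exists>w\<in>K. \<forall>s\<in>K. sat K SK (s ## w ## j ## x ## ?e) \<tau> p)
      \<longleftrightarrow> (\<exists>w\<in>K. \<forall>s\<in>D. ?F s j x)" by simp
    moreover have "\<exists>w. w \<in> K" using K0 by blast
    ultimately show ?thesis by simp
  qed
  have ex: "\<exists>j\<in>K. \<forall>s\<in>D. ?F s j x" if x: "x \<in> K" for x
  proof -
    obtain n r where r: "r \<in> D" "\<forall>s\<in>D. Dl s (nm n) r x" using Dl_exists[OF x] by blast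
    have "dz D K {A, T} (\<lambda>e. unp D (e 1) (\<lambda>i r. i \<prec> c \<and> Dl (e 0) i r x))"
      by (intro dz_unp dz_conj dz_lt dz_Dl tm_var tm_const c_K x)
    then have dzF: "dz D K SK (\<lambda>e. ?F (e 0) (e 1) x)" by (rule dz_mono[OF _ subset_refl AT])
    \<comment> \<open>The pair with the standard index is only known to lie in \<open>D\<close>.
      Reflection produces a pair in \<open>K\<close>, possibly with another index below
      \<open>c\<close>; the condition \<open>i \<prec> c\<close> is expressible, standardness is
      not.\<close>
    have "\<forall>s\<in>D. ?F s (pr (nm n) r) x" using r nm_c by (simp add: unp_pr)
    then show ?thesis using hull_witness[where Q = "\<lambda>s j. ?F s j x", OF dzF, of "pr (nm n) r"] r by simp
  qed
  have "\<not> sat K SK ?e \<tau> (bounding_fml (ExN (AllN p)))"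
  proof
    assume "sat K SK ?e \<tau> (bounding_fml (ExN (AllN p)))"
    then have bounded: "\<forall>m\<in>K. \<exists>n\<in>K. \<forall>x\<in>K. x \<prec> m \<longrightarrow> (\<exists>j\<in>K. j \<prec> n \<and> (\<forall>s\<in>D. ?F s j x))"
      unfolding sat_bounding_fml using satp ex by (simp del: sat.simps)
    \<comment> \<open>The bound \<open>B\<close> is fixed before the set to be coded, so all
      potential codes can be submitted to bounding before the diagonal set is defined.\<close>
    obtain m B where mB: "m \<in> K" "B \<in> K" and code: "\<And>X. dz K K SK (\<lambda>e. X (e 0)) \<Longrightarrow>
      \<exists>x\<in>K. x \<preceq> B \<and> (\<forall>i\<in>K. i \<prec> c \<longrightarrow> (cd K x m i \<longleftrightarrow> X i))" using H.code_exists[OF c_K] by blast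
    obtain b where b: "b \<in> K" "\<forall>x\<in>K. x \<preceq> B \<longrightarrow> (\<exists>j\<in>K. j \<prec> b \<and> (\<forall>s\<in>D. ?F s j x))"
      using bounded[rule_format, of "B \<oplus> \<one>"] mB by auto
    have b': "\<exists>i\<in>K. \<exists>r\<in>K. i \<prec> c \<and> i \<prec> b \<and> r \<prec> b \<and> (\<forall>s\<in>K. DK s i r x)" if x: "x \<in> K" "x \<preceq> B" for x
    proof -
      obtain j where j: "j \<in> K" "j \<prec> b" "\<forall>s\<in>D. ?F s j x" using b x by blast
      then have "?F \<zero> j x" using zero_in by blast
      then obtain i r where ir: "i \<in> D" "r \<in> D" "j = pr i r" "i \<prec> c" by (elim unpE) blast
      then have irK: "i \<in> K" "r \<in> K" using K_unpair[of i r] j(1) by blast+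
      have "\<forall>s\<in>D. Dl s i r x" using j(3) ir by (simp add: unp_pr)
      then have "\<forall>s\<in>K. DK s i r x" using DK_all irK x by blast
      moreover have "i \<prec> b" "r \<prec> b"
        using le_less_trans[of i j b] le_less_trans[of r j b] pr_le1[of i r] pr_le2[of i r] ir j(2) K_in[OF j(1)] K_in[OF b(1)] by auto
      ultimately show ?thesis using irK ir(4) by blast
    qed
    let ?C = "\<lambda>s k. unp K k (\<lambda>i l. unp K l (\<lambda>l1 l2. unp K l1 (\<lambda>r x. unp K l2 (\<lambda>r' x'.
      x \<noteq> x' \<and> DK s i r x \<and> DK s i r' x'))))"
    \<comment> \<open>Pairing is monotone, so every tuple with index and \<open>r\<close> components
      below \<open>b\<close> and elements up to \<open>B\<close> is coded below
      \<open>N\<close>.\<close>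
    define N where "N = pr b (pr (pr b B) (pr b B)) \<oplus> \<one>"
    have NK: "N \<in> K" using b(1) mB by (simp add: N_def)
    \<comment> \<open>No tuple exhibits two distinct elements with the same index, so each has a
      refuting \<open>s\<close>. Below the common bound \<open>L\<close> of these, checking
      \<open>DK\<close> already guarantees uniqueness.\<close>
    have "\<exists>L\<in>K. \<forall>k\<in>K. k \<prec> N \<longrightarrow> (\<exists>s\<in>K. s \<prec> L \<and> \<not> ?C s k)"
    proof (rule H.bounding[where P = "\<lambda>s k. \<not> ?C s k", OF _ NK])
      show "dz K K SK (\<lambda>e. \<not> ?C (e 0) (e 1))"
        by (intro dz_not dz_unp dz_conj dz_eq dzDK tm_var)
      fix k assume k: "k \<in> K"
      show "\<exists>s\<in>K. \<not> ?C s k"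
      proof (rule ccontr)
        assume "\<not> (\<exists>s\<in>K. \<not> ?C s k)"
        then have C: "\<forall>s\<in>K. ?C s k" by blast
        then have "?C \<zero> k" using K0 by blast
        then obtain i r x r' x' where *: "i \<in> K" "r \<in> K" "x \<in> K" "r' \<in> K" "x' \<in> K"
          "k = pr i (pr (pr r x) (pr r' x'))" by (elim H.unpE) blast
        then have "\<forall>s\<in>K. x \<noteq> x' \<and> DK s i r x \<and> DK s i r' x'" using C by (simp add: H.unp_pr)
        then have "x \<noteq> x'" "\<forall>s\<in>K. DK s i r x" "\<forall>s\<in>K. DK s i r' x'" using K0 by blast+
        then show False using DK_all * Dl_unique[of i r x r' x'] by blast
      qed
    qed
    then obtain L where L: "L \<in> K" "\<forall>k\<in>K. k \<prec> N \<longrightarrow> (\<exists>s\<in>K. s \<prec> L \<and> \<not> ?C s k)" by blast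
    have func: "x = x'" if D: "i \<in> K" "r \<in> K" "x \<in> K" "r' \<in> K" "x' \<in> K"
      and less: "i \<prec> b" "r \<prec> b" "r' \<prec> b" "x \<preceq> B" "x' \<preceq> B"
      and DKs: "\<forall>s\<in>K. s \<prec> L \<longrightarrow> DK s i r x" "\<forall>s\<in>K. s \<prec> L \<longrightarrow> DK s i r' x'" for i r x r' x'
    proof (rule ccontr)
      assume ne: "x \<noteq> x'"
      let ?k = "pr i (pr (pr r x) (pr r' x'))"
      have "?k \<prec> N" unfolding N_def using D less b(1) mB by (intro H.pr_mono) (simp_all add: H.less_le)
      moreover have "?k \<in> K" using D by simp
      ultimately obtain s where "s \<in> K" "s \<prec> L" "\<not> ?C s ?k" using L(2) by blast
      then show False using ne DKs D by (simp add: H.unp_pr)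
    qed
    \<comment> \<open>Diagonal set: \<open>i\<close> belongs to it if an element up to
      \<open>B\<close> that has index \<open>i\<close>, as far as \<open>b\<close> and
      \<open>L\<close> can tell, codes a set without \<open>i\<close>. All quantifiers are bounded,
      so the set has a code up to \<open>B\<close>, and that code has an index of its own.\<close>
    let ?X = "\<lambda>i. \<exists>x\<in>K. x \<preceq> B \<and> (\<exists>r\<in>K. r \<prec> b \<and> (\<forall>s\<in>K. s \<prec> L \<longrightarrow> DK s i r x) \<and> \<not> cd K x m i)"
    have "dz K K SK (\<lambda>e. ?X (e 0))"
      by (intro dz_bex dz_conj dz_ball dz_not dz_cd dzDK tm_var tm_add tm_one tm_const mB b(1) L(1))
    from code[OF this] obtain x where x: "x \<in> K" "x \<preceq> B" "\<forall>i\<in>K. i \<prec> c \<longrightarrow> (cd K x m i \<longleftrightarrow> ?X i)" by blast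
    obtain i r where ir: "i \<in> K" "r \<in> K" "i \<prec> c" "i \<prec> b" "r \<prec> b" "\<forall>s\<in>K. DK s i r x"
      using b'[OF x(1,2)] by blast
    have "cd K x m i \<longleftrightarrow> ?X i" using x(3) ir by blast
    moreover have "?X i \<longleftrightarrow> \<not> cd K x m i"
    proof
      assume "?X i"
      then obtain x' r' where "x' \<in> K" "x' \<preceq> B" "r' \<in> K" "r' \<prec> b" "\<forall>s\<in>K. s \<prec> L \<longrightarrow> DK s i r' x'" "\<not> cd K x' m i"
        by blast
      then show "\<not> cd K x m i" using func[of i r x r' x'] ir x by blast
    next
      assume "\<not> cd K x m i"
      then show "?X i" using x(1,2) ir by blast
    qed
    ultimately show False by blast
  qed
  moreover have "is_Sigma0 2 (ExN (AllN p))"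
    using is_Sigma0_is_Pi0.intros(3)[OF Pi1_AllN[OF p(1)]] by (simp add: numeral_2_eq_2)
  ultimately show ?thesis
    using \<tau> c_K by (intro exI[of _ "ExN (AllN p)"] exI[of _ ?e] exI[of _ \<tau>] conjI allI)
qed

end

theorem theorem3p4:
  fixes \<Psi> :: fml
  assumes "is_Pi0 3 \<Psi>"
    and "is_sentence (ExS (AllS \<Psi>))"
    and "is_consistent (RCA0 \<union> {ExS (AllS \<Psi>)})"
  shows "\<not> proves_scheme (RCA0 \<union> {ExS (AllS \<Psi>)}) (BSigma0 2)"
proof
  assume prov: "proves_scheme (RCA0 \<union> {ExS (AllS \<Psi>)}) (BSigma0 2)"
  obtain z :: "trm set" and u a m l D S A T c where U: "ops.universal_model z u a m l D S A T c \<Psi>"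
    using universal_model_exists[OF assms(2,3)] by blast
  interpret ops z u a m l .
  have M: "models D S RCA0" using U by (simp add: universal_model_def)
  interpret rca z u a m l D S by (rule models_RCA0_rca[OF M])
  interpret umodel z u a m l D S A T c
    by unfold_locales (use U in \<open>auto simp: universal_model_def\<close>)
  obtain p e \<sigma> where p: "is_Sigma0 2 p" "\<forall>i. e i \<in> K" "\<forall>k. \<sigma> k \<in> SK" "\<not> sat K SK e \<sigma> (bounding_fml p)"
    using K_not_bounding by blast
  have "sat K SK e (Y ## A ## \<sigma>) \<Psi>" if "Y \<in> SK" for Y
  proof (rule K_Pi3[OF assms(1)])
    show "sat D S e (Y ## A ## \<sigma>) \<Psi>"
      using U that SK_S p(2) K_in unfolding universal_model_def by blast
  qed (use p that AT_SK in \<open>auto split: nat.split\<close>)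
  then have "sat K SK e \<sigma> (ExS (AllS \<Psi>))" using AT_SK by auto
  moreover have "sat K SK e \<sigma> q" if "q \<in> RCA0" for q
    using K_models p(2,3) that unfolding models_def by blast
  ultimately have sat: "sat K SK e \<sigma> q" if "q \<in> RCA0 \<union> {ExS (AllS \<Psi>)}" for q
    using that by blast
  have "RCA0 \<union> {ExS (AllS \<Psi>)} \<turnstile> univ_closure (bounding_fml p)"
    using prov p(1) unfolding proves_scheme_def BSigma0_def by blast
  then have "sat K SK e \<sigma> (univ_closure (bounding_fml p))"
    by (rule soundness[OF _ closed_K]) (use p sat in auto)
  then show False using sat_univ_closure[of e K \<sigma> SK "bounding_fml p"] p by blast
qed

end
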